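(* WMISP restricted to $W_5$-free tournaments can be solved in polynomial time.
   Context: All tournaments are finite. A tournament $G$ is $H$-free if no induced subtournament of $G$ is isomorphic to $H$. $W_5$ is the tournament with vertex set $\{v, w_1, w_2, w_3, w_4\}$ such that $w_i \to w_j$ whenever $i<j$, and $w_2 \to v$, $w_4 \to v$, $v \to w_1$, $v \to w_3$. A set $X \subseteq V(G)$ is independent if $G[X]$ is transitive (acyclic). WMISP: given a tournament $G$ and a weight function $w: V(G)\to \mathbb{Q}_+$, find the maximum total weight of an independent set of $G$. *)

theory Defs
  imports
    "HOL-Computational_Algebra.Polynomial"
    "HOL-Library.Discrete_Functions"
begin

section \<open>Random access machines and polynomial time\<close>

text \<open>
  The machine model is the random access machine under the logarithmic cost criterion (Aho,
  Hopcroft, Ullman, \<^emph>\<open>The Design and Analysis of Computer Algorithms\<close>, Sections 1.2 and 1.3), which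
  is polynomially equivalent to the multitape Turing machine.  Programs are given in structured
  form.  The memory is divided into banks, each an infinite array of natural numbers; bank names
  are literals of the program text, so a program only uses finitely many banks.  A scalar register
  is cell 0 of a bank.
\<close>

type_synonym state = "nat \<Rightarrow> nat \<Rightarrow> nat"

datatype aexp =
    Const nat
  | Rd nat aexp
  | Add aexp aexp
  | Sub aexp aexp
  | Mult aexp aexp
  | Div aexp aexp

datatype com =
    Skip
  | Assign nat aexp aexp
  | Seq com com
  | Cond aexp com com
  | While aexp com

text \<open>\<^term>\<open>Sub\<close> is truncated subtraction, and division by zero yields zero.\<close>

fun aval :: "aexp \<Rightarrow> state \<Rightarrow> nat" where
  "aval (Const k) s = k"
| "aval (Rd a e) s = s a (aval e s)"
| "aval (Add e1 e2) s = aval e1 s + aval e2 s"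
| "aval (Sub e1 e2) s = aval e1 s - aval e2 s"
| "aval (Mult e1 e2) s = aval e1 s * aval e2 s"
| "aval (Div e1 e2) s = aval e1 s div aval e2 s"

text \<open>Number of binary digits, where 0 has one digit.\<close>

definition bit_length :: "nat \<Rightarrow> nat" where
  "bit_length k = floor_log k + 1"

text \<open>
  Logarithmic cost: every value occurring in the evaluation, in particular every operand, every
  address and every result, is charged with its number of binary digits.
\<close>

fun acost :: "aexp \<Rightarrow> state \<Rightarrow> nat" where
  "acost (Const k) s = bit_length k"
| "acost (Rd a e) s = acost e s + bit_length (aval (Rd a e) s)"
| "acost (Add e1 e2) s = acost e1 s + acost e2 s + bit_length (aval (Add e1 e2) s)"
| "acost (Sub e1 e2) s = acost e1 s + acost e2 s + bit_length (aval (Sub e1 e2) s)"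
| "acost (Mult e1 e2) s = acost e1 s + acost e2 s + bit_length (aval (Mult e1 e2) s)"
| "acost (Div e1 e2) s = acost e1 s + acost e2 s + bit_length (aval (Div e1 e2) s)"

text \<open>
  \<open>exec c s t s'\<close>: program \<open>c\<close> started in state \<open>s\<close> halts in state \<open>s'\<close> after time \<open>t\<close>.
  The command \<open>Assign a i e\<close> stores the value of \<open>e\<close> in the cell of bank \<open>a\<close> whose address is the
  value of \<open>i\<close>.  Conditions are true iff their value is nonzero.
\<close>

inductive exec :: "com \<Rightarrow> state \<Rightarrow> nat \<Rightarrow> state \<Rightarrow> bool" where
  Skip: "exec Skip s 1 s"
| Assign: "exec (Assign a i e) s (acost i s + acost e s + 1)
     (s(a := (s a)(aval i s := aval e s)))"
| Seq: "exec c1 s t1 s1 \<Longrightarrow> exec c2 s1 t2 s2 \<Longrightarrow> exec (Seq c1 c2) s (t1 + t2) s2"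
| CondTrue: "aval b s \<noteq> 0 \<Longrightarrow> exec c1 s t s1 \<Longrightarrow> exec (Cond b c1 c2) s (acost b s + 1 + t) s1"
| CondFalse: "aval b s = 0 \<Longrightarrow> exec c2 s t s1 \<Longrightarrow> exec (Cond b c1 c2) s (acost b s + 1 + t) s1"
| WhileFalse: "aval b s = 0 \<Longrightarrow> exec (While b c) s (acost b s + 1) s"
| WhileTrue: "aval b s \<noteq> 0 \<Longrightarrow> exec c s t1 s1 \<Longrightarrow> exec (While b c) s1 t2 s2 \<Longrightarrow>
     exec (While b c) s (acost b s + 1 + t1 + t2) s2"

inductive_cases exec_SkipE: "exec Skip s t s'"
inductive_cases exec_AssignE: "exec (Assign a i e) s t s'"
inductive_cases exec_SeqE: "exec (Seq c1 c2) s t s'"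
inductive_cases exec_CondE: "exec (Cond b c1 c2) s t s'"
inductive_cases exec_WhileE: "exec (While b c) s t s'"

lemma exec_deterministic:
  "exec c s t s1 \<Longrightarrow> exec c s t' s2 \<Longrightarrow> t = t' \<and> s1 = s2"
proof (induction arbitrary: t' s2 rule: exec.induct)
  case Skip
  then show ?case by (auto elim: exec_SkipE)
next
  case Assign
  then show ?case by (auto elim: exec_AssignE)
next
  case (Seq c1 s t1 s1 c2 t2 s2 t' s2')
  from Seq.prems obtain u1 r1 u2
    where "exec c1 s u1 r1" "exec c2 r1 u2 s2'" "t' = u1 + u2"
    by (auto elim: exec_SeqE)
  moreover from this Seq.IH(1) have "t1 = u1" "s1 = r1" by blast+
  ultimately show ?case using Seq.IH(2) by blast
next
  case (CondTrue b s c1 t s1 c2 t' s2')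
  from CondTrue.prems obtain u where "exec c1 s u s2'" "t' = acost b s + 1 + u"
    by (rule exec_CondE) (use CondTrue.hyps(1) in auto)
  then show ?case using CondTrue.IH by blast
next
  case (CondFalse b s c2 t s1 c1 t' s2')
  from CondFalse.prems obtain u where "exec c2 s u s2'" "t' = acost b s + 1 + u"
    by (rule exec_CondE) (use CondFalse.hyps(1) in auto)
  then show ?case using CondFalse.IH by blast
next
  case WhileFalse
  from WhileFalse.prems show ?case by (rule exec_WhileE) (use WhileFalse.hyps in auto)
next
  case (WhileTrue b s c t1 s1 t2 s2 t' s2')
  from WhileTrue.prems obtain u1 r1 u2
    where "exec c s u1 r1" "exec (While b c) r1 u2 s2'" "t' = acost b s + 1 + u1 + u2"
    by (rule exec_WhileE) (use WhileTrue.hyps(1) in auto)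
  moreover from this WhileTrue.IH(1) have "t1 = u1" "s1 = r1" by blast+
  ultimately show ?case using WhileTrue.IH(2) by blast
qed

text \<open>
  Inputs and outputs are lists of natural numbers.  A list is stored in a bank with its length in
  cell 0 and its entries in the following cells.  Initially bank 0 holds the input and all other
  cells are zero; on halting, the output is in bank 1.
\<close>

definition init_state :: "nat list \<Rightarrow> state" where
  "init_state xs = (\<lambda>a i. if a = 0 \<and> i \<le> length xs then (length xs # xs) ! i else 0)"

definition holds_output :: "state \<Rightarrow> nat list \<Rightarrow> bool" where
  "holds_output s ys \<longleftrightarrow> (\<forall>i \<le> length ys. s 1 i = (length ys # ys) ! i)"

definition input_size :: "nat list \<Rightarrow> nat" where
  "input_size xs = sum_list (map bit_length xs)"

text \<open>
  The problem of computing \<open>f x\<close> for given \<open>x \<in> D\<close> is solvable in polynomial time, with respect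
  to encodings of the instances and of the solutions.
\<close>

definition poly_time_solvable ::
  "('a \<Rightarrow> nat list) \<Rightarrow> ('b \<Rightarrow> nat list) \<Rightarrow> 'a set \<Rightarrow> ('a \<Rightarrow> 'b) \<Rightarrow> bool" where
  "poly_time_solvable enc_in enc_out D f \<longleftrightarrow>
     (\<exists>(c :: com) (p :: nat poly). \<forall>x\<in>D. \<exists>t s.
        exec c (init_state (enc_in x)) t s \<and>
        holds_output s (enc_out (f x)) \<and>
        t \<le> poly p (input_size (enc_in x)))"


section \<open>Tournaments\<close>

text \<open>A pair \<open>(x, y) \<in> E\<close> is an arc from \<open>x\<close> to \<open>y\<close>.\<close>

definition tournament :: "'a set \<Rightarrow> 'a rel \<Rightarrow> bool" where
  "tournament V E \<longleftrightarrow> finite V \<and> E \<subseteq> V \<times> V \<and> asym E \<and> total_on V E"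

definition isomorphic :: "'a set \<Rightarrow> 'a rel \<Rightarrow> 'b set \<Rightarrow> 'b rel \<Rightarrow> bool" where
  "isomorphic V E V' E' \<longleftrightarrow>
     (\<exists>f. bij_betw f V V' \<and> (\<forall>x\<in>V. \<forall>y\<in>V. (x, y) \<in> E \<longleftrightarrow> (f x, f y) \<in> E'))"

definition tournament_free :: "'b set \<Rightarrow> 'b rel \<Rightarrow> 'a set \<Rightarrow> 'a rel \<Rightarrow> bool" where
  "tournament_free VH EH V E \<longleftrightarrow> \<not> (\<exists>X \<subseteq> V. isomorphic X (Restr E X) VH EH)"

text \<open>In \<open>W\<^sub>5\<close>, vertex 0 is \<open>v\<close> and vertex \<open>i\<close> is \<open>w\<^sub>i\<close> for \<open>i = 1, 2, 3, 4\<close>.\<close>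

definition W5_verts :: "nat set" where
  "W5_verts = {0, 1, 2, 3, 4}"

definition W5_arcs :: "nat rel" where
  "W5_arcs = {(i, j). 1 \<le> i \<and> i < j \<and> j \<le> 4} \<union> {(2, 0), (4, 0), (0, 1), (0, 3)}"

definition W5_free :: "'a set \<Rightarrow> 'a rel \<Rightarrow> bool" where
  "W5_free V E \<longleftrightarrow> tournament_free W5_verts W5_arcs V E"

definition independent_set :: "'a set \<Rightarrow> 'a rel \<Rightarrow> 'a set \<Rightarrow> bool" where
  "independent_set V E X \<longleftrightarrow> X \<subseteq> V \<and> trans (Restr E X)"

definition max_independent_weight :: "'a set \<Rightarrow> 'a rel \<Rightarrow> ('a \<Rightarrow> rat) \<Rightarrow> rat" where
  "max_independent_weight V E w = Max {\<Sum>v\<in>X. w v | X. independent_set V E X}"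


section \<open>The maximum weight independent set problem\<close>

text \<open>
  An instance \<open>(n, E, w)\<close> consists of a tournament with vertex set \<open>{..<n}\<close>, which up to the names of
  the vertices is an arbitrary finite tournament, and of nonnegative rational weights.
\<close>

type_synonym wmisp_instance = "nat \<times> nat rel \<times> (nat \<Rightarrow> rat)"

definition wmisp_instances :: "wmisp_instance set" where
  "wmisp_instances = {(n, E, w). tournament {..<n} E \<and> (\<forall>v<n. w v \<ge> 0)}"

definition wmisp :: "wmisp_instance \<Rightarrow> rat" where
  "wmisp = (\<lambda>(n, E, w). max_independent_weight {..<n} E w)"

text \<open>A nonnegative rational is encoded by numerator and denominator in lowest terms.\<close>

definition encode_rat :: "rat \<Rightarrow> nat list" where
  "encode_rat q = (case quotient_of q of (a, b) \<Rightarrow> [nat a, nat b])"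

text \<open>The number of vertices, the adjacency matrix row by row, and the weights.\<close>

definition encode_instance :: "wmisp_instance \<Rightarrow> nat list" where
  "encode_instance = (\<lambda>(n, E, w).
     n # [of_bool ((i, j) \<in> E). i \<leftarrow> [0..<n], j \<leftarrow> [0..<n]]
       @ concat (map (\<lambda>i. encode_rat (w i)) [0..<n]))"

end

theory Submission
  imports Defs
begin

text \<open>
  A tournament in which every homogeneous set is trivial (a prime tournament) and which contains no
  \<open>W\<^sub>5\<close> is locally transitive, or embeds into the Paley tournament \<open>P\<^sub>7\<close>, or is an alternating line
  \<open>U\<^bsub>2m+1\<^esub>\<close>: vertices \<open>x\<^sub>0, \<dots>, x\<^bsub>2m\<^esub>\<close> with all arcs directed backwards except those between two
  vertices of even index.  In each case every inclusion-maximal transitive set \<open>X\<close> has a subset \<open>Y\<close> of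
  at most four vertices such that \<open>X\<close> consists of all \<open>z\<close> that lie on no 3-cycle with two vertices of
  \<open>Y\<close>.  So in a prime tournament the optimum is found by trying all four-element subsets.  In general,
  a minimal homogeneous set with at least two vertices induces a prime tournament, and it can be
  contracted to a single vertex whose weight is its optimum; after at most \<open>n\<close> contractions one vertex is
  left.  Scaling by the product of the denominators makes all weights natural numbers.
\<close>

section \<open>Tournaments without a copy of W5\<close>

text \<open>The program never finds out which of the three prime cases it faces: it tries every
  quadruple and keeps those whose described set turns out transitive, so the classification only has
  to guarantee that some quadruple succeeds. The number four has three sources. In a locally
  transitive tournament the source and the sink of \<open>X\<close> suffice; in P7 a transitive set
  is a source with at most three out-neighbours; in a line \<open>X\<close> is fixed by its two
  extreme even indices, and their outer odd neighbours expose the even indices left out. The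
  obstruction to local transitivity is a five-vertex line, so a prime tournament with such a line is
  studied around a line of maximal length: every other vertex behaves like a line vertex or sees the
  whole line uniformly, the classes of alike vertices are homogeneous, and primality makes them
  singletons. The exception, a copy of six vertices of P7, is treated in the same way. For the
  running time a single number \<open>N\<close> bounds both the binary length of all cells and the
  rounds of each loop, so that a polynomial in \<open>N\<close> can be read off the program
  text.\<close>

abbreviation cycle3 :: "'a rel \<Rightarrow> 'a \<Rightarrow> 'a \<Rightarrow> 'a \<Rightarrow> bool" where
  "cycle3 E x y z \<equiv> (x, y) \<in> E \<and> (y, z) \<in> E \<and> (z, x) \<in> E"

abbreviation forms_W5 :: "'a rel \<Rightarrow> 'a \<Rightarrow> 'a \<Rightarrow> 'a \<Rightarrow> 'a \<Rightarrow> 'a \<Rightarrow> bool" where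
  "forms_W5 E v w1 w2 w3 w4 \<equiv> (w1, w2) \<in> E \<and> (w1, w3) \<in> E \<and> (w1, w4) \<in> E \<and> (w2, w3) \<in> E \<and> (w2, w4) \<in> E \<and>
     (w3, w4) \<in> E \<and> (w2, v) \<in> E \<and> (w4, v) \<in> E \<and> (v, w1) \<in> E \<and> (v, w3) \<in> E"

text \<open>The differences 1, 2, 4 are the nonzero squares modulo 7. Copies are sought on the
  indices below 6 only: P7 is vertex-transitive, so deleting any vertex leaves the same tournament,
  and index 6 stands for the possibly missing vertex.\<close>

definition p7_arc :: "nat \<Rightarrow> nat \<Rightarrow> bool" where
  "p7_arc i j \<longleftrightarrow> (j + 7 - i) mod 7 \<in> {1, 2, 4}"

definition line_arc :: "nat \<Rightarrow> nat \<Rightarrow> bool" where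
  "line_arc i j \<longleftrightarrow> (if i < j then even i \<and> even j else j < i \<and> \<not> (even i \<and> even j))"

definition down_closed :: "(nat \<Rightarrow> bool) \<Rightarrow> nat \<Rightarrow> bool" where
  "down_closed g L \<longleftrightarrow> (\<forall>j<L. \<forall>i<j. g j \<longrightarrow> g i)"

text \<open>Testing the arcs that leave \<open>z\<close> is enough: in a tournament their uniformity
  gives uniformity of the arcs that enter \<open>z\<close>.\<close>

definition homogeneous :: "'a set \<Rightarrow> 'a rel \<Rightarrow> 'a set \<Rightarrow> bool" where
  "homogeneous V E M \<longleftrightarrow> M \<subseteq> V \<and> (\<forall>z\<in>V - M. \<forall>x\<in>M. \<forall>y\<in>M. (z, x) \<in> E \<longrightarrow> (z, y) \<in> E)"

definition cycle_free :: "'a rel \<Rightarrow> 'a set \<Rightarrow> bool" where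
  "cycle_free E X \<longleftrightarrow> (\<forall>x\<in>X. \<forall>y\<in>X. \<forall>z\<in>X. \<not> cycle3 E x y z)"

section \<open>Adjacency patterns of a vertex outside a line or outside six vertices of P7\<close>

lemma all_less_numeral:
  "(\<forall>i<5. P (i::nat)) \<longleftrightarrow> P 0 \<and> P 1 \<and> P 2 \<and> P 3 \<and> P 4"
  "(\<forall>i<6. P (i::nat)) \<longleftrightarrow> P 0 \<and> P 1 \<and> P 2 \<and> P 3 \<and> P 4 \<and> P 5"
  "(\<exists>i<7. P (i::nat)) \<longleftrightarrow> P 0 \<or> P 1 \<or> P 2 \<or> P 3 \<or> P 4 \<or> P 5 \<or> P 6"
  by (simp_all only: eval_nat_numeral BitM.simps One_nat_def pred_numeral_simps All_less_Suc Ex_less_Suc not_less0 simp_thms)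
    blast+

lemma p7_table:
  "p7_arc 0 0 = False" "p7_arc 0 1 = True" "p7_arc 0 2 = True" "p7_arc 0 3 = False" "p7_arc 0 4 = True" "p7_arc 0 5 = False"
  "p7_arc 1 0 = False" "p7_arc 1 1 = False" "p7_arc 1 2 = True" "p7_arc 1 3 = True" "p7_arc 1 4 = False" "p7_arc 1 5 = True"
  "p7_arc 2 0 = False" "p7_arc 2 1 = False" "p7_arc 2 2 = False" "p7_arc 2 3 = True" "p7_arc 2 4 = True" "p7_arc 2 5 = False"
  "p7_arc 3 0 = True" "p7_arc 3 1 = False" "p7_arc 3 2 = False" "p7_arc 3 3 = False" "p7_arc 3 4 = True" "p7_arc 3 5 = True"
  "p7_arc 4 0 = False" "p7_arc 4 1 = True" "p7_arc 4 2 = False" "p7_arc 4 3 = False" "p7_arc 4 4 = False" "p7_arc 4 5 = True"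
  "p7_arc 5 0 = True" "p7_arc 5 1 = False" "p7_arc 5 2 = True" "p7_arc 5 3 = False" "p7_arc 5 4 = False" "p7_arc 5 5 = False"
  "p7_arc 6 0 = True" "p7_arc 6 1 = True" "p7_arc 6 2 = False" "p7_arc 6 3 = True" "p7_arc 6 4 = False" "p7_arc 6 5 = False"
  by (simp_all add: p7_arc_def)

lemma down_closed_5: "down_closed g 5 \<longleftrightarrow> (g 1 \<longrightarrow> g 0) \<and> (g 2 \<longrightarrow> g 1) \<and> (g 3 \<longrightarrow> g 2) \<and> (g 4 \<longrightarrow> g 3)"
  unfolding down_closed_def
  by (simp only: eval_nat_numeral BitM.simps One_nat_def pred_numeral_simps All_less_Suc not_less0 simp_thms) blast

text \<open>\<open>E\<close> is not confined to pairs from \<open>V\<close>, so that one relation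
  serves all subtournaments. The ten arcs of \<open>forms_W5\<close> join all pairs of the five
  vertices and thereby keep them distinct.\<close>

locale w5_free_tour =
  fixes V :: "'a set" and E :: "'a rel"
  assumes fin: "finite V"
    and irr: "x \<in> V \<Longrightarrow> (x, x) \<notin> E"
    and tot: "x \<in> V \<Longrightarrow> y \<in> V \<Longrightarrow> x \<noteq> y \<Longrightarrow> (x, y) \<in> E \<longleftrightarrow> (y, x) \<notin> E"
    and no_W5: "v \<in> V \<Longrightarrow> w1 \<in> V \<Longrightarrow> w2 \<in> V \<Longrightarrow> w3 \<in> V \<Longrightarrow> w4 \<in> V \<Longrightarrow>
      \<not> forms_W5 E v w1 w2 w3 w4"
begin

definition copy_of :: "(nat \<Rightarrow> nat \<Rightarrow> bool) \<Rightarrow> nat \<Rightarrow> (nat \<Rightarrow> 'a) \<Rightarrow> bool" where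
  "copy_of R n h \<longleftrightarrow> (\<forall>i<n. h i \<in> V) \<and> (\<forall>i<n. \<forall>j<n. i \<noteq> j \<longrightarrow> h i \<noteq> h j \<and> ((h i, h j) \<in> E \<longleftrightarrow> R i j))"

lemma arc_asym: "(x, y) \<in> E \<Longrightarrow> x \<in> V \<Longrightarrow> y \<in> V \<Longrightarrow> (y, x) \<notin> E"
  using tot irr by metis

text \<open>Each instance in \<open>W\<close> puts \<open>z\<close> and four vertices of the copy
  into the roles of W5. Together they exclude all of the 64 patterns except those of a vertex of P7,
  free at its own index, and the two constant ones.\<close>

lemma p7_pattern:
  assumes h: "copy_of p7_arc 6 h" and z: "z \<in> V" "\<And>i. i < 6 \<Longrightarrow> z \<noteq> h i"
  shows "(\<exists>k<7. \<forall>i<6. i \<noteq> k \<longrightarrow> ((z, h i) \<in> E \<longleftrightarrow> p7_arc k i)) \<or>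
    (\<forall>i<6. (z, h i) \<in> E) \<or> (\<forall>i<6. (z, h i) \<notin> E)"
proof -
  have V: "h 0 \<in> V" "h 1 \<in> V" "h 2 \<in> V" "h 3 \<in> V" "h 4 \<in> V" "h 5 \<in> V"
    using h by (simp_all add: copy_of_def)
  have zi: "(h i, z) \<in> E \<longleftrightarrow> (z, h i) \<notin> E" if "i < 6" for i
    using tot[of "h i" z] z h that by (metis copy_of_def)
  have zz: "(h 0, z) \<in> E \<longleftrightarrow> (z, h 0) \<notin> E" "(h 1, z) \<in> E \<longleftrightarrow> (z, h 1) \<notin> E"
    "(h 2, z) \<in> E \<longleftrightarrow> (z, h 2) \<notin> E" "(h 3, z) \<in> E \<longleftrightarrow> (z, h 3) \<notin> E"
    "(h 4, z) \<in> E \<longleftrightarrow> (z, h 4) \<notin> E" "(h 5, z) \<in> E \<longleftrightarrow> (z, h 5) \<notin> E"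
    by (simp_all add: zi)
  have arc: "(h i, h j) \<in> E \<longleftrightarrow> p7_arc i j" if "i < 6" "j < 6" "i \<noteq> j" for i j
    using h that by (simp add: copy_of_def)
  have A: "(h 0, h 1) \<in> E" "(h 0, h 2) \<in> E" "(h 0, h 4) \<in> E" "(h 1, h 2) \<in> E" "(h 1, h 3) \<in> E" "(h 1, h 5) \<in> E" "(h 2, h 3) \<in> E" "(h 2, h 4) \<in> E" "(h 3, h 0) \<in> E" "(h 3, h 4) \<in> E" "(h 3, h 5) \<in> E" "(h 4, h 1) \<in> E" "(h 4, h 5) \<in> E" "(h 5, h 0) \<in> E" "(h 5, h 2) \<in> E"
    using arc by (simp_all add: p7_arc_def)
  note W = no_W5[OF V(1) V(2) V(4) z(1) V(6)]
    no_W5[OF V(5) V(2) V(4) V(6) z(1)]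
    no_W5[OF V(4) V(1) V(3) V(5) z(1)]
    no_W5[OF V(1) z(1) V(4) V(5) V(6)]
    no_W5[OF V(5) V(6) V(1) z(1) V(3)]
    no_W5[OF V(4) z(1) V(2) V(6) V(3)]
    no_W5[OF V(1) V(3) V(4) V(5) z(1)]
    no_W5[OF V(5) z(1) V(4) V(6) V(1)]
    no_W5[OF V(6) z(1) V(4) V(1) V(5)]
    no_W5[OF V(2) V(6) V(1) V(3) z(1)]
    no_W5[OF V(3) z(1) V(1) V(5) V(2)]
    no_W5[OF V(4) V(5) V(2) V(6) z(1)]
    no_W5[OF V(5) V(2) z(1) V(6) V(3)]
    no_W5[OF V(6) z(1) V(2) V(3) V(4)]
    no_W5[OF V(2) V(4) V(5) V(6) z(1)]
  note W' = W[simplified A zz simp_thms]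
  show ?thesis
    unfolding all_less_numeral p7_table using W' by smt
qed

text \<open>
  A vertex outside a line sits at some cut of the line: either its out-neighbours on the line form an
  initial segment, like those of a vertex of odd index, or they do so after switching the even
  indices, like those of a vertex of even index.
\<close>

lemma line_pattern_5:
  assumes noB: "\<nexists>h. copy_of p7_arc 6 h"
    and x: "copy_of line_arc 5 x" and z: "z \<in> V" "\<And>i. i < 5 \<Longrightarrow> z \<noteq> x i"
  shows "down_closed (\<lambda>i. (z, x i) \<in> E) 5 \<or> down_closed (\<lambda>i. (z, x i) \<in> E \<longleftrightarrow> odd i) 5"
proof -
  have V: "x 0 \<in> V" "x 1 \<in> V" "x 2 \<in> V" "x 3 \<in> V" "x 4 \<in> V"
    using x by (simp_all add: copy_of_def)
  have zi: "(x i, z) \<in> E \<longleftrightarrow> (z, x i) \<notin> E" if "i < 5" for i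
    using tot[of "x i" z] z x that by (metis copy_of_def)
  have zz: "(x 0, z) \<in> E \<longleftrightarrow> (z, x 0) \<notin> E" "(x 1, z) \<in> E \<longleftrightarrow> (z, x 1) \<notin> E"
    "(x 2, z) \<in> E \<longleftrightarrow> (z, x 2) \<notin> E" "(x 3, z) \<in> E \<longleftrightarrow> (z, x 3) \<notin> E"
    "(x 4, z) \<in> E \<longleftrightarrow> (z, x 4) \<notin> E"
    by (simp_all add: zi)
  have arc: "(x i, x j) \<in> E \<longleftrightarrow> line_arc i j" if "i < 5" "j < 5" "i \<noteq> j" for i j
    using x that by (simp add: copy_of_def)
  have ne: "x i \<noteq> x j" if "i < 5" "j < 5" "i \<noteq> j" for i j
    using x that by (simp add: copy_of_def)
  have B6: False
    if d: "distinct [a, b, c, d, e, f]" and V: "set [a, b, c, d, e, f] \<subseteq> V"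
      and A: "(a, b) \<in> E" "(a, c) \<in> E" "(a, e) \<in> E" "(b, c) \<in> E" "(b, d) \<in> E" "(b, f) \<in> E"
        "(c, d) \<in> E" "(c, e) \<in> E" "(d, a) \<in> E" "(d, e) \<in> E" "(d, f) \<in> E" "(e, b) \<in> E"
        "(e, f) \<in> E" "(f, a) \<in> E" "(f, c) \<in> E" for a b c d e f
  proof -
    let ?h = "\<lambda>i::nat. if i = 0 then a else if i = 1 then b else if i = 2 then c else if i = 3 then d
      else if i = 4 then e else f"
    have N: "(b, a) \<notin> E" "(c, a) \<notin> E" "(e, a) \<notin> E" "(c, b) \<notin> E" "(d, b) \<notin> E" "(f, b) \<notin> E"
        "(d, c) \<notin> E" "(e, c) \<notin> E" "(a, d) \<notin> E" "(e, d) \<notin> E" "(f, d) \<notin> E" "(b, e) \<notin> E"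
        "(f, e) \<notin> E" "(a, f) \<notin> E" "(c, f) \<notin> E"
      using A[THEN arc_asym] V by simp_all
    have "copy_of p7_arc 6 ?h"
      unfolding copy_of_def all_less_numeral p7_table
      using d V A N by (simp del: One_nat_def) auto
    then show False using noB by blast
  qed
  have A: "(x 0, x 2) \<in> E" "(x 0, x 4) \<in> E" "(x 1, x 0) \<in> E" "(x 2, x 1) \<in> E" "(x 2, x 4) \<in> E" "(x 3, x 0) \<in> E" "(x 3, x 1) \<in> E" "(x 3, x 2) \<in> E" "(x 4, x 1) \<in> E" "(x 4, x 3) \<in> E"
    using arc by (simp_all add: line_arc_def)
  note W = no_W5[OF V(2) V(1) V(3) z(1) V(5)]
    no_W5[OF V(4) V(3) V(5) V(2) z(1)]
    no_W5[OF V(3) V(5) V(4) V(2) z(1)]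
    no_W5[OF V(4) V(1) z(1) V(3) V(5)]
    no_W5[OF V(1) V(5) V(4) z(1) V(2)]
    no_W5[OF V(2) z(1) V(4) V(1) V(3)]
    no_W5[OF V(1) V(3) z(1) V(5) V(2)]
    no_W5[OF V(5) V(4) V(3) V(2) z(1)]
    no_W5[OF V(1) z(1) V(4) V(3) V(2)]
    no_W5[OF V(5) V(4) z(1) V(2) V(1)]
    no_W5[OF V(3) z(1) V(4) V(2) V(1)]
  note W' = W[simplified A zz simp_thms]
  have zn: "z \<noteq> x 0" "z \<noteq> x 1" "z \<noteq> x 2" "z \<noteq> x 3" "z \<noteq> x 4"
    using z(2) by simp_all
  have xn: "distinct [x 0, x 1, x 2, x 3, x 4]"
    using ne by simp
  \<comment> \<open>The next two patterns are excluded by P7 rather than by W5: \<open>z\<close>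
    completes the line to a copy of six vertices of P7, in the order handed to
    \<open>B6\<close>.\<close>
  have e1: "\<not> ((z, x 0) \<notin> E \<and> (z, x 1) \<notin> E \<and> (z, x 2) \<in> E \<and> (z, x 3) \<in> E \<and> (z, x 4) \<notin> E)"
    using B6[of "x 0" "x 4" z "x 3" "x 2" "x 1"] zn xn zz A V z(1) by auto
  have e2: "\<not> ((z, x 0) \<in> E \<and> (z, x 1) \<notin> E \<and> (z, x 2) \<notin> E \<and> (z, x 3) \<in> E \<and> (z, x 4) \<in> E)"
    using B6[of "x 2" z "x 4" "x 3" "x 1" "x 0"] zn xn zz A V z(1) by auto
  show ?thesis
    unfolding down_closed_5 using W' e1 e2 by simp smt
qed
end

lemma down_closedD: "down_closed f L \<Longrightarrow> i < j \<Longrightarrow> j < L \<Longrightarrow> f j \<Longrightarrow> f i"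
  by (auto simp: down_closed_def)

lemma down_closed_threshold:
  assumes "down_closed f L"
  shows "\<exists>t\<le>L. \<forall>i<L. f i \<longleftrightarrow> i < t"
proof (cases "\<forall>i<L. f i")
  case True
  then show ?thesis by blast
next
  case False
  define t where "t = (LEAST i. i < L \<and> \<not> f i)"
  have t: "t < L \<and> \<not> f t" unfolding t_def using False by (metis (mono_tags, lifting) LeastI)
  have "f i \<longleftrightarrow> i < t" if "i < L" for i
    using assms t that not_less_Least[of i "\<lambda>i. i < L \<and> \<not> f i"] unfolding down_closed_def t_def[symmetric]
    by (metis linorder_neqE_nat)
  then show ?thesis using t by (meson less_imp_le)
qed

text \<open>An implication from the second window down to the first passes through index 2, which
  \<open>3 \<le> L\<close> puts into both.\<close>

lemma down_closed_glue:
  assumes "down_closed f L" "down_closed (\<lambda>i. f (i + 2)) L" "3 \<le> L"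
  shows "down_closed f (L + 2)"
  unfolding down_closed_def
proof (intro allI impI)
  fix i j assume ij: "j < L + 2" "i < j" "f j"
  have 1: "f i" if "j < L" "i < j" "f j" for i j using assms(1) that by (auto simp: down_closed_def)
  have 2: "f i" if "2 \<le> i" "j < L + 2" "i < j" "f j" for i j
  proof -
    have eq: "j - 2 + 2 = j" "i - 2 + 2 = i" using that by linarith+
    have "j - 2 < L" "i - 2 < j - 2" "f (j - 2 + 2)" using that unfolding eq by simp_all
    then have "f (i - 2 + 2)" using assms(2) unfolding down_closed_def by blast
    then show ?thesis unfolding eq .
  qed
  show "f i"
  proof (cases "j < L \<or> 2 \<le> i")
    case True then show ?thesis using 1 2 ij by blast
  next
    case False
    have "f 2" using 2[of 2 j] ij False assms(3) by (cases "j = 2") auto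
    then show ?thesis using 1[of 2 i] False assms(3) by simp
  qed
qed

lemma line_arc_odd: "odd q \<Longrightarrow> i \<noteq> q \<Longrightarrow> line_arc q i \<longleftrightarrow> i < q"
  and line_arc_even: "even q \<Longrightarrow> i \<noteq> q \<Longrightarrow> line_arc q i \<longleftrightarrow> (i < q \<longleftrightarrow> odd i)"
  by (auto simp: line_arc_def)

lemma line_arc_total: "i \<noteq> j \<Longrightarrow> line_arc i j \<longleftrightarrow> \<not> line_arc j i"
  by (auto simp: line_arc_def)

text \<open>Used when a line vertex has been exchanged, so that the arcs of a vertex of type
  \<open>k'\<close> are known only away from its own index \<open>k'\<close> and the exchanged index
  \<open>k\<close>. With at least five indices there remains a pair on which the alternative of the
  wrong parity fails to be monotone.\<close>

lemma line_type_unique: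
  assumes L: "odd L" "5 \<le> L" and k: "k < L" "k' < L" "k \<noteq> k'"
    and g: "\<And>i. i < L \<Longrightarrow> i \<noteq> k \<Longrightarrow> i \<noteq> k' \<Longrightarrow> g i \<longleftrightarrow> line_arc k' i"
    and d: "down_closed g L \<or> down_closed (\<lambda>i. g i \<longleftrightarrow> odd i) L"
  shows "down_closed (\<lambda>i. if odd k' then g i else (g i \<longleftrightarrow> odd i)) L"
proof (cases "odd k'")
  case True
  have "\<not> down_closed (\<lambda>i. g i \<longleftrightarrow> odd i) L"
  proof
    assume "down_closed (\<lambda>i. g i \<longleftrightarrow> odd i) L"
    then have D: "(g j \<longleftrightarrow> odd j) \<Longrightarrow> (g i \<longleftrightarrow> odd i)" if "i < j" "j < L" for i j
      using that by (auto simp: down_closed_def)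
    have G: "g i \<longleftrightarrow> i < k'" if "i < L" "i \<noteq> k" "i \<noteq> k'" for i
      using g[OF that] that True by (simp add: line_arc_odd)
    have k'1: "1 \<le> k'" "k' < L - 1" using True L k by (auto elim!: oddE)
    have "(k = 0 \<and> k' = 1) \<or> (k = 0 \<and> 3 \<le> k') \<or> (k = L - 1 \<and> k' = L - 2) \<or> (k = L - 1 \<and> k' < L - 3) \<or> (k \<noteq> 0 \<and> k \<noteq> L - 1)"
      using True L k'1 k by presburger
    then consider "k = 0" "k' = 1" | "k = 0" "3 \<le> k'" | "k = L - 1" "k' = L - 2" | "k = L - 1" "k' < L - 3"
      | "k \<noteq> 0" "k \<noteq> L - 1"
      by meson
    then show False
    proof cases
      case 1 then show False using D[of 3 4] G[of 3] G[of 4] L by simp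
    next
      case 2 then show False using D[of 2 "L - 1"] G[of 2] G[of "L - 1"] L k'1 by auto
    next
      case 3
      moreover have "1 < L - 2" "1 \<noteq> L - 1" "1 \<noteq> L - 2" using L by linarith+
      ultimately show False using D[of 0 1] G[of 0] G[of 1] L by auto
    next
      case 4 then show False using D[of 0 "L - 3"] G[of 0] G[of "L - 3"] L k'1 by auto
    next
      case 5 then show False using D[of 0 "L - 1"] G[of 0] G[of "L - 1"] L k'1 by auto
    qed
  qed
  then show ?thesis using d True by simp
next
  case False
  have "\<not> down_closed g L"
  proof
    assume "down_closed g L"
    then have D: "g j \<Longrightarrow> g i" if "i < j" "j < L" for i j using that by (auto simp: down_closed_def)
    have G: "g i \<longleftrightarrow> (i < k' \<longleftrightarrow> odd i)" if "i < L" "i \<noteq> k" "i \<noteq> k'" for i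
      using g[OF that] that False by (simp add: line_arc_even)
    have "(k' = 0 \<and> k \<noteq> 1 \<and> k \<noteq> 2) \<or> (k' = 0 \<and> k \<noteq> 3 \<and> k \<noteq> 4) \<or> (k' = L - 1 \<and> k \<noteq> 0 \<and> k \<noteq> 1) \<or>
      (k' = L - 1 \<and> k \<noteq> 2 \<and> k \<noteq> 3) \<or> (2 \<le> k' \<and> k' + 2 < L \<and> k < k') \<or> (2 \<le> k' \<and> k' + 2 < L \<and> k' < k)"
      using False L k by presburger
    then consider "k' = 0" "k \<noteq> 1" "k \<noteq> 2" | "k' = 0" "k \<noteq> 3" "k \<noteq> 4"
      | "k' = L - 1" "k \<noteq> 0" "k \<noteq> 1" | "k' = L - 1" "k \<noteq> 2" "k \<noteq> 3"
      | "2 \<le> k'" "k' + 2 < L" "k < k'" | "2 \<le> k'" "k' + 2 < L" "k' < k"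
      by meson
    then show False
    proof cases
      case 1 then show False using D[of 1 2] G[of 1] G[of 2] L by simp
    next
      case 2 then show False using D[of 3 4] G[of 3] G[of 4] L by simp
    next
      case 3
      moreover have "1 < k'" using 3 L by linarith
      ultimately show False using D[of 0 1] G[of 0] G[of 1] L by simp
    next
      case 4
      moreover have "3 < k'" using 4 L by linarith
      ultimately show False using D[of 2 3] G[of 2] G[of 3] L by simp
    next
      case 5 then show False using D[of "k' + 1" "k' + 2"] G[of "k' + 1"] G[of "k' + 2"] False by auto
    next
      case 6
      then have "k' - 2 < k' - 1" "k' - 1 < L" "k' - 2 < L" "k' - 1 \<noteq> k" "k' - 2 \<noteq> k" "k' - 2 < k'" "k' - 1 < k'"
        by linarith+
      then show False using D[of "k' - 2" "k' - 1"] G[of "k' - 2"] G[of "k' - 1"] False 6 by simp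
    qed
  qed
  then show ?thesis using d False by simp
qed

lemma line_arc_separated:
  assumes "5 \<le> L" "k < L" "k' < L" "k \<noteq> k'"
  shows "\<exists>i<L. i \<noteq> k \<and> i \<noteq> k' \<and> (line_arc k i \<noteq> line_arc k' i)"
proof -
  have *: "\<exists>i<L. i \<noteq> k \<and> i \<noteq> k' \<and> (line_arc k i \<noteq> line_arc k' i)" if k: "k < k'" "k' < L" for k k'
  proof -
    \<comment> \<open>For the case of consecutive indices: these are told apart precisely by the
      even indices other than themselves, and one of 0, 2, 4 avoids both.\<close>
    have "(k \<noteq> 0 \<and> k' \<noteq> 0) \<or> (k \<noteq> 2 \<and> k' \<noteq> 2) \<or> (k \<noteq> 4 \<and> k' \<noteq> 4)" by arith
    then obtain e where e: "even e" "e < L" "e \<noteq> k" "e \<noteq> k'"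
      using that[of 0] that[of 2] that[of 4] assms(1) by auto
    show ?thesis
    proof (cases "k' = k + 1")
      case True
      then show ?thesis using e by (intro exI[of _ e]) (auto simp: line_arc_def)
    next
      case False
      then have "k + 2 \<le> k'" using k by simp
      then have "even k \<or> odd k' \<or> k + 3 \<le> k'" by (cases "k + 2 = k'") auto
      then consider "even k \<or> odd k'" | "odd k" "even k'" "k + 3 \<le> k'" by blast
      then show ?thesis
      proof cases
        case 1 then show ?thesis using k False by (intro exI[of _ "k + 1"]) (auto simp: line_arc_def)
      next
        case 2 then show ?thesis using k False by (intro exI[of _ "k + 2"]) (auto simp: line_arc_def)
      qed
    qed
  qed
  show ?thesis using *[of k k'] *[of k' k] assms by (metis linorder_neqE_nat)
qed

definition prime_tour :: "'a set \<Rightarrow> 'a rel \<Rightarrow> bool" where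
  "prime_tour V E \<longleftrightarrow> (\<forall>M. homogeneous V E M \<longrightarrow> (\<exists>a\<in>M. \<exists>b\<in>M. a \<noteq> b) \<longrightarrow> M = V)"

context w5_free_tour
begin

text \<open>The longer line is covered by two windows of length \<open>2 * m + 1\<close>, shifted by
  two so that parities are kept. They share the indices 2, 3, 4, on which the two alternatives
  cannot both be monotone; so the windows agree on the alternative and can be glued.\<close>

lemma line_pattern:
  assumes noB: "\<nexists>h. copy_of p7_arc 6 h" and "2 \<le> m"
    and x: "copy_of line_arc (2 * m + 1) x" and z: "z \<in> V" "\<And>i. i < 2 * m + 1 \<Longrightarrow> z \<noteq> x i"
  shows "down_closed (\<lambda>i. (z, x i) \<in> E) (2 * m + 1) \<or>
    down_closed (\<lambda>i. (z, x i) \<in> E \<longleftrightarrow> odd i) (2 * m + 1)"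
  using assms(2) x z(2)
proof (induction m arbitrary: x rule: nat_induct_at_least)
  case base
  then show ?case using line_pattern_5[OF noB _ z(1), of x] by simp
next
  case (Suc m)
  let ?g = "\<lambda>i. (z, x i) \<in> E" let ?g' = "\<lambda>i. (z, x i) \<in> E \<longleftrightarrow> odd i"
  have "copy_of line_arc (2 * m + 1) x" using Suc.prems(1) by (simp add: copy_of_def)
  then have 1: "down_closed ?g (2 * m + 1) \<or> down_closed ?g' (2 * m + 1)"
    using Suc.IH[of x] Suc.prems(2) by simp
  have "copy_of line_arc (2 * m + 1) (\<lambda>i. x (i + 2))"
    using Suc.prems(1) by (simp add: copy_of_def line_arc_def)
  then have 2: "down_closed (\<lambda>i. ?g (i + 2)) (2 * m + 1) \<or> down_closed (\<lambda>i. ?g' (i + 2)) (2 * m + 1)"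
    using Suc.IH[of "\<lambda>i. x (i + 2)"] Suc.prems(2) by simp
  have a: "f 4 \<longrightarrow> f 3" "f 3 \<longrightarrow> f 2" "f 2 \<longrightarrow> f 1" "f 1 \<longrightarrow> f 0" if "down_closed f (2 * m + 1)" for f
    using down_closedD[OF that, of 3 4] down_closedD[OF that, of 2 3] down_closedD[OF that, of 1 2]
      down_closedD[OF that, of 0 1] Suc.hyps by simp_all
  have b: "f 4 \<longrightarrow> f 3" "f 3 \<longrightarrow> f 2" if "down_closed (\<lambda>i. f (i + 2)) (2 * m + 1)" for f
    using down_closedD[OF that, of 1 2] down_closedD[OF that, of 0 1] Suc.hyps
    by (simp_all add: numeral_eq_Suc)
  have "\<not> (down_closed ?g (2 * m + 1) \<and> down_closed (\<lambda>i. ?g' (i + 2)) (2 * m + 1))"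
    using a(1,2)[of ?g] b[of ?g'] by auto
  moreover have "\<not> (down_closed ?g' (2 * m + 1) \<and> down_closed (\<lambda>i. ?g (i + 2)) (2 * m + 1))"
    using a(1,2)[of ?g'] b[of ?g] by auto
  ultimately have "(down_closed ?g (2 * m + 1) \<and> down_closed (\<lambda>i. ?g (i + 2)) (2 * m + 1)) \<or>
     (down_closed ?g' (2 * m + 1) \<and> down_closed (\<lambda>i. ?g' (i + 2)) (2 * m + 1))"
    using 1 2 by blast
  moreover have "3 \<le> 2 * m + 1" using Suc.hyps by simp
  ultimately have "down_closed ?g (2 * m + 1 + 2) \<or> down_closed ?g' (2 * m + 1 + 2)"
    using down_closed_glue[of ?g "2 * m + 1"] down_closed_glue[of ?g' "2 * m + 1"] by blast
  then show ?case by simp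
qed


end

section \<open>Prime tournaments around a longest line\<close>

locale maximal_line = w5_free_tour +
  fixes m :: nat and x :: "nat \<Rightarrow> 'a" and L :: nat
  assumes no_B6: "\<nexists>h. copy_of p7_arc 6 h"
    and m: "2 \<le> m" and L_def: "L = 2 * m + 1"
    and line: "copy_of line_arc L x"
    and maximal: "\<nexists>y. copy_of line_arc (L + 2) y"
begin

lemma L: "odd L" "5 \<le> L"
  using m by (auto simp: L_def)

text \<open>These vertices see the rest of the line as \<open>x k\<close> does. The arc between such
  a vertex and \<open>x k\<close> is left open, so each of them may take the place of
  \<open>x k\<close> in the line.\<close>

definition kin :: "nat \<Rightarrow> 'a set" where
  "kin k = insert (x k) {z \<in> V - x ` {..<L}. \<forall>i<L. i \<noteq> k \<longrightarrow> ((z, x i) \<in> E \<longleftrightarrow> line_arc k i)}"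

lemma x_V: "i < L \<Longrightarrow> x i \<in> V"
  and x_inj: "i < L \<Longrightarrow> j < L \<Longrightarrow> x i = x j \<longleftrightarrow> i = j"
  and x_arc: "i < L \<Longrightarrow> j < L \<Longrightarrow> i \<noteq> j \<Longrightarrow> (x i, x j) \<in> E \<longleftrightarrow> line_arc i j"
  using line unfolding copy_of_def by blast+

lemma kin_V: "k < L \<Longrightarrow> kin k \<subseteq> V"
  by (auto simp: kin_def x_V)

lemma kin_arc: "z \<in> kin k \<Longrightarrow> k < L \<Longrightarrow> i < L \<Longrightarrow> i \<noteq> k \<Longrightarrow> (z, x i) \<in> E \<longleftrightarrow> line_arc k i"
  by (auto simp: kin_def x_arc)

lemma kin_arc': "z \<in> kin k \<Longrightarrow> k < L \<Longrightarrow> i < L \<Longrightarrow> i \<noteq> k \<Longrightarrow> (x i, z) \<in> E \<longleftrightarrow> line_arc i k"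
proof -
  assume a: "z \<in> kin k" "k < L" "i < L" "i \<noteq> k"
  then have "x i \<noteq> z" by (auto simp: kin_def x_inj)
  then show ?thesis
    using kin_arc[OF a] tot[of z "x i"] a kin_V[of k] x_V[of i] line_arc_total[of i k] by auto
qed

lemma pattern:
  assumes "copy_of line_arc L y" "z \<in> V" "\<And>i. i < L \<Longrightarrow> z \<noteq> y i"
  shows "down_closed (\<lambda>i. (z, y i) \<in> E) L \<or> down_closed (\<lambda>i. (z, y i) \<in> E \<longleftrightarrow> odd i) L"
  using line_pattern[OF no_B6 m, of y z] assms unfolding L_def by blast

lemma replace_line:
  assumes "z \<in> kin k" "k < L"
  shows "copy_of line_arc L (x(k := z))"
proof -
  have "z \<in> V" using assms kin_V by blast
  moreover have "z \<noteq> x i" if "i \<noteq> k" "i < L" for i using assms that by (auto simp: kin_def x_inj)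
  ultimately show ?thesis
    using assms x_V x_inj x_arc kin_arc[OF assms] kin_arc'[OF assms]
    unfolding copy_of_def by (auto simp: fun_upd_def)
qed

lemma kin_cases:
  assumes z: "z \<in> V"
  obtains k where "k < L" "z \<in> kin k"
    | "z \<notin> x ` {..<L}" "\<And>i. i < L \<Longrightarrow> (z, x i) \<in> E"
    | "z \<notin> x ` {..<L}" "\<And>i. i < L \<Longrightarrow> (z, x i) \<notin> E"
proof (cases "z \<in> x ` {..<L}")
  case True
  then show ?thesis using that(1) by (auto simp: kin_def)
next
  case False
  then have out: "\<And>i. i < L \<Longrightarrow> z \<noteq> x i" by blast
  from pattern[OF line z out] show ?thesis
  proof
    assume "down_closed (\<lambda>i. (z, x i) \<in> E) L"
    then obtain t where t: "t \<le> L" "\<And>i. i < L \<Longrightarrow> (z, x i) \<in> E \<longleftrightarrow> i < t"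
      using down_closed_threshold by blast
    show ?thesis
    proof (cases "t = 0 \<or> t = L")
      case True
      then show ?thesis using that(2,3) False t by auto
    next
      case F: False
      \<comment> \<open>The cuts just below and just above \<open>x k\<close> differ only in the arc
        with \<open>x k\<close>, so both lead to the same odd \<open>k\<close>.\<close>
      define k where "k = (if odd t then t else t - 1)"
      have k: "odd k" "k < L" "t = k \<or> t = k + 1" using F t(1) by (auto simp: k_def)
      have "z \<in> kin k" using False z k t(2) by (auto simp: kin_def line_arc_odd)
      then show ?thesis using that(1) k by blast
    qed
  next
    assume "down_closed (\<lambda>i. (z, x i) \<in> E \<longleftrightarrow> odd i) L"
    then obtain t where t: "t \<le> L" "\<And>i. i < L \<Longrightarrow> ((z, x i) \<in> E \<longleftrightarrow> odd i) \<longleftrightarrow> i < t"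
      using down_closed_threshold by blast
    \<comment> \<open>Here no cut is left over at the ends: since \<open>L\<close> is odd,
      \<open>t = 0\<close> and \<open>t = L\<close> give the even indices 0 and
      \<open>L - 1\<close>.\<close>
    define k where "k = (if even t then t else t - 1)"
    have k: "even k" "t = k \<or> t = k + 1" by (auto simp: k_def)
    have kL: "k < L" using t(1) L(1) L(2) unfolding k_def by (cases "t = L") auto
    have "(z, x i) \<in> E \<longleftrightarrow> line_arc k i" if "i < L" "i \<noteq> k" for i
    proof -
      have "i < t \<longleftrightarrow> i < k" using k that by auto
      then show ?thesis using t(2)[OF that(1)] line_arc_even[OF k(1) that(2)] by blast
    qed
    then have "z \<in> kin k" using False z by (simp add: kin_def)
    then show ?thesis using that(1) kL by blast
  qed
qed

lemma kin_disjoint: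
  assumes "z \<in> kin k" "z \<in> kin k'" "k < L" "k' < L"
  shows "k = k'"
proof (rule ccontr)
  assume "k \<noteq> k'"
  then obtain i where "i < L" "i \<noteq> k" "i \<noteq> k'" "line_arc k i \<noteq> line_arc k' i"
    using line_arc_separated L assms by blast
  then show False using kin_arc[OF assms(1,3)] kin_arc[OF assms(2,4)] by blast
qed

text \<open>With \<open>z'\<close> standing in for \<open>x k'\<close> the sequence is again a line,
  so \<open>z\<close> has to fit into it. This puts the arc between \<open>z\<close> and
  \<open>z'\<close> under the control of monotonicity.\<close>

lemma kin_position:
  assumes z: "z \<in> kin k" "z \<notin> x ` {..<L}" and z': "z' \<in> kin k'" and k: "k < L" "k' < L" "k \<noteq> k'"
  shows "down_closed (\<lambda>i. if odd k then (z, (x(k' := z')) i) \<in> E else ((z, (x(k' := z')) i) \<in> E \<longleftrightarrow> odd i)) L"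
proof (rule line_type_unique[OF L k(2,1)])
  show "k' \<noteq> k" using k by simp
  show "(z, (x(k' := z')) i) \<in> E \<longleftrightarrow> line_arc k i" if "i < L" "i \<noteq> k'" "i \<noteq> k" for i
    using kin_arc[OF z(1) k(1), of i] that by simp
  have "z \<noteq> z'" using kin_disjoint[OF z(1) _ k(1,2)] z' k by blast
  then show "down_closed (\<lambda>i. (z, (x(k' := z')) i) \<in> E) L \<or>
      down_closed (\<lambda>i. (z, (x(k' := z')) i) \<in> E \<longleftrightarrow> odd i) L"
    using z k kin_V by (intro pattern replace_line[OF z' k(2)]) auto
qed

text \<open>
  Two vertices that are twins of \<open>x k\<close> and \<open>x (k + 1)\<close>, but joined in the opposite direction, can be
  inserted as a pair between \<open>x k\<close> and \<open>x (k + 1)\<close>, which makes the line longer.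
\<close>

lemma no_inserted_pair:
  assumes k: "k \<le> L" and V: "u \<in> V" "v \<in> V" and out: "u \<notin> x ` {..<L}" "v \<notin> x ` {..<L}"
    and u: "\<And>i. i < L \<Longrightarrow> (if odd k then (u, x i) \<in> E else ((u, x i) \<in> E \<longleftrightarrow> odd i)) \<longleftrightarrow> i < k"
    and v: "\<And>i. i < L \<Longrightarrow> (if odd k then ((v, x i) \<in> E \<longleftrightarrow> odd i) else (v, x i) \<in> E) \<longleftrightarrow> i < k"
    and vu: "(v, u) \<in> E"
  shows False
proof -
  define y where "y = (\<lambda>i. if i < k then x i else if i = k then u else if i = k + 1 then v else x (i - 2))"
  have u': "(x i, u) \<in> E \<longleftrightarrow> (u, x i) \<notin> E" and v': "(x i, v) \<in> E \<longleftrightarrow> (v, x i) \<notin> E" if "i < L" for i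
    using tot[of "x i"] V out x_V that by (metis image_eqI lessThan_iff)+
  have ne: "x i \<noteq> u" "x i \<noteq> v" if "i < L" for i using out that by blast+
  have uv: "u \<noteq> v" using vu irr V by blast
  have low: "y i \<noteq> y j \<and> ((y i, y j) \<in> E \<longleftrightarrow> line_arc i j)" if ij: "j < i" "i < L + 2" for i j
  proof -
    consider "i < k" | "i = k" | "i = k + 1" "j < k" | "i = k + 1" "j = k" | "k + 2 \<le> i" "j < k" | "k + 2 \<le> i" "j = k"
      | "k + 2 \<le> i" "j = k + 1" | "k + 2 \<le> i" "k + 2 \<le> j"
      using ij by linarith
    then show ?thesis
    proof cases
      case 1
      then show ?thesis using ij k x_arc[of i j] x_inj[of i j] by (simp add: y_def)
    next
      case 2
      then show ?thesis using ij k u[of j] ne[of j]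
        by (cases "odd k") (auto simp: y_def line_arc_odd line_arc_even)
    next
      case 3
      then show ?thesis using ij k v[of j] ne[of j]
        by (cases "odd k") (auto simp: y_def line_arc_odd line_arc_even)
    next
      case 4
      then show ?thesis using vu uv by (auto simp: y_def line_arc_def)
    next
      case 5
      then have "y i = x (i - 2)" "y j = x j" "j < i - 2" "i - 2 < L" using ij k by (auto simp: y_def)
      moreover have "even (i - 2) \<longleftrightarrow> even i" using 5 by simp
      ultimately show ?thesis using x_arc[of "i - 2" j] x_inj[of "i - 2" j] 5
        by (auto simp: line_arc_def)
    next
      case 6
      then have "y i = x (i - 2)" "y j = u" "i - 2 < L" "\<not> i - 2 < k" using ij k by (auto simp: y_def)
      moreover have "even (i - 2) \<longleftrightarrow> even i" using 6 by simp
      ultimately show ?thesis using u[of "i - 2"] u'[of "i - 2"] ne[of "i - 2"] 6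
        by (cases "odd k") (auto simp: line_arc_def)
    next
      case 7
      then have "y i = x (i - 2)" "y j = v" "i - 2 < L" "\<not> i - 2 < k" using ij k by (auto simp: y_def)
      moreover have "even (i - 2) \<longleftrightarrow> even i" using 7 by simp
      ultimately show ?thesis using v[of "i - 2"] v'[of "i - 2"] ne[of "i - 2"] 7 ij
        by (cases "odd k") (auto simp: line_arc_def)
    next
      case 8
      then have "y i = x (i - 2)" "y j = x (j - 2)" "j - 2 < i - 2" "i - 2 < L" using ij k by (auto simp: y_def)
      moreover have "even (i - 2) \<longleftrightarrow> even i" "even (j - 2) \<longleftrightarrow> even j" using 8 by simp_all
      ultimately show ?thesis using x_arc[of "i - 2" "j - 2"] x_inj[of "i - 2" "j - 2"] ij
        by (auto simp: line_arc_def)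
    qed
  qed
  have yV: "y i \<in> V" if "i < L + 2" for i
    using that V x_V[of i] x_V[of "i - 2"] k by (auto simp: y_def)
  have "copy_of line_arc (L + 2) y"
    unfolding copy_of_def
  proof (intro conjI allI impI yV)
    fix i j assume ij: "i < L + 2" "j < L + 2" "i \<noteq> j"
    then consider "j < i" | "i < j" by linarith
    then have "y i \<noteq> y j \<and> ((y i, y j) \<in> E \<longleftrightarrow> line_arc i j)"
    proof cases
      case 1 then show ?thesis using low ij by blast
    next
      case 2 then show ?thesis
        using low[of i j] ij tot[of "y i" "y j"] yV line_arc_total[of i j] by auto
    qed
    then show "y i \<noteq> y j" "(y i, y j) \<in> E \<longleftrightarrow> line_arc i j" by blast+
  qed
  then show False using maximal by blast
qed

text \<open>A wrong arc contradicts monotonicity at any index strictly between \<open>k\<close> and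
  \<open>k'\<close>, so \<open>k' = k + 1\<close>. Monotonicity then also settles the arcs of
  \<open>z\<close> with \<open>x k\<close> and of \<open>z'\<close> with \<open>x k'\<close>, and
  the pair \<open>z'\<close>, \<open>z\<close>, in this reversed order, fits between
  \<open>x k\<close> and \<open>x k'\<close>, against maximality.\<close>

lemma kin_kin_arc:
  assumes z: "z \<in> kin k" and z': "z' \<in> kin k'" and k: "k < k'" "k' < L"
  shows "(z', z) \<in> E \<longleftrightarrow> line_arc k' k"
proof (rule ccontr)
  assume wrong: "\<not> ((z', z) \<in> E \<longleftrightarrow> line_arc k' k)"
  have out: "z \<notin> x ` {..<L}" "z' \<notin> x ` {..<L}"
    using kin_arc'[OF z, of k'] kin_arc[OF z', of k] wrong k z z' by (auto simp: kin_def)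
  have ne: "z \<noteq> z'" using kin_disjoint[OF z, of k'] z' k by auto
  have V: "z \<in> V" "z' \<in> V" using z z' kin_V k by (auto dest: less_trans)
  define f where "f = (\<lambda>i. if odd k then (z, (x(k' := z')) i) \<in> E else ((z, (x(k' := z')) i) \<in> E \<longleftrightarrow> odd i))"
  define f' where "f' = (\<lambda>i. if odd k' then (z', (x(k := z)) i) \<in> E else ((z', (x(k := z)) i) \<in> E \<longleftrightarrow> odd i))"
  have kL: "k < L" using k by simp
  have f: "down_closed f L" unfolding f_def using kin_position[OF z out(1) z'] k by simp
  have f': "down_closed f' L" unfolding f'_def using kin_position[OF z' out(2) z] k by simp
  have fi: "f i \<longleftrightarrow> i < k" if "i < L" "i \<noteq> k" "i \<noteq> k'" for i
    using that kin_arc[OF z kL, of i] by (auto simp: f_def line_arc_odd line_arc_even)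
  have f'i: "f' i \<longleftrightarrow> i < k'" if "i < L" "i \<noteq> k" "i \<noteq> k'" for i
    using that kin_arc[OF z' k(2), of i] by (auto simp: f'_def line_arc_odd line_arc_even)
  have zz': "(z, z') \<in> E \<longleftrightarrow> (z', z) \<notin> E" using tot V ne by blast
  have f'k: "\<not> f' k" using wrong k by (auto simp: f'_def line_arc_odd line_arc_even)
  have fk': "f k'" using wrong k zz' line_arc_total[of k k'] by (auto simp: f_def line_arc_odd line_arc_even)
  have k': "k' = k + 1"
  proof (rule ccontr)
    assume "k' \<noteq> k + 1"
    then show False using down_closedD[OF f', of k "k + 1"] f'i[of "k + 1"] f'k k by auto
  qed
  have "\<not> f' k'" using down_closedD[OF f', of k k'] f'k k by blast
  moreover have "(z', x k) \<in> E \<longleftrightarrow> line_arc k' k" using kin_arc[OF z' k(2) kL] k by simp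
  ultimately have A': "(if odd k' then (z', x i) \<in> E else ((z', x i) \<in> E \<longleftrightarrow> odd i)) \<longleftrightarrow> i \<le> k" if "i < L" for i
    using f'i[of i] that k k' by (cases "i = k"; cases "i = k'") (auto simp: f'_def line_arc_odd line_arc_even)
  have "f k" using down_closedD[OF f, of k k'] fk' k by blast
  moreover have "(z, x k') \<in> E \<longleftrightarrow> line_arc k k'" using kin_arc[OF z kL k(2)] k by simp
  ultimately have A: "(if odd k then (z, x i) \<in> E else ((z, x i) \<in> E \<longleftrightarrow> odd i)) \<longleftrightarrow> i \<le> k" if "i < L" for i
    using fi[of i] that k k' by (cases "i = k"; cases "i = k'") (auto simp: f_def line_arc_odd line_arc_even)
  have "(z, z') \<in> E" using wrong k' zz' by (auto simp: line_arc_def)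
  then show False
    using no_inserted_pair[of "k + 1" z' z] V out A A' k k' by (cases "odd k") (simp_all add: less_Suc_eq_le)
qed

text \<open>If \<open>z\<close> beat \<open>d\<close>, then after exchanging \<open>x k\<close> for
  \<open>z\<close> there would be one exception to the dominance of \<open>d\<close>, which
  monotonicity allows only at the last index. Then either \<open>d\<close>, \<open>z\<close> prolong
  the line at its end, or, with \<open>z\<close> at the last index and \<open>d\<close> at
  \<open>L - 2\<close>, the displaced vertex \<open>x k\<close> fits neither pattern.\<close>

lemma above_kin:
  assumes d: "d \<in> V" "d \<notin> x ` {..<L}" "\<And>i. i < L \<Longrightarrow> (d, x i) \<in> E" and z: "z \<in> kin k" "k < L"
  shows "(d, z) \<in> E"
proof (rule ccontr)
  assume "(d, z) \<notin> E"
  have zo: "z \<notin> x ` {..<L}" using \<open>(d, z) \<notin> E\<close> d(3) z by (auto simp: kin_def)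
  have zV: "z \<in> V" using z kin_V by blast
  have "\<exists>i<L. i \<noteq> k \<and> \<not> line_arc k i"
    using z(2) L by (intro exI[of _ "if k = 0 then 1 else if even k then 0 else k + 1"]) (auto simp: line_arc_def; presburger)
  then have ne: "d \<noteq> z" using d(3) kin_arc[OF z] by blast
  have zd: "(z, d) \<in> E" using \<open>(d, z) \<notin> E\<close> tot[of z d] ne zV d(1) by blast
  define x1 where "x1 = x(k := z)"
  have x1: "copy_of line_arc L x1" unfolding x1_def by (rule replace_line[OF z])
  have g1: "(d, x1 i) \<in> E \<longleftrightarrow> i \<noteq> k" if "i < L" for i
    using that d(3) \<open>(d, z) \<notin> E\<close> by (simp add: x1_def)
  have "\<not> down_closed (\<lambda>i. (d, x1 i) \<in> E \<longleftrightarrow> odd i) L"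
  proof
    assume "down_closed (\<lambda>i. (d, x1 i) \<in> E \<longleftrightarrow> odd i) L"
    note D = down_closedD[OF this]
    have "(k \<noteq> 0 \<and> k \<noteq> 1) \<or> (k \<noteq> 2 \<and> k \<noteq> 3)" by arith
    then show False
    proof
      assume "k \<noteq> 0 \<and> k \<noteq> 1"
      then show False using D[of 0 1] g1[of 0] g1[of 1] L by simp
    next
      assume "k \<noteq> 2 \<and> k \<noteq> 3"
      then show False using D[of 2 3] g1[of 2] g1[of 3] L by simp
    qed
  qed
  moreover have dn: "d \<noteq> x1 i" if "i < L" for i using d(2) ne that by (auto simp: x1_def)
  ultimately have "down_closed (\<lambda>i. (d, x1 i) \<in> E) L"
    using pattern[OF x1 d(1)] by blast
  from down_closedD[OF this, of k "L - 1"] have k: "k = L - 1"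
    using g1[of k] g1[of "L - 1"] z(2) nat_neq_iff[of k "L - 1"] by auto
  have zx: "(z, x i) \<in> E \<longleftrightarrow> odd i" if "i < L - 1" for i
    using kin_arc[OF z, of i] that k L by (simp add: line_arc_even)
  show False
  proof (cases "(z, x k) \<in> E")
    case False
    have "(z, x i) \<in> E \<longleftrightarrow> odd i" if "i < L" for i
      using zx[of i] False that k L by (cases "i = k") auto
    then show ?thesis using no_inserted_pair[of L d z] d zV zo zd L by auto
  next
    case True
    have x1d: "(d, x1 i) \<in> E \<longleftrightarrow> i < L - 1" if "i < L" for i using g1[OF that] k that by auto
    define x2 where "x2 = x1(L - 2 := d)"
    interpret l1: maximal_line V E m x1 L
      by unfold_locales (use no_B6 m L_def x1 maximal in auto)
    have "(d, x1 i) \<in> E \<longleftrightarrow> line_arc (L - 2) i" if "i < L" "i \<noteq> L - 2" for i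
    proof -
      have "i < L - 1 \<longleftrightarrow> i < L - 2" "odd (L - 2)" using that L by auto
      then show ?thesis using x1d[OF that(1)] line_arc_odd[of "L - 2" i] that(2) by simp
    qed
    then have "d \<in> l1.kin (L - 2)"
      unfolding l1.kin_def using d(1) dn by auto
    then have x2: "copy_of line_arc L x2" unfolding x2_def using l1.replace_line L by simp
    have n: "x k \<noteq> x2 i" if "i < L" for i
      using that z d(2) zo x_inj[of k i] k L by (auto simp: x2_def x1_def)
    have g: "(x k, x2 i) \<in> E \<longleftrightarrow> i < L - 2 \<and> odd i" if iL: "i < L" for i
    proof -
      consider "i < L - 2" | "i = L - 2" | "i = L - 1" using iL by linarith
      then show ?thesis
      proof cases
        case 1
        then have "i < L - 1" "i \<noteq> L - 1" by linarith+
        then show ?thesis using x_arc[of k i] k L iL 1 by (simp add: x2_def x1_def line_arc_even)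
      next
        case 2 then show ?thesis using arc_asym[OF d(3)[of k]] d(1) x_V[of k] z(2) by (simp add: x2_def)
      next
        case 3
        then have "i \<noteq> L - 2" using L by linarith
        with 3 show ?thesis using arc_asym[OF True] zV x_V[of k] z(2) k L by (simp add: x2_def x1_def)
      qed
    qed
    from pattern[OF x2 x_V[OF z(2)] n] show False
    proof
      assume "down_closed (\<lambda>i. (x k, x2 i) \<in> E) L"
      moreover have "1 < L - 2" using L by linarith
      ultimately show False using down_closedD[of _ L 0 1] g[of 0] g[of 1] L by force
    next
      assume "down_closed (\<lambda>i. (x k, x2 i) \<in> E \<longleftrightarrow> odd i) L"
      moreover have "L - 2 < L - 1" "L - 1 < L" "L - 2 < L" "\<not> L - 1 < L - 2" using L by linarith+
      moreover have "odd (L - 2)" "even (L - 1)" using L by simp_all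
      ultimately show False using down_closedD[of _ L "L - 2" "L - 1"] g[of "L - 2"] g[of "L - 1"] by blast
    qed
  qed
qed

text \<open>Mirror image of \<open>above_kin\<close> at the other end: the exception must sit at
  index 0, and either \<open>z\<close>, \<open>d\<close> prolong the line before its beginning or,
  with \<open>z\<close> at 0 and \<open>d\<close> at 1, the displaced vertex \<open>x 0\<close> fits
  neither pattern.\<close>

lemma below_kin:
  assumes d: "d \<in> V" "d \<notin> x ` {..<L}" "\<And>i. i < L \<Longrightarrow> (d, x i) \<notin> E" and z: "z \<in> kin k" "k < L"
  shows "(d, z) \<notin> E"
proof
  assume dz: "(d, z) \<in> E"
  have zo: "z \<notin> x ` {..<L}" using dz d(3) z by (auto simp: kin_def)
  have zV: "z \<in> V" using z kin_V by blast
  have ne: "d \<noteq> z" using dz irr zV by blast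
  define x1 where "x1 = x(k := z)"
  have x1: "copy_of line_arc L x1" unfolding x1_def by (rule replace_line[OF z])
  have g1: "(d, x1 i) \<in> E \<longleftrightarrow> i = k" if "i < L" for i
    using that d(3) dz by (simp add: x1_def)
  have "\<not> down_closed (\<lambda>i. (d, x1 i) \<in> E \<longleftrightarrow> odd i) L"
  proof
    assume "down_closed (\<lambda>i. (d, x1 i) \<in> E \<longleftrightarrow> odd i) L"
    note D = down_closedD[OF this]
    have "(k \<noteq> 1 \<and> k \<noteq> 2) \<or> (k \<noteq> 3 \<and> k \<noteq> 4)" by arith
    then show False
    proof
      assume "k \<noteq> 1 \<and> k \<noteq> 2"
      then show False using D[of 1 2] g1[of 1] g1[of 2] L by simp
    next
      assume "k \<noteq> 3 \<and> k \<noteq> 4"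
      then show False using D[of 3 4] g1[of 3] g1[of 4] L by simp
    qed
  qed
  moreover have dn: "d \<noteq> x1 i" if "i < L" for i using d(2) ne that by (auto simp: x1_def)
  ultimately have "down_closed (\<lambda>i. (d, x1 i) \<in> E) L"
    using pattern[OF x1 d(1)] by blast
  from down_closedD[OF this, of 0 k] have k: "k = 0"
    using g1[of k] g1[of 0] z(2) by (cases "k = 0") auto
  have zx: "(z, x i) \<in> E \<longleftrightarrow> even i" if "0 < i" "i < L" for i
    using kin_arc[OF z, of i] that k L by (simp add: line_arc_even)
  show False
  proof (cases "(z, x 0) \<in> E")
    case True
    have "(z, x i) \<in> E \<longleftrightarrow> even i" if "i < L" for i
      using zx[of i] True that by (cases "i = 0") auto
    then show ?thesis using no_inserted_pair[of 0 z d] d zV zo dz L by auto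
  next
    case False
    define x2 where "x2 = x1(1 := d)"
    interpret l1: maximal_line V E m x1 L
      by unfold_locales (use no_B6 m L_def x1 maximal in auto)
    have "d \<in> l1.kin 1"
      unfolding l1.kin_def using d(1) dn g1 k L by (auto simp: line_arc_odd)
    then have x2: "copy_of line_arc L x2" unfolding x2_def using l1.replace_line L by simp
    have n: "x 0 \<noteq> x2 i" if "i < L" for i
      using that z d(2) zo x_inj[of 0 i] k L by (auto simp: x2_def x1_def)
    have zx0: "(x 0, z) \<in> E" using False tot[of "x 0" z] zV x_V[of 0] z(2) k zo by auto
    have "(x 0, d) \<in> E" using d(3)[of 0] tot[of "x 0" d] d(1,2) x_V[of 0] z(2) k by auto
    then have g: "(x 0, x2 i) \<in> E \<longleftrightarrow> i = 1 \<or> even i" if "i < L" for i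
      using that zx0 x_arc[of 0 i] L k by (auto simp: x2_def x1_def line_arc_even)
    from pattern[OF x2 x_V[OF z(2)[unfolded k]] n] show False
    proof
      assume "down_closed (\<lambda>i. (x 0, x2 i) \<in> E) L"
      from down_closedD[OF this, of 3 4] show False using g[of 3] g[of 4] L by simp
    next
      assume "down_closed (\<lambda>i. (x 0, x2 i) \<in> E \<longleftrightarrow> odd i) L"
      from down_closedD[OF this, of 0 1] show False using g[of 0] g[of 1] L by simp
    qed
  qed
qed

text \<open>Primality is used twice. The union of the classes is homogeneous, because every other
  vertex sees it uniformly, so it is \<open>V\<close>; then each single class is homogeneous too and
  must be a singleton.\<close>

lemma prime_eq_line:
  assumes p: "prime_tour V E"
  shows "V = x ` {..<L}"
proof -
  have kin_x: "x k \<in> kin k" for k by (simp add: kin_def)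
  have ne: "x 0 \<noteq> x 1" using x_inj[of 0 1] L by simp
  have kk: "(w, y) \<in> E \<longleftrightarrow> line_arc k' k" if "w \<in> kin k'" "y \<in> kin k" "k < L" "k' < L" "k \<noteq> k'" for w y k k'
  proof (cases "k < k'")
    case True then show ?thesis using kin_kin_arc that by blast
  next
    case False
    then have "k' < k" using that by simp
    moreover have "w \<noteq> y" using kin_disjoint that by blast
    ultimately show ?thesis
      using kin_kin_arc[of w k' y k] that tot[of w y] kin_V line_arc_total[of k k'] by blast
  qed
  have "homogeneous V E (\<Union>k<L. kin k)"
    unfolding homogeneous_def
  proof (intro conjI ballI impI)
    show "(\<Union>k<L. kin k) \<subseteq> V" using kin_V by blast
    fix z a b assume z: "z \<in> V - (\<Union>k<L. kin k)" and ab: "a \<in> (\<Union>k<L. kin k)" "b \<in> (\<Union>k<L. kin k)"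
      and za: "(z, a) \<in> E"
    from z have "z \<in> V" by blast
    then show "(z, b) \<in> E"
    proof (cases rule: kin_cases)
      case (1 k) then show ?thesis using z by blast
    next
      case 2 then show ?thesis using above_kin[of z] z ab by blast
    next
      case 3 then show ?thesis using below_kin[of z] z ab za by blast
    qed
  qed
  moreover have "x 0 \<in> (\<Union>k<L. kin k)" "x 1 \<in> (\<Union>k<L. kin k)" using kin_x L by force+
  ultimately have V: "(\<Union>k<L. kin k) = V" using p ne unfolding prime_tour_def by blast
  have "kin k = {x k}" if k: "k < L" for k
  proof (rule ccontr)
    assume "kin k \<noteq> {x k}"
    then obtain b where b: "b \<in> kin k" "b \<noteq> x k" using kin_x by blast
    have "homogeneous V E (kin k)"
      unfolding homogeneous_def
    proof (intro conjI ballI impI)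
      show "kin k \<subseteq> V" using kin_V k by blast
      fix z a b assume z: "z \<in> V - kin k" and ab: "a \<in> kin k" "b \<in> kin k" and za: "(z, a) \<in> E"
      obtain k' where "k' < L" "z \<in> kin k'" using z V by blast
      moreover have "k' \<noteq> k" using z calculation by blast
      ultimately show "(z, b) \<in> E" using kk[of z k' a k] kk[of z k' b k] ab za k by blast
    qed
    then have "kin k = V" using p b kin_x unfolding prime_tour_def by blast
    moreover obtain k' where "k' < L" "k' \<noteq> k" using L that[of 0] that[of 1] by (cases "k = 0") auto
    ultimately show False using kin_disjoint[of "x k'" k k'] kin_x x_V k by blast
  qed
  then show ?thesis using V by auto
qed

end

lemma cycle_free_subset: "cycle_free E X \<Longrightarrow> Y \<subseteq> X \<Longrightarrow> cycle_free E Y"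
  unfolding cycle_free_def by blast

section \<open>Finite facts about P7\<close>

lemma p7_separated:
  assumes "q < 7" "k' < 7" "q \<noteq> k'" "k < 7"
  shows "\<exists>i<6. i \<noteq> q \<and> i \<noteq> k' \<and> i \<noteq> k \<and> p7_arc q i \<noteq> p7_arc k' i"
proof -
  have "\<forall>q\<in>set [0..<7]. \<forall>k'\<in>set [0..<7]. q \<noteq> k' \<longrightarrow> (\<forall>k\<in>set [0..<7].
     \<exists>i\<in>set [0..<6]. i \<noteq> q \<and> i \<noteq> k' \<and> i \<noteq> k \<and> p7_arc q i \<noteq> p7_arc k' i)"
    unfolding p7_arc_def by code_simp
  then show ?thesis using assms by (metis atLeastLessThan_upt atLeastLessThan_iff le0)
qed

lemma p7_mixed:
  assumes "q < 7" "k < 7"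
  shows "\<exists>i<6. i \<noteq> q \<and> i \<noteq> k \<and> p7_arc q i" "\<exists>i<6. i \<noteq> q \<and> i \<noteq> k \<and> \<not> p7_arc q i"
proof -
  have "\<forall>q\<in>set [0..<7]. \<forall>k\<in>set [0..<7]. (\<exists>i\<in>set [0..<6]. i \<noteq> q \<and> i \<noteq> k \<and> p7_arc q i) \<and>
     (\<exists>i\<in>set [0..<6]. i \<noteq> q \<and> i \<noteq> k \<and> \<not> p7_arc q i)"
    unfolding p7_arc_def by code_simp
  then show "\<exists>i<6. i \<noteq> q \<and> i \<noteq> k \<and> p7_arc q i" "\<exists>i<6. i \<noteq> q \<and> i \<noteq> k \<and> \<not> p7_arc q i"
    using assms by (metis atLeastLessThan_upt atLeastLessThan_iff le0)+
qed

lemma p7_total: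
  assumes "i < 7" "j < 7" "i \<noteq> j"
  shows "p7_arc i j \<longleftrightarrow> \<not> p7_arc j i"
proof -
  have "\<forall>i\<in>set [0..<7]. \<forall>j\<in>set [0..<7]. i \<noteq> j \<longrightarrow> (p7_arc i j \<longleftrightarrow> \<not> p7_arc j i)"
    unfolding p7_arc_def by code_simp
  then show ?thesis using assms by (metis atLeastLessThan_upt atLeastLessThan_iff le0)
qed

lemma p7_out_degree: "i < 7 \<Longrightarrow> card {j. j < 7 \<and> p7_arc i j} \<le> 3"
proof -
  assume i: "i < 7"
  have "\<forall>i\<in>set [0..<7]. length (filter (p7_arc i) [0..<7]) \<le> 3"
    unfolding p7_arc_def by code_simp
  then have "length (filter (p7_arc i) [0..<7]) \<le> 3"
    using i by (metis atLeastLessThan_upt atLeastLessThan_iff le0)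
  moreover have "{j. j < 7 \<and> p7_arc i j} = set (filter (p7_arc i) [0..<7])" by auto
  ultimately show ?thesis by (metis card_length le_trans)
qed

lemma p7_arc_Suc: "p7_arc (Suc i) (Suc j) = p7_arc i j"
  by (simp add: p7_arc_def add.commute)

section \<open>Sources, converses and local transitivity of prime tournaments\<close>

context w5_free_tour
begin

lemma cycle_free_source:
  assumes "finite X" "X \<noteq> {}" "X \<subseteq> V" "cycle_free E X"
  shows "\<exists>u\<in>X. \<forall>y\<in>X - {u}. (u, y) \<in> E"
  using assms
proof (induction X rule: finite_ne_induct)
  case (singleton a)
  then show ?case by simp
next
  case (insert a F)
  have "cycle_free E F" using cycle_free_subset[OF insert.prems(2)] by blast
  then obtain u where u: "u \<in> F" "\<forall>y\<in>F - {u}. (u, y) \<in> E"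
    using insert.IH insert.prems(1) by blast
  have V: "a \<in> V" "F \<subseteq> V" and au: "a \<noteq> u" using insert.prems(1) insert.hyps u by blast+
  show ?case
  proof (cases "(u, a) \<in> E")
    case True
    then show ?thesis using u by blast
  next
    case False
    have a: "(a, u) \<in> E" using False tot[of a u] au V u by blast
    have "(a, y) \<in> E" if "y \<in> F - {a}" for y
    proof (rule ccontr)
      assume "(a, y) \<notin> E"
      then have "(y, a) \<in> E" using tot[of a y] that V by blast
      moreover have "y \<noteq> u" using \<open>(a, y) \<notin> E\<close> a by blast
      ultimately show False using insert.prems(2) u a that unfolding cycle_free_def by blast
    qed
    then show ?thesis by blast
  qed
qed

text \<open>W5 is isomorphic to its converse: keep \<open>v\<close> and reverse the order of the
  other four vertices.\<close>

lemma converse_w5_free: "w5_free_tour V (E\<inverse>)"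
proof
  fix v w1 w2 w3 w4
  assume "v \<in> V" "w1 \<in> V" "w2 \<in> V" "w3 \<in> V" "w4 \<in> V"
  then show "\<not> forms_W5 (E\<inverse>) v w1 w2 w3 w4"
    using no_W5[of v w4 w3 w2 w1] unfolding converse_iff by argo
next
  fix x y assume "x \<in> V" "y \<in> V" "x \<noteq> y"
  then show "(x, y) \<in> E\<inverse> \<longleftrightarrow> (y, x) \<notin> E\<inverse>" using tot[of y x] by simp
qed (simp_all add: fin irr)

lemma converse_prime:
  assumes "prime_tour V E" shows "prime_tour V (E\<inverse>)"
proof -
  have "homogeneous V E M" if M: "homogeneous V (E\<inverse>) M" for M
    unfolding homogeneous_def
  proof (intro conjI ballI impI)
    show MV: "M \<subseteq> V" using M by (simp add: homogeneous_def)
    fix z x y assume a: "z \<in> V - M" "x \<in> M" "y \<in> M" "(z, x) \<in> E"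
    then have "z \<noteq> y" "z \<noteq> x" "x \<in> V" "y \<in> V" using MV by auto
    then have "(y, z) \<notin> E" using M a tot[of z x] unfolding homogeneous_def by blast
    then show "(z, y) \<in> E" using tot[of z y] a \<open>z \<noteq> y\<close> \<open>y \<in> V\<close> by blast
  qed
  then show ?thesis using assms by (auto simp: prime_tour_def)
qed

text \<open>
  Inside the out-neighbourhood of \<open>u\<close>, join two vertices if they lie on a common 3-cycle.  If no vertex
  splits such a 3-cycle, then a connected component is homogeneous; a splitting vertex yields \<open>W\<^sub>5\<close> or a line.
\<close>

lemma prime_out_cycle_line:
  assumes p: "prime_tour V E" and u: "u \<in> V"
    and abc: "a \<in> V" "b \<in> V" "c \<in> V" "(u, a) \<in> E" "(u, b) \<in> E" "(u, c) \<in> E"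
      "(a, b) \<in> E" "(b, c) \<in> E" "(c, a) \<in> E"
  shows "\<exists>y. copy_of line_arc 5 y"
proof (rule ccontr)
  assume no: "\<nexists>y. copy_of line_arc 5 y"
  define A where "A = {y \<in> V. (u, y) \<in> E}"
  define tri where "tri p q r \<longleftrightarrow> p \<in> A \<and> q \<in> A \<and> r \<in> A \<and> cycle3 E p q r" for p q r
  define R where "R = {(p, q). \<exists>r. tri p q r \<or> tri q p r}"
  define K where "K = R\<^sup>* `` {a}"
  have tri_rot: "tri p q r \<Longrightarrow> tri q r p" for p q r by (auto simp: tri_def)
  have tri_K: "q \<in> K \<and> r \<in> K" if "tri p q r" "p \<in> K" for p q r
  proof -
    have "(p, q) \<in> R" "(p, r) \<in> R" using that tri_rot unfolding R_def by blast+
    then show ?thesis using that(2) unfolding K_def by (auto intro: rtrancl_into_rtrancl)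
  qed
  have KA: "K \<subseteq> A"
  proof
    fix y assume "y \<in> K"
    then have "(a, y) \<in> R\<^sup>*" by (simp add: K_def)
    then show "y \<in> A"
      by (induction rule: rtrancl_induct) (use abc in \<open>auto simp: A_def R_def tri_def\<close>)
  qed
  have uK: "u \<notin> K" using KA irr u by (auto simp: A_def)
  have step: "(w, q) \<in> E" if t: "tri p q r" "p \<in> K" and w: "w \<in> V - K" and wp: "(w, p) \<in> E" for p q r w
  proof (rule ccontr)
    assume nq: "(w, q) \<notin> E"
    have K: "q \<in> K" "r \<in> K" using tri_K[OF t] by blast+
    have V: "p \<in> V" "q \<in> V" "r \<in> V" "w \<in> V" using t w by (auto simp: tri_def A_def)
    have ne: "w \<noteq> p" "w \<noteq> q" "w \<noteq> r" using w t K by auto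
    have qw: "(q, w) \<in> E" using nq tot[of q w] V ne by blast
    have T: "(u, p) \<in> E" "(u, q) \<in> E" "(u, r) \<in> E" "(p, q) \<in> E" "(q, r) \<in> E" "(r, p) \<in> E"
      using t by (auto simp: tri_def A_def)
    show False
    proof (cases "w \<in> A")
      case True
      \<comment> \<open>A splitter in the out-neighbourhood of \<open>u\<close> would close a
        3-cycle of its own with \<open>p\<close> and \<open>q\<close> and so lie in
        \<open>K\<close>.\<close>
      then have "tri p q w" using t wp qw by (auto simp: tri_def)
      then show False using tri_K[of p q w] t w by blast
    next
      case False
      have "w \<noteq> u" using nq T by blast
      then have wu: "(w, u) \<in> E" using False tot[of w u] V u by (auto simp: A_def)
      show False
      proof (cases "(w, r) \<in> E")
        case True
        then show False using no_W5[of q w u r p] V u wu wp T qw by blast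
      next
        case False
        then have rw: "(r, w) \<in> E" using tot[of r w] V ne by blast
        \<comment> \<open>What remains is a five-vertex line with \<open>q\<close>,
          \<open>r\<close>, \<open>w\<close> at the even positions and \<open>p\<close>,
          \<open>u\<close> at the odd ones.\<close>
        let ?y = "\<lambda>i::nat. if i = 0 then q else if i = 1 then p else if i = 2 then r else if i = 3 then u else w"
        have A: "(q, r) \<in> E" "(q, w) \<in> E" "(r, w) \<in> E" "(p, q) \<in> E" "(r, p) \<in> E" "(u, q) \<in> E" "(u, p) \<in> E" "(u, r) \<in> E"
          "(w, p) \<in> E" "(w, u) \<in> E" using T qw rw wp wu by auto
        have N: "(r, q) \<notin> E" "(w, q) \<notin> E" "(w, r) \<notin> E" "(q, p) \<notin> E" "(p, r) \<notin> E" "(q, u) \<notin> E" "(p, u) \<notin> E" "(r, u) \<notin> E"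
          "(p, w) \<notin> E" "(u, w) \<notin> E" using A[THEN arc_asym] V u by auto
        have D: "distinct [q, p, r, u, w]" using A N by auto
        have "copy_of line_arc 5 ?y"
          unfolding copy_of_def all_less_numeral using A N D V u
          by (simp add: line_arc_def del: One_nat_def) auto
        then show False using no by blast
      qed
    qed
  qed
  have pair: "(w, y) \<in> E \<longleftrightarrow> (w, y') \<in> E" if "(y, y') \<in> R" "y \<in> K" "w \<in> V - K" for w y y'
  proof -
    have all: "(w, p) \<in> E \<longleftrightarrow> (w, q) \<in> E" "(w, q) \<in> E \<longleftrightarrow> (w, r) \<in> E" if "tri p q r" "p \<in> K" for p q r
      using step[OF that \<open>w \<in> V - K\<close>] step[OF tri_rot[OF that(1)] _ \<open>w \<in> V - K\<close>]
        step[OF tri_rot[OF tri_rot[OF that(1)]] _ \<open>w \<in> V - K\<close>] tri_K[OF that] by blast+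
    from that(1) obtain r where "tri y y' r \<or> tri y' y r" by (auto simp: R_def)
    then show ?thesis
      using all[of y y' r] all[of y r y'] that(2) tri_rot[of y' y r] by blast
  qed
  have "(w, y) \<in> E \<longleftrightarrow> (w, a) \<in> E" if w: "w \<in> V - K" and y: "y \<in> K" for w y
  proof -
    from y have "(a, y) \<in> R\<^sup>*" by (simp add: K_def)
    then show ?thesis
    proof (induction rule: rtrancl_induct)
      case base then show ?case by simp
    next
      case (step y y')
      have "y \<in> K" using step.hyps(1) by (simp add: K_def)
      then show ?case using pair[OF step.hyps(2) _ w] step.IH by blast
    qed
  qed
  then have "homogeneous V E K" using KA unfolding homogeneous_def A_def by blast
  moreover have "a \<in> K" by (simp add: K_def)
  moreover have "b \<in> K" using tri_K[of a b c] abc \<open>a \<in> K\<close> by (auto simp: tri_def A_def)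
  moreover have "a \<noteq> b" using abc irr by blast
  ultimately have "K = V" using p unfolding prime_tour_def by blast
  then show False using uK u by blast
qed

text \<open>This is \<open>prime_out_cycle_line\<close> for the converse. Reversing the positions by
  \<open>4 - i\<close> preserves parities and carries a five-vertex line to its converse.\<close>

lemma prime_in_cycle_line:
  assumes p: "prime_tour V E" and u: "u \<in> V"
    and abc: "a \<in> V" "b \<in> V" "c \<in> V" "(a, u) \<in> E" "(b, u) \<in> E" "(c, u) \<in> E"
      "(a, b) \<in> E" "(b, c) \<in> E" "(c, a) \<in> E"
  shows "\<exists>y. copy_of line_arc 5 y"
proof -
  interpret c: w5_free_tour V "E\<inverse>" by (rule converse_w5_free)
  obtain y where y: "c.copy_of line_arc 5 y"
    using c.prime_out_cycle_line[OF converse_prime[OF p] u, of a c b] abc by auto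
  have l: "line_arc (4 - i) (4 - j) \<longleftrightarrow> line_arc j i" if "i < 5" "j < 5" for i j
    using that unfolding line_arc_def by auto
  have "copy_of line_arc 5 (\<lambda>i. y (4 - i))"
    unfolding copy_of_def
  proof (intro conjI allI impI)
    fix i j :: nat assume ij: "i < 5" "j < 5" "i \<noteq> j"
    then have "4 - i < 5" "4 - j < 5" "4 - i \<noteq> 4 - j" by linarith+
    then have "y (4 - i) \<noteq> y (4 - j)" "(y (4 - j), y (4 - i)) \<in> E\<inverse> \<longleftrightarrow> line_arc (4 - j) (4 - i)"
      using y unfolding c.copy_of_def by auto
    then show "y (4 - i) \<noteq> y (4 - j)" "(y (4 - i), y (4 - j)) \<in> E \<longleftrightarrow> line_arc i j"
      using l[of j i] ij by auto
  qed (use y in \<open>auto simp: c.copy_of_def\<close>)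
  then show ?thesis by blast
qed

end

section \<open>Prime tournaments containing six vertices of P7\<close>

locale p7_subtour = w5_free_tour +
  fixes h :: "nat \<Rightarrow> 'a"
  assumes copy: "copy_of p7_arc 6 h"
begin

text \<open>There are seven types although the copy has six vertices: the class of index 6 contains
  no vertex of the copy and may be empty.\<close>

definition kin7 :: "nat \<Rightarrow> 'a set" where
  "kin7 k = (if k < 6 then {h k} else {}) \<union>
     {z \<in> V - h ` {..<6}. \<forall>i<6. i \<noteq> k \<longrightarrow> ((z, h i) \<in> E \<longleftrightarrow> p7_arc k i)}"

lemma h_V: "i < 6 \<Longrightarrow> h i \<in> V"
  and h_inj: "i < 6 \<Longrightarrow> j < 6 \<Longrightarrow> h i = h j \<longleftrightarrow> i = j"
  and h_arc: "i < 6 \<Longrightarrow> j < 6 \<Longrightarrow> i \<noteq> j \<Longrightarrow> (h i, h j) \<in> E \<longleftrightarrow> p7_arc i j"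
  using copy unfolding copy_of_def by blast+

lemma kin7_V: "kin7 k \<subseteq> V"
  by (auto simp: kin7_def h_V split: if_splits)

lemma kin7_ne: "z \<in> kin7 k \<Longrightarrow> i < 6 \<Longrightarrow> i \<noteq> k \<Longrightarrow> z \<noteq> h i"
  by (auto simp: kin7_def h_inj split: if_splits)

lemma kin7_arc: "z \<in> kin7 k \<Longrightarrow> i < 6 \<Longrightarrow> i \<noteq> k \<Longrightarrow> (z, h i) \<in> E \<longleftrightarrow> p7_arc k i"
  by (auto simp: kin7_def h_arc split: if_splits)

lemma kin7_arc':
  assumes "z \<in> kin7 k" "k < 7" "i < 6" "i \<noteq> k"
  shows "(h i, z) \<in> E \<longleftrightarrow> p7_arc i k"
  using kin7_arc[OF assms(1,3,4)] tot[of z "h i"] kin7_ne[OF assms(1,3,4)] assms kin7_V h_V[of i]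
    p7_total[of i k] by auto

lemma kin7_disjoint:
  assumes "z \<in> kin7 k" "z \<in> kin7 k'" "k < 7" "k' < 7"
  shows "k = k'"
proof (rule ccontr)
  assume "k \<noteq> k'"
  then obtain i where "i < 6" "i \<noteq> k" "i \<noteq> k'" "p7_arc k i \<noteq> p7_arc k' i"
    using p7_separated[of k k' k] assms by blast
  then show False using kin7_arc[OF assms(1)] kin7_arc[OF assms(2)] by blast
qed

lemma replace_p7:
  assumes z: "z \<in> kin7 k" "k < 6"
  shows "copy_of p7_arc 6 (h(k := z))"
  unfolding copy_of_def
proof (intro conjI allI impI)
  fix i :: nat assume "i < 6" then show "(h(k := z)) i \<in> V" using h_V z kin7_V by auto
next
  fix i j :: nat assume ij: "i < 6" "j < 6" "i \<noteq> j"
  show "(h(k := z)) i \<noteq> (h(k := z)) j"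
    using ij kin7_ne[OF z(1), of i] kin7_ne[OF z(1), of j] h_inj by (auto simp: fun_upd_def)
  show "((h(k := z)) i, (h(k := z)) j) \<in> E \<longleftrightarrow> p7_arc i j"
    using ij kin7_arc[OF z(1), of j] kin7_arc'[OF z(1), of i] h_arc[of i j] z(2) by (auto simp: fun_upd_def)
qed

text \<open>The arc with \<open>h' k\<close> is recovered from the remaining ones: every other
  pattern offered by \<open>p7_pattern\<close> differs from type \<open>k'\<close> at some index
  apart from \<open>k\<close> and \<open>k'\<close>, and this is why \<open>p7_separated\<close>
  keeps a third index out.\<close>

lemma p7_flip:
  assumes h': "copy_of p7_arc 6 h'" and z: "z \<in> V" "\<And>i. i < 6 \<Longrightarrow> z \<noteq> h' i"
    and k: "k < 6" "k' < 7" "k \<noteq> k'"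
    and g: "\<And>i. i < 6 \<Longrightarrow> i \<noteq> k \<Longrightarrow> i \<noteq> k' \<Longrightarrow> (z, h' i) \<in> E \<longleftrightarrow> p7_arc k' i"
  shows "(z, h' k) \<in> E \<longleftrightarrow> p7_arc k' k"
proof -
  from p7_pattern[OF h' z] consider q where "q < 7" "\<forall>i<6. i \<noteq> q \<longrightarrow> ((z, h' i) \<in> E \<longleftrightarrow> p7_arc q i)"
    | "\<forall>i<6. (z, h' i) \<in> E" | "\<forall>i<6. (z, h' i) \<notin> E" by blast
  then show ?thesis
  proof cases
    case (1 q)
    show ?thesis
    proof (cases "q = k'")
      case True then show ?thesis using 1 k by blast
    next
      case False
      then obtain i where "i < 6" "i \<noteq> q" "i \<noteq> k'" "i \<noteq> k" "p7_arc q i \<noteq> p7_arc k' i"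
        using p7_separated[of q k' k] 1(1) k by auto
      then show ?thesis using g 1(2) by blast
    qed
  next
    case 2
    then show ?thesis using p7_mixed(2)[of k' k] g k by auto
  next
    case 3
    then show ?thesis using p7_mixed(1)[of k' k] g k by auto
  qed
qed

lemma p7_const:
  assumes h': "copy_of p7_arc 6 h'" and z: "z \<in> V" "\<And>i. i < 6 \<Longrightarrow> z \<noteq> h' i" and k: "k < 6"
    and g: "\<And>i. i < 6 \<Longrightarrow> i \<noteq> k \<Longrightarrow> (z, h' i) \<in> E \<longleftrightarrow> b"
  shows "(z, h' k) \<in> E \<longleftrightarrow> b"
proof -
  from p7_pattern[OF h' z] consider q where "q < 7" "\<forall>i<6. i \<noteq> q \<longrightarrow> ((z, h' i) \<in> E \<longleftrightarrow> p7_arc q i)"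
    | "\<forall>i<6. (z, h' i) \<in> E" | "\<forall>i<6. (z, h' i) \<notin> E" by blast
  then show ?thesis
  proof cases
    case (1 q)
    then show ?thesis using p7_mixed[of q k] g k by (cases b) auto
  next
    case 2
    then show ?thesis using g[of 0] g[of 1] k by (cases "k = 0") auto
  next
    case 3
    then show ?thesis using g[of 0] g[of 1] k by (cases "k = 0") auto
  qed
qed

text \<open>At least one of the two indices is below 6. Its vertex can be put into the copy, and
  then \<open>p7_flip\<close> yields the arc.\<close>

lemma kin7_kin7_arc:
  assumes z: "z \<in> kin7 k" and z': "z' \<in> kin7 k'" and k: "k < 7" "k' < 7" "k \<noteq> k'"
  shows "(z, z') \<in> E \<longleftrightarrow> p7_arc k k'"
proof -
  have *: "(z, z') \<in> E \<longleftrightarrow> p7_arc k k'"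
    if z: "z \<in> kin7 k" and z': "z' \<in> kin7 k'" and k: "k < 7" "k' < 6" "k \<noteq> k'" for z z' k k'
  proof (cases "z \<in> h ` {..<6}")
    case True
    then have "z = h k" "k < 6" using z by (auto simp: kin7_def split: if_splits)
    then show ?thesis using kin7_arc'[OF z', of k] k by simp
  next
    case False
    have "z \<noteq> z'" using kin7_disjoint[OF z, of k'] z' k by auto
    then have "z \<noteq> (h(k' := z')) i" if "i < 6" for i using False that by auto
    moreover have "(z, (h(k' := z')) i) \<in> E \<longleftrightarrow> p7_arc k i" if "i < 6" "i \<noteq> k'" "i \<noteq> k" for i
      using kin7_arc[OF z, of i] that by simp
    ultimately have "(z, (h(k' := z')) k') \<in> E \<longleftrightarrow> p7_arc k k'"
      using p7_flip[OF replace_p7[OF z' k(2)], of z k' k] k z kin7_V by auto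
    then show ?thesis by simp
  qed
  show ?thesis
  proof (cases "k' < 6")
    case True then show ?thesis using *[OF z z'] k by blast
  next
    case False
    have "z \<noteq> z'" using kin7_disjoint[OF z] z' k by blast
    then show ?thesis
      using *[OF z' z] False k tot[of z z'] kin7_V z z' p7_total[of k k'] by auto
  qed
qed

lemma outer_kin7:
  assumes d: "d \<in> V" "d \<notin> h ` {..<6}" "\<And>i. i < 6 \<Longrightarrow> (d, h i) \<in> E \<longleftrightarrow> b" and z: "z \<in> kin7 k" "k < 7"
  shows "(d, z) \<in> E \<longleftrightarrow> b"
proof -
  obtain i where "i < 6" "i \<noteq> k" "p7_arc k i \<noteq> b"
    using p7_mixed[of k k] z by (cases b) auto
  then have ne: "d \<noteq> z" using d(3) kin7_arc[OF z(1)] by blast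
  show ?thesis
  proof (cases "k < 6")
    case True
    have "(d, (h(k := z)) k) \<in> E \<longleftrightarrow> b"
      by (rule p7_const[OF replace_p7[OF z(1) True] d(1)]) (use d ne True in \<open>auto split: if_splits\<close>)
    then show ?thesis by simp
  next
    case False
    then have k: "k = 6" using z by simp
    \<comment> \<open>Type 6 has no place in the copy, so \<open>h 0\<close> is dropped and P7 is
      rotated by one; \<open>z\<close> enters at position 5.\<close>
    define h' where "h' i = (if i < 5 then h (Suc i) else z)" for i
    have "copy_of p7_arc 6 h'"
      unfolding copy_of_def
    proof (intro conjI allI impI)
      fix i :: nat assume "i < 6" then show "h' i \<in> V" using h_V z kin7_V by (auto simp: h'_def)
    next
      fix i j :: nat assume ij: "i < 6" "j < 6" "i \<noteq> j"
      have zn: "z \<noteq> h q" if "q < 6" for q using kin7_ne[OF z(1) that] k that by simp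
      have c: "i < 5 \<and> j < 5 \<or> i = 5 \<and> j < 5 \<or> i < 5 \<and> j = 5" using ij by linarith
      then show "h' i \<noteq> h' j"
        using ij zn[of "Suc i"] zn[of "Suc j"] h_inj[of "Suc i" "Suc j"] by (auto simp: h'_def)
      from c show "(h' i, h' j) \<in> E \<longleftrightarrow> p7_arc i j"
        using ij h_arc[of "Suc i" "Suc j"] kin7_arc[OF z(1), of "Suc j"] kin7_arc'[OF z, of "Suc i"]
          p7_arc_Suc[of i j] p7_arc_Suc[of 5 j] p7_arc_Suc[of i 5] k
        by (auto simp: h'_def eval_nat_numeral)
    qed
    then have "(d, h' 5) \<in> E \<longleftrightarrow> b"
      by (rule p7_const[OF _ d(1)]) (use d ne in \<open>auto simp: h'_def\<close>)
    then show ?thesis by (simp add: h'_def)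
  qed
qed

text \<open>As for lines, primality makes the classes singletons that cover \<open>V\<close>, so
  \<open>V\<close> embeds into P7. There out-degrees are at most three, and all of \<open>X\<close>
  but its source lies among the out-neighbours of the source.\<close>

lemma cycle_free_card_le:
  assumes p: "prime_tour V E" and X: "X \<subseteq> V" "cycle_free E X" "X \<noteq> {}"
  shows "card X \<le> 4"
proof -
  have h_kin: "h k \<in> kin7 k" if "k < 6" for k using that by (simp add: kin7_def)
  have "homogeneous V E (\<Union>k<7. kin7 k)"
    unfolding homogeneous_def
  proof (intro conjI ballI impI)
    show "(\<Union>k<7. kin7 k) \<subseteq> V" using kin7_V by blast
    fix z a b assume z: "z \<in> V - (\<Union>k<7. kin7 k)" and ab: "a \<in> (\<Union>k<7. kin7 k)" "b \<in> (\<Union>k<7. kin7 k)"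
      and za: "(z, a) \<in> E"
    have zh: "z \<notin> h ` {..<6}" using z h_kin by force
    then have zn: "z \<noteq> h i" if "i < 6" for i using that by blast
    have zV: "z \<in> V" using z by blast
    have nk: "\<not> (\<exists>k<7. \<forall>i<6. i \<noteq> k \<longrightarrow> ((z, h i) \<in> E \<longleftrightarrow> p7_arc k i))"
      using z zh by (auto simp: kin7_def)
    have "(\<forall>i<6. (z, h i) \<in> E) \<or> (\<forall>i<6. (z, h i) \<notin> E)"
    proof -
      have "(\<exists>k<7. \<forall>i<6. i \<noteq> k \<longrightarrow> ((z, h i) \<in> E \<longleftrightarrow> p7_arc k i)) \<or> (\<forall>i<6. (z, h i) \<in> E) \<or> (\<forall>i<6. (z, h i) \<notin> E)"
        by (rule p7_pattern[OF copy zV zn])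
      then show ?thesis using nk by argo
    qed
    then obtain c where c: "\<And>i. i < 6 \<Longrightarrow> (z, h i) \<in> E \<longleftrightarrow> c"
      using that[of True] that[of False] by auto
    obtain ka kb where k: "ka < 7" "a \<in> kin7 ka" "kb < 7" "b \<in> kin7 kb" using ab by blast
    then show "(z, b) \<in> E"
      using outer_kin7[OF zV zh c k(2,1)] outer_kin7[OF zV zh c k(4,3)] za by simp
  qed
  moreover have "h 0 \<in> (\<Union>k<7. kin7 k)" "h 1 \<in> (\<Union>k<7. kin7 k)" using h_kin[of 0] h_kin[of 1] by force+
  moreover have "h 0 \<noteq> h 1" using h_inj[of 0 1] by simp
  ultimately have V: "(\<Union>k<7. kin7 k) = V" using p unfolding prime_tour_def by blast
  have single: "a = b" if k: "k < 7" and ab: "a \<in> kin7 k" "b \<in> kin7 k" for a b k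
  proof (rule ccontr)
    assume "a \<noteq> b"
    have "homogeneous V E (kin7 k)"
      unfolding homogeneous_def
    proof (intro conjI ballI impI)
      show "kin7 k \<subseteq> V" by (rule kin7_V)
      fix z a b assume z: "z \<in> V - kin7 k" and ab: "a \<in> kin7 k" "b \<in> kin7 k" and za: "(z, a) \<in> E"
      obtain k' where "k' < 7" "z \<in> kin7 k'" using z V by blast
      moreover have "k' \<noteq> k" using z calculation by blast
      ultimately show "(z, b) \<in> E" using kin7_kin7_arc[of z k' a k] kin7_kin7_arc[of z k' b k] ab za k by blast
    qed
    then have "kin7 k = V" using p ab \<open>a \<noteq> b\<close> unfolding prime_tour_def by blast
    moreover obtain k' where "k' < 6" "k' \<noteq> k" using that[of 0] that[of 1] by (cases "k = 0") auto
    ultimately show False using kin7_disjoint[of "h k'" k k'] h_kin h_V k by auto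
  qed
  have "finite X" using X fin finite_subset by blast
  then obtain u where u: "u \<in> X" "\<forall>y\<in>X - {u}. (u, y) \<in> E" using cycle_free_source X by blast
  define c where "c v = (SOME k. k < 7 \<and> v \<in> kin7 k)" for v
  have c: "c v < 7 \<and> v \<in> kin7 (c v)" if "v \<in> V" for v
    unfolding c_def using V that by (intro someI_ex[of "\<lambda>k. k < 7 \<and> v \<in> kin7 k"]) blast
  have "inj_on c V" using c single by (intro inj_onI) metis
  then have "card (X - {u}) = card (c ` (X - {u}))"
    using X by (metis Diff_subset card_image inj_on_subset)
  also have "\<dots> \<le> card {j. j < 7 \<and> p7_arc (c u) j}"
  proof (rule card_mono)
    show "c ` (X - {u}) \<subseteq> {j. j < 7 \<and> p7_arc (c u) j}"
    proof
      fix j assume "j \<in> c ` (X - {u})"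
      then obtain y where y: "y \<in> X" "y \<noteq> u" "j = c y" by blast
      then have yV: "y \<in> V" "u \<in> V" using X u by auto
      then have "c y \<noteq> c u" using \<open>inj_on c V\<close> y by (auto dest: inj_onD)
      then show "j \<in> {j. j < 7 \<and> p7_arc (c u) j}"
        using kin7_kin7_arc[of u "c u" y "c y"] c[OF yV(1)] c[OF yV(2)] u(2) y by auto
    qed
  qed simp
  also have "\<dots> \<le> 3" using p7_out_degree c u X by blast
  finally show ?thesis using u(1) \<open>finite X\<close> by (simp add: card_Diff_singleton_if split: if_splits)
qed

end

section \<open>Maximal transitive sets of a line\<close>

lemma line_cycle:
  assumes "line_arc i j" "line_arc j k" "line_arc k i"
  shows "(even i \<and> even j \<and> odd k \<and> i < k \<and> k < j) \<or> (even j \<and> even k \<and> odd i \<and> j < i \<and> i < k) \<or>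
    (even k \<and> even i \<and> odd j \<and> k < j \<and> j < i)"
proof -
  have a: "(if a < b then even a \<and> even b else b < a \<and> \<not> (even a \<and> even b))" if "line_arc a b" for a b
    using that by (simp add: line_arc_def)
  show ?thesis
    using a[OF assms(1)] a[OF assms(2)] a[OF assms(3)] by (simp split: if_splits)
qed

context maximal_line
begin

text \<open>A 3-cycle of a line has an odd index strictly between two even ones. Hence
  \<open>X\<close> consists of the even indices from its least one \<open>l\<close> to its greatest
  one \<open>r\<close> and of the odd indices outside this interval. An odd index inside lies on a
  cycle with \<open>l\<close> and \<open>r\<close>; an even index outside is exposed by
  \<open>l\<close> or \<open>r\<close> together with the outer odd neighbour on its side.\<close>

lemma line_maximal_cycle_free:
  assumes V: "V = x ` {..<L}" and X: "X \<subseteq> V" "cycle_free E X" "\<And>z. z \<in> V - X \<Longrightarrow> \<not> cycle_free E (insert z X)"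
  shows "\<exists>Y\<subseteq>X. Y \<noteq> {} \<and> card Y \<le> 4 \<and> (\<forall>z\<in>V. (\<forall>a\<in>Y. \<forall>b\<in>Y. \<not> cycle3 E z a b) \<longrightarrow> z \<in> X)"
proof -
  have cyc: "\<not> cycle_free E Z" if "x i \<in> Z" "x j \<in> Z" "x k \<in> Z" "i < L" "j < L" "k < L"
      "line_arc i j" "line_arc j k" "line_arc k i" for i j k Z
  proof -
    have "i \<noteq> j" "j \<noteq> k" "k \<noteq> i" using that by (auto simp: line_arc_def)
    then show ?thesis using that x_arc unfolding cycle_free_def by blast
  qed
  have cfI: "cycle_free E (x ` I)" if I: "I \<subseteq> {..<L}"
    and no: "\<And>i j k. i \<in> I \<Longrightarrow> j \<in> I \<Longrightarrow> k \<in> I \<Longrightarrow> \<not> (line_arc i j \<and> line_arc j k \<and> line_arc k i)" for I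
  proof -
    have "(x i, x j) \<in> E \<longleftrightarrow> line_arc i j" if "i \<in> I" "j \<in> I" for i j
      using that I x_arc[of i j] irr[OF x_V[of i]] by (cases "i = j") (auto simp: line_arc_def)
    then show ?thesis using no unfolding cycle_free_def by (metis (no_types, lifting) imageE)
  qed
  define I where "I = {i. i < L \<and> x i \<in> X}"
  have XI: "X = x ` I" using X(1) V by (auto simp: I_def)
  have maxI: "i \<in> I" if "i < L" "cycle_free E (x ` (insert i I))" for i
  proof -
    have "x ` insert i I = insert (x i) X" unfolding image_insert XI[symmetric] ..
    then have "cycle_free E (insert (x i) X)" using that(2) by (simp only:)
    then have "x i \<in> X" using X(3)[of "x i"] x_V[OF that(1)] by blast
    then show ?thesis using that(1) by (simp add: I_def)
  qed
  have fI: "finite I" by (simp add: I_def)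
  \<comment> \<open>Otherwise 0 could be added, since a cycle needs two even indices.\<close>
  have "\<exists>i\<in>I. even i"
  proof (rule ccontr)
    assume no: "\<not> (\<exists>i\<in>I. even i)"
    have n0: "\<not> (line_arc i j \<and> line_arc j k \<and> line_arc k i)" if "i \<in> insert 0 I" "j \<in> insert 0 I" "k \<in> insert 0 I" for i j k
      using line_cycle[of i j k] that no by (metis insertE less_irrefl less_nat_zero_code)
    have "insert 0 I \<subseteq> {..<L}" using L by (auto simp: I_def)
    then have "cycle_free E (x ` insert 0 I)" using n0 by (rule cfI)
    moreover have "0 < L" using L by linarith
    ultimately have "0 \<in> I" using maxI by blast
    then show False using no by auto
  qed
  define l where "l = Min {i \<in> I. even i}"
  define r where "r = Max {i \<in> I. even i}"
  have "l \<in> {i \<in> I. even i}" "r \<in> {i \<in> I. even i}"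
  proof -
    have "finite {i \<in> I. even i}" "{i \<in> I. even i} \<noteq> {}" using fI \<open>\<exists>i\<in>I. even i\<close> by auto
    then show "l \<in> {i \<in> I. even i}" "r \<in> {i \<in> I. even i}"
      unfolding l_def r_def by (rule Min_in, rule Max_in)
  qed
  then have lr: "l \<in> I" "even l" "r \<in> I" "even r" "l < L" "r < L" by (auto simp: I_def)
  have lr_le: "l \<le> i" "i \<le> r" if "i \<in> I" "even i" for i
    unfolding l_def r_def using that fI by auto
  define S where "S = {i. i < L \<and> (if even i then l \<le> i \<and> i \<le> r else i < l \<or> r < i)}"
  have IS: "I \<subseteq> S"
  proof
    fix i assume i: "i \<in> I"
    then have iL: "i < L" by (simp add: I_def)
    show "i \<in> S"
    proof (cases "even i")
      case True then show ?thesis using lr_le[OF i] iL by (simp add: S_def)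
    next
      case False
      have "\<not> (l < i \<and> i < r)"
      proof
        assume "l < i \<and> i < r"
        then have "line_arc l r" "line_arc r i" "line_arc i l" using lr False by (auto simp: line_arc_def)
        then show False using cyc[of l X r i] lr i X(2) unfolding I_def by blast
      qed
      moreover have "i \<noteq> l" "i \<noteq> r" using False lr by blast+
      ultimately have "i < l \<or> r < i" by linarith
      then show ?thesis using False iL by (simp add: S_def)
    qed
  qed
  have cS: "cycle_free E (x ` S)"
  proof (rule cfI)
    show "S \<subseteq> {..<L}" by (auto simp: S_def)
    have S: "even i \<Longrightarrow> l \<le> i \<and> i \<le> r" "odd i \<Longrightarrow> i < l \<or> r < i" if "i \<in> S" for i
      using that by (simp_all add: S_def)
    have "\<not> (even i \<and> even j \<and> odd k \<and> i < k \<and> k < j)" if "i \<in> S" "j \<in> S" "k \<in> S" for i j k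
      using S[OF that(1)] S[OF that(2)] S[OF that(3)] by linarith
    then show "\<not> (line_arc i j \<and> line_arc j k \<and> line_arc k i)" if "i \<in> S" "j \<in> S" "k \<in> S" for i j k
      using line_cycle[of i j k] that by blast
  qed
  have "S \<subseteq> I"
  proof
    fix i assume i: "i \<in> S"
    then have "x ` insert i I \<subseteq> x ` S" using IS by blast
    then have "cycle_free E (x ` insert i I)" by (rule cycle_free_subset[OF cS])
    moreover have "i < L" using i by (simp add: S_def)
    ultimately show "i \<in> I" using maxI by blast
  qed
  then have SI: "I = S" using IS by blast
  \<comment> \<open>At an end of the line no even index remains to be excluded on that side, so the
    extreme index is simply repeated.\<close>
  define l' where "l' = (if l = 0 then l else l - 1)"
  define r' where "r' = (if r = L - 1 then r else r + 1)"
  have r'L: "r' < L" using lr by (auto simp: r'_def)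
  have "l' \<in> S" "r' \<in> S" using lr lr_le[OF lr(1,2)] r'L by (simp_all add: S_def l'_def r'_def) auto
  moreover have "l \<in> S" "r \<in> S" using lr SI by blast+
  ultimately have Y: "{x l, x r, x l', x r'} \<subseteq> X" unfolding XI SI by blast
  have "z \<in> X" if z: "z \<in> V" and no: "\<forall>a\<in>{x l, x r, x l', x r'}. \<forall>b\<in>{x l, x r, x l', x r'}. \<not> cycle3 E z a b" for z
  proof (rule ccontr)
    assume "z \<notin> X"
    obtain i where i: "z = x i" "i < L" using z V by blast
    then have "i \<notin> S" using \<open>z \<notin> X\<close> unfolding XI SI by blast
    have no': "\<not> (line_arc i j \<and> line_arc j k \<and> line_arc k i)" if "j \<in> {l, r, l', r'}" "k \<in> {l, r, l', r'}" for j k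
    proof
      assume a: "line_arc i j \<and> line_arc j k \<and> line_arc k i"
      then have "i \<noteq> j" "j \<noteq> k" "k \<noteq> i" by (auto simp: line_arc_def)
      moreover have "j < L" "k < L" using that lr r'L by (auto simp: l'_def)
      ultimately have "(z, x j) \<in> E" "(x j, x k) \<in> E" "(x k, z) \<in> E" using a x_arc i by auto
      then show False using no that by blast
    qed
    have "i \<noteq> l" "i \<noteq> r" if "odd i" using that lr by blast+
    then have "odd i \<Longrightarrow> l < i \<and> i < r" "even i \<Longrightarrow> i < l \<or> r < i"
      using \<open>i \<notin> S\<close> i by (auto simp: S_def)
    then consider "even i" "i < l" | "even i" "r < i" | "odd i" "l < i" "i < r" by blast
    then show False
    proof cases
      case 1
      then have "odd l'" "l' < l" "i \<le> l'" using lr by (auto simp: l'_def)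
      moreover have "i \<noteq> l'" using 1 \<open>odd l'\<close> by blast
      ultimately have "line_arc i l" "line_arc l l'" "line_arc l' i" using 1 lr by (auto simp: line_arc_def)
      then show False using no'[of l l'] by blast
    next
      case 2
      then have "odd r'" "r < r'" "r' \<le> i" using lr i(2) L by (auto simp: r'_def)
      moreover have "i \<noteq> r'" using 2 \<open>odd r'\<close> by blast
      ultimately have "line_arc r i" "line_arc i r'" "line_arc r' r" using 2 lr by (auto simp: line_arc_def)
      then show False using no'[of r' r] by blast
    next
      case 3
      then have "line_arc l r" "line_arc r i" "line_arc i l" using lr by (auto simp: line_arc_def)
      then show False using no'[of l r] by blast
    qed
  qed
  moreover have "card {x l, x r, x l', x r'} \<le> 4"
    using card_length[of "[x l, x r, x l', x r']"] by simp
  ultimately show ?thesis using Y by (intro exI[of _ "{x l, x r, x l', x r'}"]) blast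
qed

end

section \<open>Small witnesses for maximal transitive sets\<close>

context w5_free_tour
begin

lemma cycle_free_insertI:
  assumes "z \<in> V" "X \<subseteq> V" "cycle_free E X"
    and no: "\<And>a b. a \<in> X \<Longrightarrow> b \<in> X \<Longrightarrow> \<not> cycle3 E z a b"
  shows "cycle_free E (insert z X)"
  unfolding cycle_free_def
proof (intro ballI notI)
  fix p q r assume m: "p \<in> insert z X" "q \<in> insert z X" "r \<in> insert z X"
    and c: "cycle3 E p q r"
  have zz: "(z, z) \<notin> E" using irr assms(1) by blast
  consider "p \<in> X" "q \<in> X" "r \<in> X" | "p = z" | "q = z" | "r = z" using m by blast
  then show False
  proof cases
    case 1 then show ?thesis using assms(3) c unfolding cycle_free_def by blast
  next
    case 2
    then have "q \<in> X" "r \<in> X" using m c zz by auto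
    then show ?thesis using no[of q r] c 2 by blast
  next
    case 3
    then have "p \<in> X" "r \<in> X" using m c zz by auto
    then show ?thesis using no[of r p] c 3 by blast
  next
    case 4
    then have "p \<in> X" "q \<in> X" using m c zz by auto
    then show ?thesis using no[of p q] c 4 by blast
  qed
qed

lemma copy_of_card: "copy_of R n y \<Longrightarrow> n \<le> card V"
proof -
  assume y: "copy_of R n y"
  then have "inj_on y {..<n}" "y ` {..<n} \<subseteq> V" unfolding copy_of_def inj_on_def by auto
  then show ?thesis using card_inj_on_le[OF _ _ fin, of y "{..<n}"] by simp
qed

text \<open>A set of at most four vertices is its own witness, which also settles the tournaments
  containing six vertices of P7. Without a five-vertex line all in- and out-neighbourhoods are
  transitive, and source and sink suffice. In the remaining case a longest line exhausts
  \<open>V\<close>.\<close>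

lemma prime_witness:
  assumes p: "prime_tour V E" and X: "X \<subseteq> V" "cycle_free E X" "X \<noteq> {}"
    and max: "\<And>z. z \<in> V - X \<Longrightarrow> \<not> cycle_free E (insert z X)"
  shows "\<exists>Y\<subseteq>X. Y \<noteq> {} \<and> card Y \<le> 4 \<and>
    (\<forall>z\<in>V. (\<forall>a\<in>Y. \<forall>b\<in>Y. \<not> cycle3 E z a b) \<longrightarrow> z \<in> X)"
proof (cases "card X \<le> 4")
  case True
  have "z \<in> X" if "z \<in> V" "\<forall>a\<in>X. \<forall>b\<in>X. \<not> cycle3 E z a b" for z
    using cycle_free_insertI[OF that(1) X(1,2)] that max[of z] by blast
  then show ?thesis using True X(3) by (intro exI[of _ X]) blast
next
  case big: False
  have finX: "finite X" using X(1) fin finite_subset by blast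
  show ?thesis
  proof (cases "\<exists>y. copy_of line_arc 5 y")
    case False
    have out: "cycle_free E {y \<in> V. (u, y) \<in> E}" if "u \<in> V" for u
      using prime_out_cycle_line[OF p that] False unfolding cycle_free_def by blast
    have in': "cycle_free E {y \<in> V. (y, u) \<in> E}" if "u \<in> V" for u
      using prime_in_cycle_line[OF p that] False unfolding cycle_free_def by blast
    obtain u where u: "u \<in> X" "\<forall>y\<in>X - {u}. (u, y) \<in> E" using cycle_free_source[OF finX X(3,1,2)] by blast
    interpret c: w5_free_tour V "E\<inverse>" by (rule converse_w5_free)
    have "cycle_free (E\<inverse>) X" using X(2) unfolding cycle_free_def converse_iff by blast
    then obtain v where v: "v \<in> X" "\<forall>y\<in>X - {v}. (y, v) \<in> E"
      using c.cycle_free_source[OF finX X(3,1)] unfolding converse_iff by blast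
    have uV: "u \<in> V" "v \<in> V" using u v X by auto
    have "u \<noteq> v"
    proof
      assume "u = v"
      have "y = u" if "y \<in> X" for y
      proof (rule ccontr)
        assume "y \<noteq> u"
        then have "(u, y) \<in> E" "(y, u) \<in> E" using u v \<open>u = v\<close> that by auto
        then show False using arc_asym[of u y] uV that X(1) by blast
      qed
      then have "X = {u}" using u(1) by blast
      then show False using big by simp
    qed
    then have uv: "(u, v) \<in> E" using u v by blast
    \<comment> \<open>The closed out-neighbourhood of the source is transitive and contains
      \<open>X\<close>, hence equals \<open>X\<close> by maximality.\<close>
    let ?N = "insert u {y \<in> V. (u, y) \<in> E}"
    have "cycle_free E ?N"
    proof (rule cycle_free_insertI[OF uV(1) _ out[OF uV(1)]])
      show "\<not> cycle3 E u a b" if "a \<in> {y \<in> V. (u, y) \<in> E}" "b \<in> {y \<in> V. (u, y) \<in> E}" for a b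
        using that arc_asym[of u b] uV by blast
    qed blast
    have XN: "X \<subseteq> ?N" using u X(1) by blast
    have NX: "y \<in> X" if "y \<in> ?N" for y
    proof (rule ccontr)
      assume "y \<notin> X"
      moreover have "insert y X \<subseteq> ?N" "y \<in> V" using XN that uV(1) by auto
      ultimately show False using cycle_free_subset[OF \<open>cycle_free E ?N\<close>, of "insert y X"] max[of y] by blast
    qed
    have "z \<in> X" if z: "z \<in> V" and no: "\<forall>a\<in>{u, v}. \<forall>b\<in>{u, v}. \<not> cycle3 E z a b" for z
    proof (rule ccontr)
      assume zX: "z \<notin> X"
      then have zn: "z \<noteq> u" "z \<noteq> v" using u v by auto
      have zu: "(z, u) \<in> E" using NX[of z] zX z tot[of z u] uV zn by auto
      have "(v, z) \<notin> E" using no zu uv by blast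
      then have zv: "(z, v) \<in> E" using tot[of z v] zn uV z by blast
      \<comment> \<open>If \<open>z\<close> beat all of \<open>X\<close>, it could be added as a new
        source. So some \<open>y\<close> beats \<open>z\<close>, and then \<open>u\<close>,
        \<open>y\<close>, \<open>z\<close> form a 3-cycle inside the in-neighbourhood of
        \<open>v\<close>.\<close>
      have "\<not> (\<forall>y\<in>X. (z, y) \<in> E)"
      proof
        assume a: "\<forall>y\<in>X. (z, y) \<in> E"
        have "cycle_free E (insert z X)"
        proof (rule cycle_free_insertI[OF z X(1,2)])
          show "\<not> cycle3 E z a b" if "a \<in> X" "b \<in> X" for a b
            using a that arc_asym[of z b] z X(1) by blast
        qed
        then show False using max z zX by blast
      qed
      then obtain y where y: "y \<in> X" "(z, y) \<notin> E" by blast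
      then have yz: "(y, z) \<in> E" using tot[of z y] z zX X(1) by blast
      have "y \<noteq> u" "y \<noteq> v" using y zu zv by auto
      then have "(u, y) \<in> E" "(y, v) \<in> E" using u v y by auto
      moreover have "u \<in> {y \<in> V. (y, v) \<in> E}" "y \<in> {y \<in> V. (y, v) \<in> E}" "z \<in> {y \<in> V. (y, v) \<in> E}"
        using calculation uv zv z uV y X(1) by auto
      ultimately show False using in'[OF uV(2)] yz zu unfolding cycle_free_def by blast
    qed
    moreover have "card {u, v} \<le> 4" by (simp add: card_insert_if)
    ultimately show ?thesis using u(1) v(1) by (intro exI[of _ "{u, v}"]) blast
  next
    case True
    show ?thesis
    proof (cases "\<exists>h. copy_of p7_arc 6 h")
      case True
      then obtain h where "copy_of p7_arc 6 h" by blast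
      then interpret p7_subtour V E h by unfold_locales
      show ?thesis using cycle_free_card_le[OF p X] big by blast
    next
      case False
      define P where "P m \<longleftrightarrow> (\<exists>x. copy_of line_arc (2 * m + 1) x)" for m
      have P2: "P 2" using True by (simp add: P_def)
      have bound: "\<forall>m. P m \<longrightarrow> m \<le> card V" using copy_of_card unfolding P_def by fastforce
      define m where "m = (GREATEST m. P m)"
      have m: "P m" "2 \<le> m" unfolding m_def using GreatestI_nat[of P, OF P2] Greatest_le_nat[of P, OF P2] bound by blast+
      have m1: "\<not> P (m + 1)" using Greatest_le_nat[of P "m + 1" "card V"] bound unfolding m_def by auto
      obtain x where x: "copy_of line_arc (2 * m + 1) x" using m(1) by (auto simp: P_def)
      interpret maximal_line V E m x "2 * m + 1"
        using False m(2) x m1 by unfold_locales (simp_all add: P_def)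
      show ?thesis
        using line_maximal_cycle_free[OF prime_eq_line[OF p] X(1,2) max] by blast
    qed
  qed
qed

end

section \<open>Weights and contraction of homogeneous sets\<close>

definition opt :: "'a rel \<Rightarrow> ('a \<Rightarrow> nat) \<Rightarrow> 'a set \<Rightarrow> nat" where
  "opt E W A = Max (sum W ` {X. X \<subseteq> A \<and> cycle_free E X})"

lemma cycle_free_empty: "cycle_free E {}"
  by (simp add: cycle_free_def)

lemma opt_ge: "finite A \<Longrightarrow> X \<subseteq> A \<Longrightarrow> cycle_free E X \<Longrightarrow> sum W X \<le> opt E W A"
  unfolding opt_def by (rule Max_ge) auto

lemma opt_attained:
  assumes "finite A"
  obtains X where "X \<subseteq> A" "cycle_free E X" "sum W X = opt E W A"
proof -
  have "{X. X \<subseteq> A \<and> cycle_free E X} \<noteq> {}" using cycle_free_empty by blast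
  then have "opt E W A \<in> sum W ` {X. X \<subseteq> A \<and> cycle_free E X}"
    unfolding opt_def using assms by (intro Max_in) auto
  then show ?thesis using that by auto
qed

lemma opt_le_sum: "finite A \<Longrightarrow> opt E W A \<le> sum W A"
proof -
  assume A: "finite A"
  obtain X where "X \<subseteq> A" "cycle_free E X" "sum W X = opt E W A" by (rule opt_attained[OF A])
  then show ?thesis using sum_mono2[OF A, of X W] by simp
qed

lemma opt_cong: "(\<And>v. v \<in> A \<Longrightarrow> W v = W' v) \<Longrightarrow> opt E W A = opt E W' A"
  unfolding opt_def by (intro arg_cong[where f = Max] image_cong) (auto intro!: sum.cong)

text \<open>The candidate described by a witness \<open>Y\<close>. For an arbitrary \<open>Y\<close>
  it may fail to be transitive, so the program has to check it.\<close>

definition ext :: "'a rel \<Rightarrow> 'a set \<Rightarrow> 'a set \<Rightarrow> 'a set" where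
  "ext E M Y = {z \<in> M. \<forall>a\<in>Y. \<forall>b\<in>Y. \<not> cycle3 E z a b}"

text \<open>Repetitions among the four are allowed, so quadruples also cover the smaller
  witnesses.\<close>

lemma small_set_enum:
  assumes "finite Y" "Y \<noteq> {}" "card Y \<le> 4"
  shows "\<exists>a b c d. Y = {a, b, c, d}"
proof -
  obtain xs where xs: "set xs = Y" "length xs = card Y" using assms(1) by (metis distinct_card finite_distinct_list)
  then have "xs \<noteq> []" "length xs \<le> 4" using assms by auto
  then have "length xs = 1 \<or> length xs = 2 \<or> length xs = 3 \<or> length xs = 4"
    using length_greater_0_conv[of xs] by arith
  then show ?thesis
    using xs(1) by (auto simp: length_Suc_conv numeral_eq_Suc) (metis insert_absorb2)+
qed

context w5_free_tour
begin

lemma sub_w5_free: "B \<subseteq> V \<Longrightarrow> w5_free_tour B E"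
proof
  fix v w1 w2 w3 w4 assume "B \<subseteq> V" "v \<in> B" "w1 \<in> B" "w2 \<in> B" "w3 \<in> B" "w4 \<in> B"
  then show "\<not> forms_W5 E v w1 w2 w3 w4"
    by (intro no_W5) auto
next
  show "B \<subseteq> V \<Longrightarrow> finite B" using fin finite_subset by blast
next
  fix x assume "B \<subseteq> V" "x \<in> B" then show "(x, x) \<notin> E" using irr by blast
next
  fix x y assume "B \<subseteq> V" "x \<in> B" "y \<in> B" "x \<noteq> y" then show "(x, y) \<in> E \<longleftrightarrow> (y, x) \<notin> E" using tot by blast
qed

lemma homogeneous_sub:
  assumes M: "homogeneous V E M" and K: "homogeneous M E K"
  shows "homogeneous V E K"
  unfolding homogeneous_def
proof (intro conjI ballI impI)
  show "K \<subseteq> V" using M K unfolding homogeneous_def by blast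
  fix z x y assume a: "z \<in> V - K" "x \<in> K" "y \<in> K" "(z, x) \<in> E"
  show "(z, y) \<in> E"
  proof (cases "z \<in> M")
    case True then show ?thesis using K a unfolding homogeneous_def by blast
  next
    case False
    have "x \<in> M" "y \<in> M" using K a unfolding homogeneous_def by blast+
    then show ?thesis using M a False unfolding homogeneous_def by blast
  qed
qed

text \<open>A homogeneous subset of \<open>M\<close> is homogeneous in \<open>V\<close> as well; if
  it has two elements, it is one of the sets \<open>K\<close> of the hypothesis and swallows
  \<open>M\<close>.\<close>

lemma minimal_homogeneous_prime:
  assumes "homogeneous V E M"
    and "\<And>x y K. x \<in> M \<Longrightarrow> y \<in> M \<Longrightarrow> x \<noteq> y \<Longrightarrow> homogeneous V E K \<Longrightarrow> x \<in> K \<Longrightarrow> y \<in> K \<Longrightarrow> M \<subseteq> K"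
  shows "prime_tour M E"
  unfolding prime_tour_def
proof (intro allI impI)
  fix K assume K: "homogeneous M E K" and "\<exists>a\<in>K. \<exists>b\<in>K. a \<noteq> b"
  then obtain a b where ab: "a \<in> K" "b \<in> K" "a \<noteq> b" by blast
  have KM: "K \<subseteq> M" using K by (simp add: homogeneous_def)
  then show "K = M" using assms(2)[of a b K] ab homogeneous_sub[OF assms(1) K] by blast
qed

text \<open>Justifies closing a pair under splitting vertices: the closure never leaves a
  homogeneous set that contains the pair.\<close>

lemma splitter_in_homogeneous:
  assumes K: "homogeneous V E K" and "z \<in> V" "a \<in> K" "b \<in> K" "(z, a) \<in> E" "(b, z) \<in> E"
  shows "z \<in> K"
proof (rule ccontr)
  assume "z \<notin> K"
  then have "(z, b) \<in> E" using assms unfolding homogeneous_def by blast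
  then show False using arc_asym[of z b] assms unfolding homogeneous_def by blast
qed

lemma no_splitter_homogeneous:
  assumes "C \<subseteq> V" "\<And>z a b. z \<in> V - C \<Longrightarrow> a \<in> C \<Longrightarrow> b \<in> C \<Longrightarrow> (z, a) \<in> E \<Longrightarrow> (b, z) \<notin> E"
  shows "homogeneous V E C"
  unfolding homogeneous_def
proof (intro conjI ballI impI)
  show "C \<subseteq> V" by (rule assms(1))
  fix z a b assume a: "z \<in> V - C" "a \<in> C" "b \<in> C" "(z, a) \<in> E"
  then have "(b, z) \<notin> E" "z \<noteq> b" "b \<in> V" using assms by blast+
  then show "(z, b) \<in> E" using tot[of z b] a by blast
qed

text \<open>Outer vertices see \<open>M\<close> uniformly, so no 3-cycle has exactly two vertices in
  \<open>M\<close>, and in a cycle with one vertex in \<open>M\<close> that vertex may be replaced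
  by any other vertex of \<open>M\<close>. Hence \<open>m\<close> can be traded for an optimal
  subset of \<open>M\<close>, and conversely any nonempty part inside \<open>M\<close> for
  \<open>m\<close>, without creating cycles or losing weight.\<close>

lemma opt_contract:
  assumes M: "homogeneous V E M" and m: "m \<in> M"
  shows "opt E (W(m := opt E W M)) (insert m (V - M)) = opt E W V"
proof -
  let ?W = "W(m := opt E W M)" let ?A = "insert m (V - M)"
  have MV: "M \<subseteq> V" using M by (simp add: homogeneous_def)
  have finM: "finite M" using MV fin finite_subset by blast
  have finA: "finite ?A" using fin by simp
  have out: "(z, a) \<in> E \<longleftrightarrow> (z, b) \<in> E" if "z \<in> V - M" "a \<in> M" "b \<in> M" for z a b
    using M that unfolding homogeneous_def by blast
  have inn: "(a, z) \<in> E \<longleftrightarrow> (b, z) \<in> E" if "z \<in> V - M" "a \<in> M" "b \<in> M" for z a b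
    using out[OF that] tot[of z a] tot[of z b] that MV by blast
  have le1: "sum ?W X \<le> opt E W V" if X: "X \<subseteq> ?A" "cycle_free E X" for X
  proof (cases "m \<in> X")
    case False
    then have "sum ?W X = sum W X" by (intro sum.cong) auto
    moreover have "X \<subseteq> V" using X(1) m MV by blast
    ultimately show ?thesis using opt_ge[OF fin _ X(2)] by simp
  next
    case True
    obtain Y where Y: "Y \<subseteq> M" "cycle_free E Y" "sum W Y = opt E W M" by (rule opt_attained[OF finM])
    let ?X = "(X - {m}) \<union> Y"
    have XV: "X - {m} \<subseteq> V - M" using X(1) by blast
    have "cycle_free E ?X"
      unfolding cycle_free_def
    proof (intro ballI notI)
      fix p q r assume pqr: "p \<in> ?X" "q \<in> ?X" "r \<in> ?X" and c: "cycle3 E p q r"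
      have two: False if "p \<in> Y" "q \<in> Y" "r \<in> X - {m}" "(p, q) \<in> E" "(q, r) \<in> E" "(r, p) \<in> E" for p q r
        using out[of r p q] arc_asym[of q r] that XV Y(1) MV by blast
      have one: False if "p \<in> Y" "q \<in> X - {m}" "r \<in> X - {m}" "(p, q) \<in> E" "(q, r) \<in> E" "(r, p) \<in> E" for p q r
      proof -
        have "(m, q) \<in> E" "(r, m) \<in> E" using inn[of q p m] out[of r p m] that XV Y(1) m by blast+
        then show False using X(2) that True unfolding cycle_free_def by blast
      qed
      have zero: False if "p \<in> X - {m}" "q \<in> X - {m}" "r \<in> X - {m}" using X(2) that c unfolding cycle_free_def by blast
      have three: False if "p \<in> Y" "q \<in> Y" "r \<in> Y" using Y(2) that c unfolding cycle_free_def by blast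
      show False using pqr c two[of p q r] two[of q r p] two[of r p q] one[of p q r] one[of q r p] one[of r p q] zero three
        by blast
    qed
    moreover have "?X \<subseteq> V" using XV Y(1) MV by blast
    ultimately have "sum W ?X \<le> opt E W V" using opt_ge[OF fin] by blast
    moreover have "sum W ?X = sum W (X - {m}) + sum W Y"
      using XV Y(1) finite_subset[OF XV] finite_subset[OF Y(1)] fin finM by (intro sum.union_disjoint) auto
    moreover have "sum ?W X = ?W m + sum ?W (X - {m})"
      using True finite_subset[OF X(1) finA] by (intro sum.remove) auto
    moreover have "sum ?W (X - {m}) = sum W (X - {m})" by (intro sum.cong) auto
    ultimately show ?thesis using Y(3) by simp
  qed
  have le2: "sum W X \<le> opt E ?W ?A" if X: "X \<subseteq> V" "cycle_free E X" for X
  proof (cases "X \<inter> M = {}")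
    case True
    then have "sum ?W X = sum W X" using m by (intro sum.cong) auto
    moreover have "X \<subseteq> ?A" using X(1) True by blast
    ultimately show ?thesis using opt_ge[OF finA _ X(2), of ?W] by simp
  next
    case False
    then obtain x where x: "x \<in> X" "x \<in> M" by blast
    let ?X = "insert m (X - M)"
    have "cycle_free E ?X"
    proof (rule cycle_free_insertI)
      show "m \<in> V" "X - M \<subseteq> V" using m MV X by auto
      show "cycle_free E (X - M)" using cycle_free_subset[OF X(2)] by blast
      show "\<not> cycle3 E m a b" if "a \<in> X - M" "b \<in> X - M" for a b
      proof
        assume c: "cycle3 E m a b"
        then have "(x, a) \<in> E" "(b, x) \<in> E" using inn[of a m x] out[of b m x] that X(1) x m by blast+
        then show False using X(2) c x that unfolding cycle_free_def by blast
      qed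
    qed
    then have "sum ?W ?X \<le> opt E ?W ?A" using opt_ge[OF finA, of ?X] X(1) by blast
    moreover have "sum ?W ?X = opt E W M + sum ?W (X - M)"
      using m finite_subset[OF X(1) fin] by (subst sum.insert) auto
    moreover have "sum ?W (X - M) = sum W (X - M)" using m by (intro sum.cong) auto
    moreover have "sum W X = sum W (X \<inter> M) + sum W (X - M)"
      using finite_subset[OF X(1) fin] by (rule sum.Int_Diff)
    moreover have "sum W (X \<inter> M) \<le> opt E W M"
      using cycle_free_subset[OF X(2)] by (intro opt_ge[OF finM]) auto
    ultimately show ?thesis by linarith
  qed
  obtain X where X: "X \<subseteq> ?A" "cycle_free E X" "sum ?W X = opt E ?W ?A" by (rule opt_attained[OF finA])
  obtain X' where X': "X' \<subseteq> V" "cycle_free E X'" "sum W X' = opt E W V" by (rule opt_attained[OF fin])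
  show ?thesis using le1[OF X(1,2)] le2[OF X'(1,2)] X(3) X'(3) by simp
qed

text \<open>Weights are natural numbers, so an optimal set can be enlarged to an inclusion-maximal
  transitive one at no loss; its witness then describes it exactly.\<close>

lemma prime_opt:
  assumes p: "prime_tour V E" and ne: "V \<noteq> {}"
  shows "\<exists>a\<in>V. \<exists>b\<in>V. \<exists>c\<in>V. \<exists>d\<in>V. cycle_free E (ext E V {a, b, c, d}) \<and> sum W (ext E V {a, b, c, d}) = opt E W V"
proof -
  obtain X0 where X0: "X0 \<subseteq> V" "cycle_free E X0" "sum W X0 = opt E W V" by (rule opt_attained[OF fin])
  define F where "F = {X. X0 \<subseteq> X \<and> X \<subseteq> V \<and> cycle_free E X}"
  have "finite F" using fin by (simp add: F_def)
  moreover have "X0 \<in> F" using X0 by (simp add: F_def)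
  ultimately obtain X where XF: "X \<in> F" "\<And>Z. Z \<in> F \<Longrightarrow> X \<subseteq> Z \<Longrightarrow> X = Z"
    using finite_has_maximal2[of F X0] by metis
  have X: "X0 \<subseteq> X" and XV: "X \<subseteq> V" "cycle_free E X" using XF(1) by (auto simp: F_def)
  have max: "\<not> cycle_free E (insert z X)" if "z \<in> V - X" for z
  proof
    assume "cycle_free E (insert z X)"
    then have "insert z X \<in> F" using X XV that by (auto simp: F_def)
    then show False using XF(2)[of "insert z X"] that by blast
  qed
  have "X \<noteq> {}"
  proof
    assume "X = {}"
    obtain v where v: "v \<in> V" using ne by blast
    have "cycle_free E {v}" using irr[OF v] by (simp add: cycle_free_def)
    then show False using max[of v] v \<open>X = {}\<close> by simp
  qed
  then obtain Y where Y: "Y \<subseteq> X" "Y \<noteq> {}" "card Y \<le> 4"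
      "\<forall>z\<in>V. (\<forall>a\<in>Y. \<forall>b\<in>Y. \<not> cycle3 E z a b) \<longrightarrow> z \<in> X"
    using prime_witness[OF p XV _ max] by metis
  have "ext E V Y = X"
  proof
    show "ext E V Y \<subseteq> X" using Y(4) by (auto simp: ext_def)
    show "X \<subseteq> ext E V Y"
    proof
      fix z assume z: "z \<in> X"
      have "\<not> cycle3 E z a b" if "a \<in> Y" "b \<in> Y" for a b
        using XV(2) z that Y(1) unfolding cycle_free_def by blast
      then show "z \<in> ext E V Y" using z XV(1) by (auto simp: ext_def)
    qed
  qed
  moreover have "sum W X = opt E W V"
  proof (rule antisym)
    show "sum W X \<le> opt E W V" by (rule opt_ge[OF fin XV])
    have "sum W X0 \<le> sum W X" using X finite_subset[OF XV(1) fin] by (intro sum_mono2) auto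
    then show "opt E W V \<le> sum W X" using X0(3) by simp
  qed
  moreover have "finite Y" using finite_subset[OF _ fin, of Y] Y(1) XV(1) by blast
  then obtain a b c d where abcd: "Y = {a, b, c, d}" using small_set_enum[OF _ Y(2,3)] by blast
  moreover have "a \<in> V" "b \<in> V" "c \<in> V" "d \<in> V" using abcd Y(1) XV(1) by auto
  ultimately show ?thesis using XV(2) by metis
qed

end

section \<open>Weakest preconditions with running time\<close>

text \<open>Counts in units of \<open>N + 1\<close> binary digits. Sums are treated like products,
  because for bounds of at least 2 the product dominates the sum.\<close>

fun val_bits :: "aexp \<Rightarrow> nat" where
  "val_bits (Const k) = k + 1"
| "val_bits (Rd a e) = 1"
| "val_bits (Add e1 e2) = val_bits e1 + val_bits e2"
| "val_bits (Sub e1 e2) = val_bits e1 + val_bits e2"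
| "val_bits (Mult e1 e2) = val_bits e1 + val_bits e2"
| "val_bits (Div e1 e2) = val_bits e1 + val_bits e2"

fun exp_cost :: "aexp \<Rightarrow> nat" where
  "exp_cost (Const k) = k + 1"
| "exp_cost (Rd a e) = exp_cost e + 1"
| "exp_cost (Add e1 e2) = exp_cost e1 + exp_cost e2 + val_bits (Add e1 e2)"
| "exp_cost (Sub e1 e2) = exp_cost e1 + exp_cost e2 + val_bits (Sub e1 e2)"
| "exp_cost (Mult e1 e2) = exp_cost e1 + exp_cost e2 + val_bits (Mult e1 e2)"
| "exp_cost (Div e1 e2) = exp_cost e1 + exp_cost e2 + val_bits (Div e1 e2)"

text \<open>Bounds for runs in which all cells stay below \<open>2\<^sup>N\<close> and no loop makes more than \<open>N\<close> iterations.\<close>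

fun time_bound :: "com \<Rightarrow> nat \<Rightarrow> nat" where
  "time_bound Skip N = 1"
| "time_bound (Assign a i e) N = (exp_cost i + exp_cost e) * (N + 1) + 1"
| "time_bound (Seq c1 c2) N = time_bound c1 N + time_bound c2 N"
| "time_bound (Cond b c1 c2) N = exp_cost b * (N + 1) + 1 + time_bound c1 N + time_bound c2 N"
| "time_bound (While b c) N = (N + 1) * (exp_cost b * (N + 1) + 1 + time_bound c N)"

fun mods :: "com \<Rightarrow> nat set" where
  "mods Skip = {}"
| "mods (Assign a i e) = {a}"
| "mods (Seq c1 c2) = mods c1 \<union> mods c2"
| "mods (Cond b c1 c2) = mods c1 \<union> mods c2"
| "mods (While b c) = mods c"

lemma time_bound_poly: "\<exists>p :: nat poly. \<forall>N. time_bound c N = poly p N"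
proof (induction c)
  case Skip
  show ?case by (intro exI[of _ 1]) simp
next
  case (Assign a i e)
  show ?case by (intro exI[of _ "[:exp_cost i + exp_cost e:] * [:1, 1:] + 1"]) (simp add: algebra_simps)
next
  case (Seq c1 c2)
  then obtain p q where "\<forall>N. time_bound c1 N = poly p N" "\<forall>N. time_bound c2 N = poly q N" by blast
  then show ?case by (intro exI[of _ "p + q"]) simp
next
  case (Cond b c1 c2)
  then obtain p q where "\<forall>N. time_bound c1 N = poly p N" "\<forall>N. time_bound c2 N = poly q N" by blast
  then show ?case
    by (intro exI[of _ "[:exp_cost b:] * [:1, 1:] + 1 + p + q"]) (simp add: algebra_simps)
next
  case (While b c)
  then obtain p where "\<forall>N. time_bound c N = poly p N" by blast
  then show ?case
    by (intro exI[of _ "[:1, 1:] * ([:exp_cost b:] * [:1, 1:] + 1 + p)"]) (simp add: algebra_simps)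
qed

definition bounded_state :: "nat \<Rightarrow> state \<Rightarrow> bool" where
  "bounded_state N s \<longleftrightarrow> (\<forall>a i. s a i < 2 ^ N)"

lemma bit_length_le:
  assumes "k < 2 ^ b" "0 < b"
  shows "bit_length k \<le> b"
proof (cases "k = 0")
  case True
  then show ?thesis using assms by (simp add: bit_length_def)
next
  case False
  then have "2 ^ floor_log k \<le> k" by (simp add: floor_log_exp2_le)
  then have "(2::nat) ^ floor_log k < 2 ^ b" using assms by linarith
  then show ?thesis by (simp add: bit_length_def Suc_le_eq)
qed

lemma val_bits_pos: "0 < val_bits e"
  by (induction e) auto

lemma aval_bound:
  assumes "bounded_state N s"
  shows "aval e s < 2 ^ (val_bits e * (N + 1))"
proof (induction e)
  case (Const k)
  have "k < 2 ^ k" by (rule less_exp)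
  also have "(2::nat) ^ k \<le> 2 ^ ((k + 1) * (N + 1))" by (intro power_increasing) (simp_all add: algebra_simps)
  finally show ?case by simp
next
  case (Rd a e)
  have "aval (Rd a e) s < 2 ^ N" using assms by (simp add: bounded_state_def)
  also have "\<dots> \<le> 2 ^ (val_bits (Rd a e) * (N + 1))" by (intro power_increasing) auto
  finally show ?case .
next
  case (Add e1 e2)
  let ?a = "val_bits e1 * (N + 1)" let ?b = "val_bits e2 * (N + 1)"
  have pos: "0 < ?a" "0 < ?b" using val_bits_pos by auto
  have two: "2 \<le> (2::nat) ^ ?a" "2 \<le> (2::nat) ^ ?b" using pos self_le_power[of 2 ?a] self_le_power[of 2 ?b] by simp_all
  have sum_le: "x + y \<le> x * y" if "2 \<le> x" "2 \<le> y" for x y :: nat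
    using mult_le_mono1[OF that(1), of "y - 1"] that by (simp add: algebra_simps diff_mult_distrib2)
  have "aval e1 s + aval e2 s < 2 ^ ?a + 2 ^ ?b" using Add.IH by linarith
  also have "\<dots> \<le> 2 ^ ?a * 2 ^ ?b" by (rule sum_le[OF two])
  finally show ?case by (simp add: algebra_simps power_add)
next
  case (Sub e1 e2)
  have "aval e1 s - aval e2 s < 2 ^ (val_bits e1 * (N + 1))" using Sub.IH(1) by linarith
  also have "\<dots> \<le> 2 ^ (val_bits (Sub e1 e2) * (N + 1))" by (intro power_increasing mult_le_mono1) auto
  finally show ?case by simp
next
  case (Mult e1 e2)
  have "aval e1 s * aval e2 s < 2 ^ (val_bits e1 * (N + 1)) * 2 ^ (val_bits e2 * (N + 1))"
    using Mult.IH by (intro mult_strict_mono) auto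
  then show ?case by (simp add: algebra_simps power_add)
next
  case (Div e1 e2)
  have "aval e1 s div aval e2 s < 2 ^ (val_bits e1 * (N + 1))"
    using Div.IH(1) div_le_dividend le_less_trans by blast
  also have "\<dots> \<le> 2 ^ (val_bits (Div e1 e2) * (N + 1))" by (intro power_increasing mult_le_mono1) auto
  finally show ?case by simp
qed

lemma acost_bound:
  assumes "bounded_state N s"
  shows "acost e s \<le> exp_cost e * (N + 1)"
proof -
  have bl: "bit_length (aval e s) \<le> val_bits e * (N + 1)" for e
    using aval_bound[OF assms] val_bits_pos by (intro bit_length_le) auto
  show ?thesis
  proof (induction e)
    case (Const k) then show ?case using bl[of "Const k"] by simp
  next
    case (Rd a e) then show ?case using bl[of "Rd a e"] by (simp add: algebra_simps)
  next
    case (Add e1 e2) then show ?case using bl[of "Add e1 e2"] by (simp add: algebra_simps)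
  next
    case (Sub e1 e2) then show ?case using bl[of "Sub e1 e2"] by (simp add: algebra_simps)
  next
    case (Mult e1 e2) then show ?case using bl[of "Mult e1 e2"] by (simp add: algebra_simps)
  next
    case (Div e1 e2) then show ?case using bl[of "Div e1 e2"] by (simp add: algebra_simps)
  qed
qed

text \<open>Boundedness of the start state is a premise inside the definition, so the size of a
  value has to be checked only where it is written.\<close>

definition wp :: "nat \<Rightarrow> com \<Rightarrow> (state \<Rightarrow> bool) \<Rightarrow> state \<Rightarrow> bool" where
  "wp N c Q s \<longleftrightarrow> (bounded_state N s \<longrightarrow>
     (\<exists>t s'. exec c s t s' \<and> t \<le> time_bound c N \<and> bounded_state N s' \<and> Q s'))"

lemma exec_frame: "exec c s t s' \<Longrightarrow> a \<notin> mods c \<Longrightarrow> s' a = s a"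
  by (induction rule: exec.induct) auto

lemma wp_frame:
  assumes "wp N c Q s" "\<And>s'. Q s' \<Longrightarrow> (\<And>a. a \<notin> mods c \<Longrightarrow> s' a = s a) \<Longrightarrow> R s'"
  shows "wp N c R s"
  unfolding wp_def
proof
  assume "bounded_state N s"
  then obtain t s' where e: "exec c s t s'" "t \<le> time_bound c N" "bounded_state N s'" "Q s'"
    using assms(1) unfolding wp_def by blast
  then have "R s'" using assms(2) exec_frame[OF e(1)] by blast
  then show "\<exists>t s'. exec c s t s' \<and> t \<le> time_bound c N \<and> bounded_state N s' \<and> R s'" using e by blast
qed

lemma wp_bounded: "(bounded_state N s \<Longrightarrow> wp N c Q s) \<Longrightarrow> wp N c Q s"
  by (simp add: wp_def)

lemma wp_Skip: "Q s \<Longrightarrow> wp N Skip Q s"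
  unfolding wp_def using exec.Skip by fastforce

lemma wp_Assign:
  assumes "aval e s < 2 ^ N" "Q (s(a := (s a)(aval i s := aval e s)))"
  shows "wp N (Assign a i e) Q s"
  unfolding wp_def
proof
  assume b: "bounded_state N s"
  have "acost i s + acost e s + 1 \<le> time_bound (Assign a i e) N"
    using acost_bound[OF b, of i] acost_bound[OF b, of e] by (simp add: algebra_simps)
  moreover have "bounded_state N (s(a := (s a)(aval i s := aval e s)))"
    using b assms(1) by (simp add: bounded_state_def)
  ultimately show "\<exists>t s'. exec (Assign a i e) s t s' \<and> t \<le> time_bound (Assign a i e) N \<and> bounded_state N s' \<and> Q s'"
    using assms(2) exec.Assign by blast
qed

lemma wp_Assign_eq:
  assumes "aval i s = k" "aval e s = v" "v < 2 ^ N" "Q (s(a := (s a)(k := v)))"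
  shows "wp N (Assign a i e) Q s"
  using assms by (auto intro: wp_Assign)

lemma wp_Seq:
  assumes "wp N c1 (wp N c2 Q) s"
  shows "wp N (Seq c1 c2) Q s"
  unfolding wp_def
proof
  assume "bounded_state N s"
  then obtain t1 s1 where 1: "exec c1 s t1 s1" "t1 \<le> time_bound c1 N" "bounded_state N s1" "wp N c2 Q s1"
    using assms unfolding wp_def[of N c1] by blast
  then obtain t2 s2 where 2: "exec c2 s1 t2 s2" "t2 \<le> time_bound c2 N" "bounded_state N s2" "Q s2"
    unfolding wp_def by blast
  show "\<exists>t s'. exec (Seq c1 c2) s t s' \<and> t \<le> time_bound (Seq c1 c2) N \<and> bounded_state N s' \<and> Q s'"
    using exec.Seq[OF 1(1) 2(1)] 1 2 by (intro exI[of _ "t1 + t2"] exI[of _ s2]) simp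
qed

lemma wp_Cond:
  assumes "aval b s \<noteq> 0 \<Longrightarrow> wp N c1 Q s" "aval b s = 0 \<Longrightarrow> wp N c2 Q s"
  shows "wp N (Cond b c1 c2) Q s"
  unfolding wp_def
proof
  assume bs: "bounded_state N s"
  show "\<exists>t s'. exec (Cond b c1 c2) s t s' \<and> t \<le> time_bound (Cond b c1 c2) N \<and> bounded_state N s' \<and> Q s'"
  proof (cases "aval b s = 0")
    case True
    then obtain t s' where "exec c2 s t s'" "t \<le> time_bound c2 N" "bounded_state N s'" "Q s'"
      using assms(2) bs unfolding wp_def by blast
    moreover have "exec (Cond b c1 c2) s (acost b s + 1 + t) s'" using True calculation by (intro CondFalse)
    ultimately show ?thesis using acost_bound[OF bs, of b]
      by (intro exI[of _ "acost b s + 1 + t"] exI[of _ s']) simp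
  next
    case False
    then obtain t s' where "exec c1 s t s'" "t \<le> time_bound c1 N" "bounded_state N s'" "Q s'"
      using assms(1) bs unfolding wp_def by blast
    moreover have "exec (Cond b c1 c2) s (acost b s + 1 + t) s'" using False calculation by (intro CondTrue)
    ultimately show ?thesis using acost_bound[OF bs, of b]
      by (intro exI[of _ "acost b s + 1 + t"] exI[of _ s']) simp
  qed
qed

text \<open>The variant starts at \<open>N\<close> or below, so the body runs at most
  \<open>N\<close> times; the final failing test accounts for the factor \<open>N + 1\<close> in
  \<open>time_bound\<close>.\<close>

lemma wp_While:
  assumes I: "I s" and V: "V s \<le> N"
    and step: "\<And>s. I s \<Longrightarrow> aval b s \<noteq> 0 \<Longrightarrow> wp N c (\<lambda>s'. I s' \<and> V s' < V s) s"
    and fin: "\<And>s. I s \<Longrightarrow> aval b s = 0 \<Longrightarrow> Q s"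
  shows "wp N (While b c) Q s"
  unfolding wp_def
proof
  let ?u = "exp_cost b * (N + 1) + 1 + time_bound c N"
  assume "bounded_state N s"
  with I have "\<exists>t s'. exec (While b c) s t s' \<and> t \<le> (V s + 1) * ?u \<and> bounded_state N s' \<and> Q s'"
  proof (induction "V s" arbitrary: s rule: less_induct)
    case less
    note cost = acost_bound[OF less.prems(2), of b]
    show ?case
    proof (cases "aval b s = 0")
      case True
      have "acost b s + 1 \<le> (V s + 1) * ?u" using cost by simp
      then show ?thesis using WhileFalse[OF True] less.prems fin[OF _ True] by blast
    next
      case False
      then obtain t1 s1 where 1: "exec c s t1 s1" "t1 \<le> time_bound c N" "bounded_state N s1" "I s1" "V s1 < V s"
        using step[OF less.prems(1)] less.prems(2) unfolding wp_def by blast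
      obtain t2 s2 where 2: "exec (While b c) s1 t2 s2" "t2 \<le> (V s1 + 1) * ?u" "bounded_state N s2" "Q s2"
        using less.hyps[OF 1(5,4,3)] by blast
      have "(V s1 + 1) * ?u \<le> V s * ?u" using 1(5) by (intro mult_le_mono1) simp
      then have "acost b s + 1 + t1 + t2 \<le> (V s + 1) * ?u" using cost 1(2) 2(2) by simp
      then show ?thesis using WhileTrue[OF False 1(1) 2(1)] 2(3,4) by blast
    qed
  qed
  then obtain t s' where "exec (While b c) s t s'" "t \<le> (V s + 1) * ?u" "bounded_state N s'" "Q s'" by blast
  moreover have "(V s + 1) * ?u \<le> (N + 1) * ?u" using V by (intro mult_le_mono1) simp
  ultimately show "\<exists>t s'. exec (While b c) s t s' \<and> t \<le> time_bound (While b c) N \<and> bounded_state N s' \<and> Q s'"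
    by (intro exI[of _ t] exI[of _ s']) simp
qed

abbreviation Reg :: "nat \<Rightarrow> aexp" where
  "Reg a \<equiv> Rd a (Const 0)"

definition For :: "nat \<Rightarrow> aexp \<Rightarrow> com \<Rightarrow> com" where
  "For i e c = Seq (Assign i (Const 0) (Const 0))
     (While (Sub e (Reg i)) (Seq c (Assign i (Const 0) (Add (Reg i) (Const 1)))))"

lemma mods_For: "mods (For i e c) = insert i (mods c)"
  by (auto simp: For_def)

text \<open>The limit \<open>e\<close> is evaluated again in every round; it keeps the value
  \<open>m\<close> because it depends only on the input bank 0, which the body does not write.
  \<open>J k\<close> speaks about the state whose counter already holds \<open>k\<close>.\<close>

lemma wp_For:
  assumes lim: "\<And>s. s 0 = s0 0 \<Longrightarrow> aval e s = m" and m: "m \<le> N"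
    and i: "i \<notin> mods c" "0 \<notin> mods c" "i \<noteq> 0"
    and init: "J 0 (s0(i := (s0 i)(0 := 0)))"
    and step: "\<And>k s. k < m \<Longrightarrow> J k s \<Longrightarrow> s i 0 = k \<Longrightarrow> (\<And>a. a \<notin> insert i (mods c) \<Longrightarrow> s a = s0 a) \<Longrightarrow>
       wp N c (\<lambda>s'. J (Suc k) (s'(i := (s' i)(0 := Suc k)))) s"
    and fin: "\<And>s. J m s \<Longrightarrow> (\<And>a. a \<notin> insert i (mods c) \<Longrightarrow> s a = s0 a) \<Longrightarrow> Q s"
  shows "wp N (For i e c) Q s0"
  unfolding For_def
proof (intro wp_Seq wp_Assign)
  let ?s = "s0(i := (s0 i)(aval (Const 0) s0 := aval (Const 0) s0))"
  let ?b = "Seq c (Assign i (Const 0) (Add (Reg i) (Const 1)))"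
  let ?I = "\<lambda>s. s i 0 \<le> m \<and> J (s i 0) s \<and> (\<forall>a. a \<notin> insert i (mods c) \<longrightarrow> s a = s0 a)"
  show "aval (Const 0) s0 < 2 ^ N" by simp
  show "wp N (While (Sub e (Reg i)) ?b) Q ?s"
  proof (rule wp_While[where I = ?I and V = "\<lambda>s. m - s i 0"])
    show "?I ?s" using init by simp
    show "m - ?s i 0 \<le> N" using m by simp
  next
    fix s assume I: "?I s" and b: "aval (Sub e (Reg i)) s \<noteq> 0"
    have s0: "s 0 = s0 0" using I i by auto
    then have k: "s i 0 < m" using b lim by simp
    have "wp N c (\<lambda>s'. J (Suc (s i 0)) (s'(i := (s' i)(0 := Suc (s i 0))))) s"
      using step[of "s i 0" s] k I by simp
    then show "wp N ?b (\<lambda>s'. ?I s' \<and> m - s' i 0 < m - s i 0) s"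
    proof (intro wp_Seq, elim wp_frame)
      fix s' assume J: "J (Suc (s i 0)) (s'(i := (s' i)(0 := Suc (s i 0))))"
        and fr: "\<And>a. a \<notin> mods c \<Longrightarrow> s' a = s a"
      have [simp]: "s' i = s i" using fr i by blast
      have "Suc (s i 0) < 2 ^ N" using k m less_exp[of N] by linarith
      then show "wp N (Assign i (Const 0) (Add (Reg i) (Const 1))) (\<lambda>s'. ?I s' \<and> m - s' i 0 < m - s i 0) s'"
        using J fr I k by (intro wp_Assign) auto
    qed
  next
    fix s assume I: "?I s" and b: "aval (Sub e (Reg i)) s = 0"
    have s0: "s 0 = s0 0" using I i by auto
    then have "s i 0 = m" using b lim I by auto
    then show "Q s" using fin[of s] I by auto
  qed
qed

section \<open>The program\<close>

text \<open>
  Banks: 2 common denominator, 3 weights, 4 remaining vertices, 5 current homogeneous set, 6 closure of a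
  pair, 7 candidate set, 8--12 loop counters, 13 best weight, 14 representative of the homogeneous set,
  15 flag, 16 sum, 17--19 Euclidean algorithm, 20--28 vertices.  Sets are stored as nonzero entries, and
  tuples of vertices are decoded from the base-\<open>n\<close> digits of a single loop counter.
\<close>

abbreviation nE :: aexp where "nE \<equiv> Rd 0 (Const 1)"
text \<open>Cell 0 of the input bank holds the length of the input and cell 1 holds
  \<open>n\<close>, so the adjacency matrix starts at cell 2.\<close>

abbreviation arcE :: "aexp \<Rightarrow> aexp \<Rightarrow> aexp" where
  "arcE x y \<equiv> Rd 0 (Add (Const 2) (Add (Mult x nE) y))"
abbreviation modE :: "aexp \<Rightarrow> aexp \<Rightarrow> aexp" where
  "modE a b \<equiv> Sub a (Mult (Div a b) b)"
text \<open>Truth values are numbers: at least one of the two truncated differences vanishes,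
  products act as conjunction, and subtraction from 1 acts as negation.\<close>

abbreviation neqE :: "aexp \<Rightarrow> aexp \<Rightarrow> aexp" where
  "neqE a b \<equiv> Add (Sub a b) (Sub b a)"
abbreviation eqE :: "aexp \<Rightarrow> aexp \<Rightarrow> aexp" where
  "eqE a b \<equiv> Sub (Const 1) (neqE a b)"

section \<open>Closure of a pair and minimal homogeneous sets\<close>

definition fill :: "nat \<Rightarrow> aexp \<Rightarrow> com" where
  "fill a e = For 10 nE (Assign a (Reg 10) e)"

definition decode3 :: com where
  "decode3 = Seq (Assign 26 (Const 0) (Div (Div (Reg 11) nE) nE))
     (Seq (Assign 27 (Const 0) (modE (Div (Reg 11) nE) nE)) (Assign 28 (Const 0) (modE (Reg 11) nE)))"

abbreviation splitsE :: aexp where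
  "splitsE \<equiv> Mult (Mult (Rd 4 (Reg 26)) (Sub (Const 1) (Rd 6 (Reg 26))))
                (Mult (Mult (Rd 6 (Reg 27)) (Rd 6 (Reg 28))) (Mult (arcE (Reg 26) (Reg 27)) (arcE (Reg 28) (Reg 26))))"

text \<open>Every added vertex restarts the scan over triples, so at the end a full scan has found
  no splitter of the final set.\<close>

abbreviation closure_body :: com where
  "closure_body \<equiv> Seq decode3 (Cond splitsE
     (Seq (Assign 6 (Reg 26) (Const 1)) (Assign 11 (Const 0) (Const 0)))
     (Assign 11 (Const 0) (Add (Reg 11) (Const 1))))"

definition closure_loop :: com where
  "closure_loop = Seq (Assign 11 (Const 0) (Const 0))
     (While (Sub (Mult nE (Mult nE nE)) (Reg 11)) closure_body)"

definition closure :: com where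
  "closure = Seq (fill 6 (Add (eqE (Reg 10) (Reg 20)) (eqE (Reg 10) (Reg 21)))) closure_loop"

definition shrink :: com where
  "shrink = Seq (fill 5 (Rd 4 (Reg 10))) (For 9 (Mult nE nE)
     (Seq (Assign 20 (Const 0) (Div (Reg 9) nE)) (Seq (Assign 21 (Const 0) (modE (Reg 9) nE))
       (Cond (Mult (Mult (Rd 5 (Reg 20)) (Rd 5 (Reg 21))) (neqE (Reg 20) (Reg 21)))
         (Seq closure (fill 5 (Rd 6 (Reg 10)))) Skip))))"

lemmas mods_simps = mods_For fill_def decode3_def closure_loop_def closure_def shrink_def

text \<open>\<open>b0\<close> is the content of the input bank, which the program never writes. The
  fourth power covers the longest loops: the \<open>n^4\<close> quadruples, and the closure scan
  over \<open>n^3\<close> triples with at most one restart per vertex.\<close>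

locale wmisp_ram =
  fixes n N :: nat and E :: "nat rel" and b0 :: "nat \<Rightarrow> nat"
  assumes b0_n: "b0 (Suc 0) = n"
    and b0_E: "\<And>i j. i < n \<Longrightarrow> j < n \<Longrightarrow> b0 (Suc (Suc (i * n + j))) = of_bool ((i, j) \<in> E)"
    and N_ge: "(n + 2) ^ 4 \<le> N"
    and tour: "w5_free_tour {..<n} E"
begin

lemma less_N: "k \<le> (n + 2) ^ 4 \<Longrightarrow> k < 2 ^ N"
  using N_ge less_exp[of N] by linarith

lemma n_powers: "n \<le> (n + 2) ^ 4" "n * n \<le> (n + 2) ^ 4" "n * (n * n) \<le> (n + 2) ^ 4" "n * (n * (n * n)) \<le> (n + 2) ^ 4"
  "n * (n * (n * n) + 1) + n * (n * n) \<le> (n + 2) ^ 4"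
proof -
  have e: "(n + 2) ^ 4 = n * (n * (n * n)) + 8 * (n * (n * n)) + 24 * (n * n) + 32 * n + 16"
    by (simp add: eval_nat_numeral algebra_simps)
  show "n \<le> (n + 2) ^ 4" "n * n \<le> (n + 2) ^ 4" "n * (n * n) \<le> (n + 2) ^ 4" "n * (n * (n * n)) \<le> (n + 2) ^ 4"
    "n * (n * (n * n) + 1) + n * (n * n) \<le> (n + 2) ^ 4"
    unfolding e by (simp_all add: algebra_simps)
qed

definition supp :: "state \<Rightarrow> nat \<Rightarrow> nat set" where
  "supp s a = {i. i < n \<and> s a i \<noteq> 0}"

lemma supp_finite [simp]: "finite (supp s a)"
  and supp_subset: "supp s a \<subseteq> {..<n}"
  by (auto simp: supp_def)

lemma wp_fill:
  assumes s0: "s0 0 = b0" and a: "a \<noteq> 10" "a \<noteq> 0"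
    and e: "\<And>s k. k < n \<Longrightarrow> s 10 0 = k \<Longrightarrow> (\<And>b. b \<noteq> a \<Longrightarrow> b \<noteq> 10 \<Longrightarrow> s b = s0 b) \<Longrightarrow> s a k = s0 a k \<Longrightarrow> aval e s = f k"
    and f: "\<And>k. k < n \<Longrightarrow> f k < 2 ^ N"
    and Q: "\<And>s. (\<And>j. s a j = (if j < n then f j else s0 a j)) \<Longrightarrow> (\<And>b. b \<noteq> a \<Longrightarrow> b \<noteq> 10 \<Longrightarrow> s b = s0 b) \<Longrightarrow> Q s"
  shows "wp N (fill a e) Q s0"
  unfolding fill_def
proof (rule wp_For[where m = n and J = "\<lambda>k s. \<forall>j. s a j = (if j < k then f j else s0 a j)"])
  show "\<And>s. s 0 = s0 0 \<Longrightarrow> aval nE s = n" using s0 b0_n by simp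
  show "n \<le> N" using n_powers(1) N_ge by linarith
next
  fix k s assume k: "k < n" and J: "\<forall>j. s a j = (if j < k then f j else s0 a j)" and i: "s 10 0 = k"
    and fr: "\<And>b. b \<notin> insert 10 (mods (Assign a (Reg 10) e)) \<Longrightarrow> s b = s0 b"
  have v: "aval e s = f k" using k i fr J by (intro e) auto
  show "wp N (Assign a (Reg 10) e) (\<lambda>s'. \<forall>j. (s'(10 := (s' 10)(0 := Suc k))) a j = (if j < Suc k then f j else s0 a j)) s"
    by (intro wp_Assign) (use v f k J i a in \<open>auto simp: less_Suc_eq\<close>)
next
  fix s assume "\<forall>j. s a j = (if j < n then f j else s0 a j)"
    and "\<And>b. b \<notin> insert 10 (mods (Assign a (Reg 10) e)) \<Longrightarrow> s b = s0 b"
  then show "Q s" by (intro Q) auto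
qed (use a in auto)

lemma decode3_wp:
  assumes s: "s 0 = b0" and t: "s 11 0 < n * (n * n)"
    and Q: "\<And>s'. (\<And>b. b \<notin> {26, 27, 28} \<Longrightarrow> s' b = s b) \<Longrightarrow> s' 26 0 = s 11 0 div n div n \<Longrightarrow>
       s' 27 0 = s 11 0 div n mod n \<Longrightarrow> s' 28 0 = s 11 0 mod n \<Longrightarrow> Q s'"
  shows "wp N decode3 Q s"
proof -
  have l: "s 11 0 div n div n < 2 ^ N" "s 11 0 div n mod n < 2 ^ N" "s 11 0 mod n < 2 ^ N"
  proof -
    have "s 11 0 div n div n \<le> s 11 0" "s 11 0 div n mod n \<le> s 11 0" "s 11 0 mod n \<le> s 11 0"
      by (meson div_le_dividend mod_less_eq_dividend le_trans)+
    moreover have "s 11 0 < 2 ^ N" using t n_powers(3) by (intro less_N) linarith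
    ultimately show "s 11 0 div n div n < 2 ^ N" "s 11 0 div n mod n < 2 ^ N" "s 11 0 mod n < 2 ^ N"
      by linarith+
  qed
  show ?thesis
    unfolding decode3_def
    by (intro wp_Seq wp_Assign) (use s b0_n l in \<open>auto simp: minus_div_mult_eq_mod intro!: Q\<close>)
qed

lemma digits3:
  assumes "t < n * (n * n)"
  shows "t div n div n < n" "t div n mod n < n" "t mod n < n" "0 < n"
proof -
  show "0 < n" using assms by (cases n) auto
  then show "t div n mod n < n" "t mod n < n" by auto
  show "t div n div n < n" using assms by (auto intro!: less_mult_imp_div_less simp: ac_simps)
qed

lemma code3:
  assumes "z < n" "a < n" "b < n"
  obtains t where "t < n * (n * n)" "t div n div n = z" "t div n mod n = a" "t mod n = b"
proof
  let ?t = "(z * n + a) * n + b"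
  have mix: "i * n + j < k * n" if "i < k" "j < n" for i j k
  proof -
    have "Suc i * n \<le> k * n" using that(1) by (intro mult_le_mono1) simp
    then show ?thesis using that(2) by simp
  qed
  show "?t < n * (n * n)" using mix[OF mix[OF assms(1,2)] assms(3)] by (simp add: ac_simps)
  show "?t div n div n = z" "?t div n mod n = a" "?t mod n = b" using assms by auto
qed

text \<open>Minimality alone; homogeneity of the set is reached only when the closure scan
  ends.\<close>

definition min_homogeneous :: "nat set \<Rightarrow> nat \<Rightarrow> nat \<Rightarrow> nat set \<Rightarrow> bool" where
  "min_homogeneous A u v M \<longleftrightarrow> (\<forall>K. homogeneous A E K \<longrightarrow> u \<in> K \<longrightarrow> v \<in> K \<longrightarrow> M \<subseteq> K)"

text \<open>Splitters belong to every homogeneous set that contains the pair, so the growing set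
  stays inside all of these; a complete scan without splitter makes it homogeneous itself.\<close>

lemma closure_loop_wp:
  assumes s0: "s0 0 = b0" and A: "A = supp s0 4" and C0: "supp s0 6 = {u, v}" and uv: "u \<in> A" "v \<in> A"
    and Q: "\<And>s. u \<in> supp s 6 \<Longrightarrow> v \<in> supp s 6 \<Longrightarrow> homogeneous A E (supp s 6) \<Longrightarrow> min_homogeneous A u v (supp s 6) \<Longrightarrow>
      (\<And>b. b \<notin> mods closure_loop \<Longrightarrow> s b = s0 b) \<Longrightarrow> Q s"
  shows "wp N closure_loop Q s0"
proof -
  interpret A: w5_free_tour A E using w5_free_tour.sub_w5_free[OF tour supp_subset] A by simp
  define split where "split C t \<longleftrightarrow> (t div n div n \<in> A - C \<and> t div n mod n \<in> C \<and> t mod n \<in> C \<and>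
     (t div n div n, t div n mod n) \<in> E \<and> (t mod n, t div n div n) \<in> E)" for C t
  let ?I = "\<lambda>s. (\<forall>b. b \<notin> mods closure_loop \<longrightarrow> s b = s0 b) \<and> u \<in> supp s 6 \<and> v \<in> supp s 6 \<and> supp s 6 \<subseteq> A \<and>
     min_homogeneous A u v (supp s 6) \<and> s 11 0 \<le> n * (n * n) \<and> (\<forall>t<s 11 0. \<not> split (supp s 6) t)"
  \<comment> \<open>A lexicographic variant: an added vertex lowers the first summand by
    \<open>n * (n * n) + 1\<close>, which outweighs the reset of the counter.\<close>
  let ?V = "\<lambda>s. (n - card (supp s 6)) * (n * (n * n) + 1) + (n * (n * n) - s 11 0)"
  have cardA: "card (supp s a) \<le> n" for s a using card_mono[OF _ supp_subset[of s a]] by simp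
  show ?thesis
    unfolding closure_loop_def
  proof (intro wp_Seq wp_Assign)
    show "aval (Const 0) s0 < 2 ^ N" by simp
    let ?s = "s0(11 := (s0 11)(aval (Const 0) s0 := aval (Const 0) s0))"
    have C: "supp ?s 6 = {u, v}" using C0 by (simp add: supp_def)
    show "wp N (While (Sub (Mult nE (Mult nE nE)) (Reg 11)) closure_body) Q ?s"
    proof (rule wp_While[where I = ?I and V = ?V])
      show "?I ?s" using C uv by (auto simp: min_homogeneous_def mods_simps)
      have "(n - card (supp ?s 6)) * (n * (n * n) + 1) \<le> n * (n * (n * n) + 1)" by (intro mult_le_mono1) simp
      then show "?V ?s \<le> N" using n_powers(5) N_ge by simp
    next
      fix s assume I: "?I s" and b: "aval (Sub (Mult nE (Mult nE nE)) (Reg 11)) s \<noteq> 0"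
      have s: "s 0 = b0" "s 4 = s0 4" using I s0 by (auto simp: mods_simps)
      have t: "s 11 0 < n * (n * n)" using b s b0_n by simp
      note dig = digits3[OF t]
      let ?t = "s 11 0" let ?C = "supp s 6"
      define P where "P = (\<lambda>s'. ?I s' \<and> ?V s' < ?V s)"
      have "wp N closure_body P s"
      proof (intro wp_Seq decode3_wp[OF s(1) t])
        fix s' assume fr: "\<And>b. b \<notin> {26, 27, 28} \<Longrightarrow> s' b = s b"
          and d: "s' 26 0 = ?t div n div n" "s' 27 0 = ?t div n mod n" "s' 28 0 = ?t mod n"
        have s': "s' 0 = b0" "s' 4 = s0 4" "s' 6 = s 6" "s' 11 = s 11" using fr s by auto
        have cond: "aval splitsE s' \<noteq> 0
            \<longleftrightarrow> split ?C ?t"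
          using s' d dig b0_n b0_E[OF dig(1,2)] b0_E[OF dig(3,1)] by (auto simp: split_def A supp_def)
        have frI: "\<forall>b. b \<notin> mods closure_loop \<longrightarrow> s' b = s0 b" using fr I by (auto simp: mods_simps)
        show "wp N (Cond splitsE
         (Seq (Assign 6 (Reg 26) (Const 1)) (Assign 11 (Const 0) (Const 0)))
         (Assign 11 (Const 0) (Add (Reg 11) (Const 1)))) P s'"
        proof (rule wp_Cond, goal_cases)
          case 1
          then have sp: "split ?C ?t" using cond by blast
          let ?z = "?t div n div n"
          let ?s2 = "(s'(6 := (s' 6)(?z := 1)))(11 := ((s'(6 := (s' 6)(?z := 1))) 11)(0 := 0))"
          have C2: "supp ?s2 6 = insert ?z ?C" using s' dig by (auto simp: supp_def)
          have z: "?z \<in> A" "?z \<notin> ?C" using sp by (auto simp: split_def)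
          have m: "min_homogeneous A u v (insert ?z ?C)"
            unfolding min_homogeneous_def
          proof (intro allI impI)
            fix K assume K: "homogeneous A E K" "u \<in> K" "v \<in> K"
            then have CK: "?C \<subseteq> K" using I unfolding min_homogeneous_def by blast
            then have "?z \<in> K" using A.splitter_in_homogeneous[OF K(1) z(1)] sp unfolding split_def by blast
            then show "insert ?z ?C \<subseteq> K" using CK by blast
          qed
          have c: "card (insert ?z ?C) = Suc (card ?C)" using z by simp
          have c2: "Suc (card ?C) \<le> n" using cardA[of ?s2 6] unfolding C2 c .
          have "(n - card (insert ?z ?C)) * (n * (n * n) + 1) + n * (n * n) < (n - card ?C) * (n * (n * n) + 1)"
          proof -
            have "n - card ?C = Suc (n - Suc (card ?C))" using c2 by simp
            then show ?thesis unfolding c by simp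
          qed
          then have "?V ?s2 < ?V s" unfolding C2 by simp
          moreover have "?I ?s2" using I C2 z m frI by (auto simp: mods_simps)
          ultimately have P2: "P ?s2" unfolding P_def by blast
          show "wp N (Seq (Assign 6 (Reg 26) (Const 1)) (Assign 11 (Const 0) (Const 0))) P s'"
            by (rule wp_Seq, rule wp_Assign_eq[where k = ?z and v = 1],
                simp add: d, simp, use less_N[of 1] in simp, rule wp_Assign_eq[where k = 0 and v = 0],
                simp, simp, simp, rule P2)
        next
          case 2
          then have sp: "\<not> split ?C ?t" using cond by blast
          let ?s2 = "s'(11 := (s' 11)(0 := Suc ?t))"
          have C2: "supp ?s2 6 = ?C" using s' by (simp add: supp_def)
          have "\<not> split ?C t'" if "t' < Suc ?t" for t' using I sp that by (cases "t' = ?t") auto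
          then have "?I ?s2" using I frI t unfolding C2 by (auto simp: mods_simps)
          moreover have "?V ?s2 < ?V s" unfolding C2 using t by simp
          moreover have "Suc ?t < 2 ^ N" using t n_powers(3) by (intro less_N) linarith
          ultimately have P2: "P ?s2" and "Suc ?t < 2 ^ N" unfolding P_def by blast+
          then show "wp N (Assign 11 (Const 0) (Add (Reg 11) (Const 1))) P s'"
            by (intro wp_Assign_eq[where k = 0 and v = "Suc ?t"]) (simp_all add: s')
        qed
      qed
      then show "wp N closure_body (\<lambda>s'. ?I s' \<and> ?V s' < ?V s) s"
        unfolding P_def .
    next
      fix s assume I: "?I s" and b: "aval (Sub (Mult nE (Mult nE nE)) (Reg 11)) s = 0"
      have s: "s 0 = b0" using I s0 by (auto simp: mods_simps)
      have t: "s 11 0 = n * (n * n)" using b s b0_n I by simp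
      have "homogeneous A E (supp s 6)"
      proof (rule A.no_splitter_homogeneous)
        show "supp s 6 \<subseteq> A" using I by blast
        fix z a b assume h: "z \<in> A - supp s 6" "a \<in> supp s 6" "b \<in> supp s 6" "(z, a) \<in> E"
        then have "z < n" "a < n" "b < n" using A by (auto simp: supp_def)
        then obtain t' where "t' < n * (n * n)" "t' div n div n = z" "t' div n mod n = a" "t' mod n = b" by (rule code3)
        then show "(b, z) \<notin> E" using I t h unfolding split_def by auto
      qed
      then show "Q s" using I Q by blast
    qed
  qed
qed

lemma closure_wp:
  assumes s0: "s0 0 = b0" and A: "A = supp s0 4" and uv: "s0 20 0 = u" "s0 21 0 = v" "u \<in> A" "v \<in> A" "u \<noteq> v"
    and Q: "\<And>s. u \<in> supp s 6 \<Longrightarrow> v \<in> supp s 6 \<Longrightarrow> homogeneous A E (supp s 6) \<Longrightarrow> min_homogeneous A u v (supp s 6) \<Longrightarrow>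
      (\<And>b. b \<notin> mods closure \<Longrightarrow> s b = s0 b) \<Longrightarrow> Q s"
  shows "wp N closure Q s0"
proof -
  define f where "f k = (1 - ((k - u) + (u - k))) + (1 - ((k - v) + (v - k)))" for k :: nat
  have f0: "f k \<noteq> 0 \<longleftrightarrow> k = u \<or> k = v" for k by (auto simp: f_def)
  have f2: "f k < 2 ^ N" for k
  proof -
    have "f k \<le> 1 + 1" unfolding f_def by (intro add_mono) simp_all
    also have "\<dots> \<le> (n + 2) ^ 4" using power_increasing[of 1 4 "n + 2"] by simp
    finally show ?thesis by (rule less_N)
  qed
  show ?thesis
    unfolding closure_def
  proof (intro wp_Seq wp_fill[where f = f] s0)
    fix s :: state and k assume "s 10 0 = k" and fr: "\<And>b. b \<noteq> 6 \<Longrightarrow> b \<noteq> 10 \<Longrightarrow> s b = s0 b"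
    then show "aval (Add (eqE (Reg 10) (Reg 20)) (eqE (Reg 10) (Reg 21))) s = f k"
      using uv by (simp add: f_def)
  next
    fix s assume s6: "\<And>j. s 6 j = (if j < n then f j else s0 6 j)" and fr: "\<And>b. b \<noteq> 6 \<Longrightarrow> b \<noteq> 10 \<Longrightarrow> s b = s0 b"
    have lt: "u < n" "v < n" using uv A by (auto simp: supp_def)
    have C: "supp s 6 = {u, v}" using s6 f0 lt by (auto simp: supp_def)
    show "wp N closure_loop Q s"
    proof (rule closure_loop_wp[where A = A, OF _ _ C uv(3,4)])
      show "s 0 = b0" using fr s0 by simp
      show "A = supp s 4" using fr A by (simp add: supp_def)
    next
      fix s' assume "u \<in> supp s' 6" "v \<in> supp s' 6" "homogeneous A E (supp s' 6)" "min_homogeneous A u v (supp s' 6)"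
        and "\<And>b. b \<notin> mods closure_loop \<Longrightarrow> s' b = s b"
      then show "Q s'" using fr by (intro Q) (auto simp: mods_simps)
    qed
  qed (use f2 in auto)
qed

text \<open>
  Replacing the current set by the closure of each pair that it contains leaves a set that is the closure
  of any two of its elements.
\<close>

definition shrunk :: "nat set \<Rightarrow> nat \<Rightarrow> nat set \<Rightarrow> bool" where
  "shrunk A k M \<longleftrightarrow> homogeneous A E M \<and> (A \<noteq> {} \<longrightarrow> M \<noteq> {}) \<and>
     ((\<exists>x\<in>A. \<exists>y\<in>A. x \<noteq> y) \<longrightarrow> (\<exists>x\<in>M. \<exists>y\<in>M. x \<noteq> y)) \<and>
     (\<forall>p<k. p div n \<in> M \<longrightarrow> p mod n \<in> M \<longrightarrow> p div n \<noteq> p mod n \<longrightarrow> min_homogeneous A (p div n) (p mod n) M)"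

lemma shrunk_Suc_same:
  assumes "shrunk A k M" "\<not> (k div n \<in> M \<and> k mod n \<in> M \<and> k div n \<noteq> k mod n)"
  shows "shrunk A (Suc k) M"
  using assms unfolding shrunk_def less_Suc_eq by blast

text \<open>The closure of a pair from \<open>M\<close> stays inside the homogeneous set
  \<open>M\<close>, and minimality for the pairs treated earlier passes to subsets. Therefore a
  single pass over all pairs suffices.\<close>

lemma shrunk_Suc_closure:
  assumes M: "shrunk A k M" and k: "k div n \<in> M" "k mod n \<in> M" "k div n \<noteq> k mod n"
    and C: "k div n \<in> C" "k mod n \<in> C" "homogeneous A E C" "min_homogeneous A (k div n) (k mod n) C"
  shows "shrunk A (Suc k) C"
proof -
  have CM: "C \<subseteq> M" using M k C unfolding shrunk_def min_homogeneous_def by blast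
  have "min_homogeneous A (p div n) (p mod n) C" if "p < Suc k" "p div n \<in> C" "p mod n \<in> C" "p div n \<noteq> p mod n" for p
  proof (cases "p = k")
    case True then show ?thesis using C(4) by simp
  next
    case False
    then have "p < k" using that by simp
    then have "min_homogeneous A (p div n) (p mod n) M" using M that CM unfolding shrunk_def by blast
    then show ?thesis using CM unfolding min_homogeneous_def by blast
  qed
  then show ?thesis using C k unfolding shrunk_def by blast
qed

text \<open>Once all pairs have been treated, any two elements of the set generate it, which is the
  hypothesis of \<open>minimal_homogeneous_prime\<close>.\<close>

lemma shrink_wp:
  assumes s0: "s0 0 = b0" and A: "A = supp s0 4"
    and Q: "\<And>s. homogeneous A E (supp s 5) \<Longrightarrow> (A \<noteq> {} \<Longrightarrow> supp s 5 \<noteq> {}) \<Longrightarrow>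
      ((\<exists>x\<in>A. \<exists>y\<in>A. x \<noteq> y) \<Longrightarrow> \<exists>x\<in>supp s 5. \<exists>y\<in>supp s 5. x \<noteq> y) \<Longrightarrow> prime_tour (supp s 5) E \<Longrightarrow>
      (\<And>b. b \<notin> mods shrink \<Longrightarrow> s b = s0 b) \<Longrightarrow> Q s"
  shows "wp N shrink Q s0"
proof (rule wp_bounded)
  assume b0s: "bounded_state N s0"
  interpret A: w5_free_tour A E using w5_free_tour.sub_w5_free[OF tour supp_subset] A by simp
  define body where "body = Seq (Assign 20 (Const 0) (Div (Reg 9) nE)) (Seq (Assign 21 (Const 0) (modE (Reg 9) nE))
       (Cond (Mult (Mult (Rd 5 (Reg 20)) (Rd 5 (Reg 21))) (neqE (Reg 20) (Reg 21)))
         (Seq closure (fill 5 (Rd 6 (Reg 10)))) Skip))"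
  have mb: "mods body = {20, 21, 5} \<union> mods closure \<union> {10}" by (auto simp: body_def mods_For fill_def)
  have mc: "mods closure = {6, 10, 11, 26, 27, 28}" by (auto simp: mods_simps)
  have ms: "mods shrink = {5, 10, 9} \<union> mods body" by (auto simp: shrink_def body_def mods_For fill_def)
  show "wp N shrink Q s0"
    unfolding shrink_def body_def[symmetric]
  proof (intro wp_Seq wp_fill[where f = "s0 4"] s0)
    fix s1 :: state assume s1: "\<And>j. s1 5 j = (if j < n then s0 4 j else s0 5 j)" and fr1: "\<And>b. b \<noteq> 5 \<Longrightarrow> b \<noteq> 10 \<Longrightarrow> s1 b = s0 b"
    have M1: "supp s1 5 = A" using s1 A by (auto simp: supp_def)
    have s10: "s1 0 = b0" "s1 4 = s0 4" using fr1 s0 by auto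
    show "wp N (For 9 (Mult nE nE) body) Q s1"
    proof (rule wp_For[where m = "n * n" and J = "\<lambda>k s. shrunk A k (supp s 5)"])
      show "\<And>s. s 0 = s1 0 \<Longrightarrow> aval (Mult nE nE) s = n * n" using s10 b0_n by simp
      show "n * n \<le> N" using n_powers(2) N_ge by linarith
      show "9 \<notin> mods body" "0 \<notin> mods body" "(9::nat) \<noteq> 0" by (auto simp: mb mc)
      have "supp (s1(9 := (s1 9)(0 := 0))) 5 = A" using M1 by (simp add: supp_def)
      then show "shrunk A 0 (supp (s1(9 := (s1 9)(0 := 0))) 5)"
        by (auto simp: shrunk_def homogeneous_def)
    next
      fix k s assume k: "k < n * n" and J: "shrunk A k (supp s 5)" and s9: "s 9 0 = k"
        and fr: "\<And>a. a \<notin> insert 9 (mods body) \<Longrightarrow> s a = s1 a"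
      have s: "s 0 = b0" "s 4 = s0 4" using fr[of 0] fr[of 4] s10 by (auto simp: mb mc)
      have n0: "0 < n" using k by (cases n) auto
      have xy: "k div n < n" "k mod n < n" using n0 k by (auto simp: less_mult_imp_div_less)
      have lt: "k div n < 2 ^ N" "k mod n < 2 ^ N" using xy n_powers(1) by (intro less_N, linarith)+
      define P where "P = (\<lambda>s'. shrunk A (Suc k) (supp (s'(9 := (s' 9)(0 := Suc k))) 5))"
      have P: "P s'" if "shrunk A (Suc k) (supp s' 5)" for s' using that by (simp add: P_def supp_def)
      let ?s2 = "(s(20 := (s 20)(0 := k div n)))(21 := ((s(20 := (s 20)(0 := k div n))) 21)(0 := k mod n))"
      have M2: "supp ?s2 5 = supp s 5" by (simp add: supp_def)
      have s2: "?s2 0 = b0" "?s2 4 = s0 4" "?s2 20 0 = k div n" "?s2 21 0 = k mod n" "A = supp ?s2 4" using s A by (auto simp: supp_def)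
      have cond: "aval (Mult (Mult (Rd 5 (Reg 20)) (Rd 5 (Reg 21))) (neqE (Reg 20) (Reg 21))) ?s2 \<noteq> 0 \<longleftrightarrow>
         k div n \<in> supp s 5 \<and> k mod n \<in> supp s 5 \<and> k div n \<noteq> k mod n"
        using xy by (auto simp: supp_def)
      have "wp N (Cond (Mult (Mult (Rd 5 (Reg 20)) (Rd 5 (Reg 21))) (neqE (Reg 20) (Reg 21)))
         (Seq closure (fill 5 (Rd 6 (Reg 10)))) Skip) P ?s2"
      proof (rule wp_Cond, goal_cases)
        case 1
        then have c: "k div n \<in> supp s 5" "k mod n \<in> supp s 5" "k div n \<noteq> k mod n" using cond by blast+
        have MA: "supp s 5 \<subseteq> A" using J by (simp add: shrunk_def homogeneous_def)
        show ?case
        proof (intro wp_Seq closure_wp[OF s2(1,5,3,4)])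
          show "k div n \<in> A" "k mod n \<in> A" "k div n \<noteq> k mod n" using c MA by auto
        next
          fix s3 assume C: "k div n \<in> supp s3 6" "k mod n \<in> supp s3 6" "homogeneous A E (supp s3 6)"
              "min_homogeneous A (k div n) (k mod n) (supp s3 6)"
            and fr3: "\<And>b. b \<notin> mods closure \<Longrightarrow> s3 b = ?s2 b"
          show "wp N (fill 5 (Rd 6 (Reg 10))) P s3"
          proof (rule wp_bounded)
            assume bs3: "bounded_state N s3"
            show "wp N (fill 5 (Rd 6 (Reg 10))) P s3"
            proof (rule wp_fill[where f = "s3 6"])
              show "s3 0 = b0" using fr3[of 0] s2 by (simp add: mc)
            next
              fix s4 :: state assume s4: "\<And>j. s4 5 j = (if j < n then s3 6 j else s3 5 j)"
              have "supp s4 5 = supp s3 6" using s4 by (auto simp: supp_def)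
              then show "P s4" using P shrunk_Suc_closure[OF J c C] by simp
            qed (use bs3 in \<open>auto simp: bounded_state_def\<close>)
          qed
        qed
      next
        case 2
        then show ?case using shrunk_Suc_same[OF J] cond M2 by (intro wp_Skip P) auto
      qed
      then have "wp N body P s"
        unfolding body_def
        by (intro wp_Seq wp_Assign_eq[where a = 20 and k = 0 and v = "k div n"] wp_Assign_eq[where a = 21 and k = 0 and v = "k mod n"])
          (use lt s s9 b0_n in \<open>simp_all add: minus_div_mult_eq_mod\<close>)
      then show "wp N body (\<lambda>s'. shrunk A (Suc k) (supp (s'(9 := (s' 9)(0 := Suc k))) 5)) s"
        by (simp add: P_def)
    next
      fix s assume J: "shrunk A (n * n) (supp s 5)" and fr: "\<And>a. a \<notin> insert 9 (mods body) \<Longrightarrow> s a = s1 a"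
      have "prime_tour (supp s 5) E"
      proof (rule A.minimal_homogeneous_prime)
        show "homogeneous A E (supp s 5)" using J by (simp add: shrunk_def)
        fix x y K assume h: "x \<in> supp s 5" "y \<in> supp s 5" "x \<noteq> y" "homogeneous A E K" "x \<in> K" "y \<in> K"
        have xy: "x < n" "y < n" using h by (auto simp: supp_def)
        have "Suc x * n \<le> n * n" using xy by (intro mult_le_mono1) simp
        then have "x * n + y < n * n" "(x * n + y) div n = x" "(x * n + y) mod n = y" using xy by auto
        moreover have "min_homogeneous A (p div n) (p mod n) (supp s 5)"
          if "p < n * n" "p div n \<in> supp s 5" "p mod n \<in> supp s 5" "p div n \<noteq> p mod n" for p
          using J that by (simp add: shrunk_def)
        ultimately have "min_homogeneous A x y (supp s 5)" using h(1-3) by metis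
        then show "supp s 5 \<subseteq> K" using h(4-6) by (simp add: min_homogeneous_def)
      qed
      then show "Q s" using J fr fr1 by (intro Q) (auto simp: shrunk_def ms)
    qed
  qed (use b0s in \<open>auto simp: bounded_state_def\<close>)
qed

end

section \<open>Solving a prime tournament by trying quadruples\<close>

definition sumE :: "aexp list \<Rightarrow> aexp" where
  "sumE es = foldr Add es (Const 0)"

lemma aval_sumE: "aval (sumE es) s = (\<Sum>e\<leftarrow>es. aval e s)"
  by (induction es) (simp_all add: sumE_def)

definition cycE :: "aexp \<Rightarrow> aexp \<Rightarrow> aexp \<Rightarrow> aexp" where
  "cycE x y z = Mult (arcE x y) (Mult (arcE y z) (arcE z x))"

definition ext_cycles :: aexp where
  "ext_cycles = sumE [cycE (Reg 10) (Reg a) (Reg b). a \<leftarrow> [22, 23, 24, 25], b \<leftarrow> [22, 23, 24, 25]]"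

definition set_ext :: com where
  "set_ext = fill 7 (Mult (Rd 5 (Reg 10)) (Sub (Const 1) ext_cycles))"

definition check_body :: com where
  "check_body = Seq decode3 (Cond (Mult (Mult (Rd 7 (Reg 26)) (Mult (Rd 7 (Reg 27)) (Rd 7 (Reg 28)))) (cycE (Reg 26) (Reg 27) (Reg 28)))
     (Assign 15 (Const 0) (Const 0)) Skip)"

definition check :: com where
  "check = Seq (Assign 15 (Const 0) (Const 1)) (For 11 (Mult nE (Mult nE nE)) check_body)"

definition sum_body :: com where
  "sum_body = Cond (Rd 7 (Reg 10)) (Assign 16 (Const 0) (Add (Reg 16) (Rd 3 (Reg 10)))) Skip"

definition weigh :: com where
  "weigh = Seq (Assign 16 (Const 0) (Const 0)) (Seq (For 10 nE sum_body)
     (Cond (Sub (Reg 16) (Reg 13)) (Assign 13 (Const 0) (Reg 16)) Skip))"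

definition decode4 :: com where
  "decode4 = Seq (Assign 22 (Const 0) (modE (Reg 12) nE)) (Seq (Assign 23 (Const 0) (modE (Div (Reg 12) nE) nE))
     (Seq (Assign 24 (Const 0) (modE (Div (Div (Reg 12) nE) nE) nE)) (Assign 25 (Const 0) (Div (Div (Div (Reg 12) nE) nE) nE))))"

text \<open>The first digit of each quadruple inside the current set is recorded as the
  representative, whether or not the candidate passes the check.\<close>

definition solve_body :: com where
  "solve_body = Seq decode4 (Cond (Mult (Mult (Rd 5 (Reg 22)) (Rd 5 (Reg 23))) (Mult (Rd 5 (Reg 24)) (Rd 5 (Reg 25))))
     (Seq (Assign 14 (Const 0) (Reg 22)) (Seq set_ext (Seq check (Cond (Reg 15) weigh Skip)))) Skip)"

definition solve :: com where
  "solve = Seq (Assign 13 (Const 0) (Const 0)) (For 12 (Mult nE (Mult nE (Mult nE nE))) solve_body)"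

lemmas mods_solve = mods_For fill_def decode3_def set_ext_def check_body_def check_def sum_body_def weigh_def
  decode4_def solve_body_def solve_def

context wmisp_ram
begin

lemma arc_value: "s 0 = b0 \<Longrightarrow> aval x s < n \<Longrightarrow> aval y s < n \<Longrightarrow> aval (arcE x y) s = of_bool ((aval x s, aval y s) \<in> E)"
  using b0_n b0_E by simp

lemma cyc_value:
  assumes "s 0 = b0" "aval x s < n" "aval y s < n" "aval z s < n"
  shows "aval (cycE x y z) s = of_bool ((aval x s, aval y s) \<in> E \<and> (aval y s, aval z s) \<in> E \<and> (aval z s, aval x s) \<in> E)"
  unfolding cycE_def aval.simps(5) using assms by (subst (1 2 3) arc_value) auto

lemma ext_cycles_value:
  assumes s: "s 0 = b0" and k: "s 10 0 < n" and y: "\<And>a. a \<in> {22, 23, 24, 25} \<Longrightarrow> s a 0 < n"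
    and Y: "Y = {s 22 0, s 23 0, s 24 0, s 25 0}"
  shows "aval ext_cycles s = 0 \<longleftrightarrow> (\<forall>a\<in>Y. \<forall>b\<in>Y. \<not> ((s 10 0, a) \<in> E \<and> (a, b) \<in> E \<and> (b, s 10 0) \<in> E))"
proof -
  have c: "aval (cycE (Reg 10) (Reg a) (Reg b)) s = of_bool ((s 10 0, s a 0) \<in> E \<and> (s a 0, s b 0) \<in> E \<and> (s b 0, s 10 0) \<in> E)"
    if "a \<in> {22, 23, 24, 25}" "b \<in> {22, 23, 24, 25}" for a b
    using cyc_value[of s "Reg 10" "Reg a" "Reg b"] s k y[OF that(1)] y[OF that(2)] by simp
  have "aval ext_cycles s = 0 \<longleftrightarrow> (\<forall>a\<in>{22, 23, 24, 25}. \<forall>b\<in>{22, 23, 24, 25}. aval (cycE (Reg 10) (Reg a) (Reg b)) s = 0)"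
    unfolding ext_cycles_def aval_sumE by (simp add: sum_list_eq_0_iff)
  also have "\<dots> \<longleftrightarrow> (\<forall>a\<in>{22, 23, 24, 25}. \<forall>b\<in>{22, 23, 24, 25}. \<not> ((s 10 0, s a 0) \<in> E \<and> (s a 0, s b 0) \<in> E \<and> (s b 0, s 10 0) \<in> E))"
    by (intro ball_cong refl) (simp add: c)
  also have "\<dots> \<longleftrightarrow> (\<forall>a\<in>Y. \<forall>b\<in>Y. \<not> ((s 10 0, a) \<in> E \<and> (a, b) \<in> E \<and> (b, s 10 0) \<in> E))"
    unfolding Y by (simp only: ball_simps)
  finally show ?thesis .
qed

lemma set_ext_wp:
  assumes s0: "s0 0 = b0" and y: "\<And>a. a \<in> {22, 23, 24, 25} \<Longrightarrow> s0 a 0 < n"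
    and Y: "Y = {s0 22 0, s0 23 0, s0 24 0, s0 25 0}"
    and Q: "\<And>s. supp s 7 = ext E (supp s0 5) Y \<Longrightarrow> (\<And>b. b \<notin> {7, 10} \<Longrightarrow> s b = s0 b) \<Longrightarrow> Q s"
  shows "wp N set_ext Q s0"
proof (rule wp_bounded)
  assume bs: "bounded_state N s0"
  define f where "f k = (if k \<in> ext E (supp s0 5) Y then s0 5 k else 0)" for k
  show "wp N set_ext Q s0"
    unfolding set_ext_def
  proof (rule wp_fill[where f = f])
    show "s0 0 = b0" by (rule s0)
  next
    fix s :: state and k assume k: "k < n" "s 10 0 = k" and fr: "\<And>b. b \<noteq> 7 \<Longrightarrow> b \<noteq> 10 \<Longrightarrow> s b = s0 b"
    have "aval ext_cycles s = 0 \<longleftrightarrow> (\<forall>a\<in>Y. \<forall>b\<in>Y. \<not> cycle3 E k a b)"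
      unfolding k(2)[symmetric]
    proof (rule ext_cycles_value)
      show "s 0 = b0" using fr s0 by simp
      show "s 10 0 < n" using k by simp
      show "\<And>a. a \<in> {22, 23, 24, 25} \<Longrightarrow> s a 0 < n" using fr y by auto
      show "Y = {s 22 0, s 23 0, s 24 0, s 25 0}" using fr Y by simp
    qed
    moreover have "s 5 = s0 5" using fr by simp
    ultimately show "aval (Mult (Rd 5 (Reg 10)) (Sub (Const 1) ext_cycles)) s = f k"
      using k by (cases "s0 5 k = 0"; cases "aval ext_cycles s = 0") (auto simp: f_def ext_def supp_def)
  next
    fix s :: state assume s7: "\<And>j. s 7 j = (if j < n then f j else s0 7 j)" and fr: "\<And>b. b \<noteq> 7 \<Longrightarrow> b \<noteq> 10 \<Longrightarrow> s b = s0 b"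
    have "supp s 7 = ext E (supp s0 5) Y"
      using s7 by (auto simp: supp_def f_def ext_def split: if_splits)
    then show "Q s" using fr by (intro Q) auto
  next
    fix k show "f k < 2 ^ N" using bs by (simp add: f_def bounded_state_def)
  qed auto
qed

lemma check_wp:
  assumes s0: "s0 0 = b0"
    and Q: "\<And>s. (s 15 0 \<noteq> 0 \<longleftrightarrow> cycle_free E (supp s0 7)) \<Longrightarrow> (\<And>b. b \<notin> {11, 15, 26, 27, 28} \<Longrightarrow> s b = s0 b) \<Longrightarrow> Q s"
  shows "wp N check Q s0"
proof -
  define Z where "Z = supp s0 7"
  define cyc where "cyc t \<longleftrightarrow> t div n div n \<in> Z \<and> t div n mod n \<in> Z \<and> t mod n \<in> Z \<and> (t div n div n, t div n mod n) \<in> E \<and>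
     (t div n mod n, t mod n) \<in> E \<and> (t mod n, t div n div n) \<in> E" for t
  have mb: "mods check_body = {15, 26, 27, 28}" by (auto simp: check_body_def decode3_def)
  show ?thesis
    unfolding check_def
  proof (rule wp_Seq, rule wp_Assign_eq[where k = 0 and v = 1])
    show "(1::nat) < 2 ^ N" using less_N[of 1] by simp
    let ?s1 = "s0(15 := (s0 15)(0 := 1))"
    show "wp N (For 11 (Mult nE (Mult nE nE)) check_body) Q ?s1"
    proof (rule wp_For[where m = "n * (n * n)" and J = "\<lambda>k s. s 15 0 \<noteq> 0 \<longleftrightarrow> (\<forall>t<k. \<not> cyc t)"])
      show "\<And>s. s 0 = ?s1 0 \<Longrightarrow> aval (Mult nE (Mult nE nE)) s = n * (n * n)" using s0 b0_n by simp
      show "n * (n * n) \<le> N" using n_powers(3) N_ge by linarith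
    next
      fix k s assume k: "k < n * (n * n)" and J: "s 15 0 \<noteq> 0 \<longleftrightarrow> (\<forall>t<k. \<not> cyc t)" and s11: "s 11 0 = k"
        and fr: "\<And>a. a \<notin> insert 11 (mods check_body) \<Longrightarrow> s a = ?s1 a"
      have s: "s 0 = b0" "s 7 = s0 7" using fr[of 0] fr[of 7] s0 by (simp_all add: mb)
      note dig = digits3[OF k]
      define P where "P = (\<lambda>s'::state. (s'(11 := (s' 11)(0 := Suc k))) 15 0 \<noteq> 0 \<longleftrightarrow> (\<forall>t<Suc k. \<not> cyc t))"
      have P: "P s'" if "s' 15 0 \<noteq> 0 \<longleftrightarrow> (\<forall>t<k. \<not> cyc t) \<and> \<not> cyc k" for s'
        using that by (auto simp: P_def less_Suc_eq)
      have "wp N check_body P s"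
        unfolding check_body_def
      proof (intro wp_Seq decode3_wp)
        show "s 0 = b0" by (rule s(1))
        show "s 11 0 < n * (n * n)" using s11 k by simp
      next
        fix s' assume fr': "\<And>b. b \<notin> {26, 27, 28} \<Longrightarrow> s' b = s b"
          and d: "s' 26 0 = s 11 0 div n div n" "s' 27 0 = s 11 0 div n mod n" "s' 28 0 = s 11 0 mod n"
        have s': "s' 0 = b0" "s' 7 = s0 7" "s' 15 = s 15" using fr' s by auto
        have v: "aval (cycE (Reg 26) (Reg 27) (Reg 28)) s' = of_bool ((k div n div n, k div n mod n) \<in> E \<and>
            (k div n mod n, k mod n) \<in> E \<and> (k mod n, k div n div n) \<in> E)"
          using cyc_value[of s' "Reg 26" "Reg 27" "Reg 28"] s'(1) d s11 dig by simp
        have c: "aval (Mult (Mult (Rd 7 (Reg 26)) (Mult (Rd 7 (Reg 27)) (Rd 7 (Reg 28)))) (cycE (Reg 26) (Reg 27) (Reg 28))) s' \<noteq> 0 \<longleftrightarrow> cyc k"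
          using v d s' s11 dig by (auto simp: cyc_def Z_def supp_def)
        show "wp N (Cond (Mult (Mult (Rd 7 (Reg 26)) (Mult (Rd 7 (Reg 27)) (Rd 7 (Reg 28)))) (cycE (Reg 26) (Reg 27) (Reg 28)))
           (Assign 15 (Const 0) (Const 0)) Skip) P s'"
        proof (rule wp_Cond, goal_cases)
          case 1
          then have "cyc k" using c by blast
          then show ?case by (intro wp_Assign_eq[where k = 0 and v = 0] P) auto
        next
          case 2
          then have "\<not> cyc k" using c by blast
          then show ?case using J s' by (intro wp_Skip P) auto
        qed
      qed
      then show "wp N check_body (\<lambda>s'. (s'(11 := (s' 11)(0 := Suc k))) 15 0 \<noteq> 0 \<longleftrightarrow> (\<forall>t<Suc k. \<not> cyc t)) s"
        by (simp add: P_def)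
    next
      fix s assume J: "s 15 0 \<noteq> 0 \<longleftrightarrow> (\<forall>t<n * (n * n). \<not> cyc t)" and fr: "\<And>a. a \<notin> insert 11 (mods check_body) \<Longrightarrow> s a = ?s1 a"
      have "(\<forall>t<n * (n * n). \<not> cyc t) \<longleftrightarrow> cycle_free E Z"
      proof
        assume no: "\<forall>t<n * (n * n). \<not> cyc t"
        show "cycle_free E Z"
          unfolding cycle_free_def
        proof (intro ballI)
          fix x y z assume xyz: "x \<in> Z" "y \<in> Z" "z \<in> Z"
          then have "x < n" "y < n" "z < n" by (auto simp: Z_def supp_def)
          then obtain t where "t < n * (n * n)" "t div n div n = x" "t div n mod n = y" "t mod n = z" by (rule code3)
          then show "\<not> cycle3 E x y z" using no xyz unfolding cyc_def by blast
        qed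
      next
        assume cf: "cycle_free E Z"
        show "\<forall>t<n * (n * n). \<not> cyc t"
        proof (intro allI impI notI)
          fix t assume "cyc t"
          then show False using cf[unfolded cycle_free_def, rule_format, of "t div n div n" "t div n mod n" "t mod n"]
            unfolding cyc_def by blast
        qed
      qed
      then have "s 15 0 \<noteq> 0 \<longleftrightarrow> cycle_free E (supp s0 7)" using J by (simp add: Z_def)
      then show "Q s" by (rule Q) (use fr in \<open>auto simp: mb\<close>)
    qed (auto simp: mb)
  qed auto
qed

lemma weigh_wp:
  assumes s0: "s0 0 = b0" and lt: "sum (s0 3) (supp s0 7) < 2 ^ N"
    and Q: "\<And>s. s 13 0 = max (s0 13 0) (sum (s0 3) (supp s0 7)) \<Longrightarrow> (\<And>b. b \<notin> {10, 13, 16} \<Longrightarrow> s b = s0 b) \<Longrightarrow> Q s"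
  shows "wp N weigh Q s0"
proof -
  have mb: "mods sum_body = {16}" by (auto simp: sum_body_def)
  let ?Z = "supp s0 7"
  show ?thesis
    unfolding weigh_def
  proof (rule wp_Seq, rule wp_Assign_eq[where k = 0 and v = 0])
    let ?s1 = "s0(16 := (s0 16)(0 := 0))"
    show "wp N (Seq (For 10 nE sum_body) (Cond (Sub (Reg 16) (Reg 13)) (Assign 13 (Const 0) (Reg 16)) Skip)) Q ?s1"
    proof (rule wp_Seq, rule wp_For[where m = n and J = "\<lambda>k s. s 16 0 = sum (s0 3) {i \<in> ?Z. i < k}"])
      show "\<And>s. s 0 = ?s1 0 \<Longrightarrow> aval nE s = n" using s0 b0_n by simp
      show "n \<le> N" using n_powers(1) N_ge by linarith
    next
      fix k s assume k: "k < n" and J: "s 16 0 = sum (s0 3) {i \<in> ?Z. i < k}" and s10: "s 10 0 = k"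
        and fr: "\<And>a. a \<notin> insert 10 (mods sum_body) \<Longrightarrow> s a = ?s1 a"
      have s: "s 7 = s0 7" "s 3 = s0 3" using fr[of 7] fr[of 3] by (simp_all add: mb)
      define P where "P = (\<lambda>s'::state. (s'(10 := (s' 10)(0 := Suc k))) 16 0 = sum (s0 3) {i \<in> ?Z. i < Suc k})"
      have "wp N sum_body P s"
        unfolding sum_body_def
      proof (rule wp_Cond, goal_cases)
        case 1
        then have kZ: "k \<in> ?Z" using s s10 k by (simp add: supp_def)
        then have e: "{i \<in> ?Z. i < Suc k} = insert k {i \<in> ?Z. i < k}" by auto
        have v: "s0 3 k + s 16 0 = sum (s0 3) {i \<in> ?Z. i < Suc k}" unfolding e J by simp
        have "sum (s0 3) {i \<in> ?Z. i < Suc k} \<le> sum (s0 3) ?Z" by (intro sum_mono2) auto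
        then have "s 16 0 + s0 3 k < 2 ^ N" using v lt by simp
        then show ?case using v s s10 by (intro wp_Assign_eq[where k = 0 and v = "s 16 0 + s0 3 k"]) (simp_all add: P_def)
      next
        case 2
        then have "k \<notin> ?Z" using s s10 by (simp add: supp_def)
        then have "{i \<in> ?Z. i < Suc k} = {i \<in> ?Z. i < k}" by (auto simp: less_Suc_eq)
        then show ?case using J by (intro wp_Skip) (simp add: P_def)
      qed
      then show "wp N sum_body (\<lambda>s'. (s'(10 := (s' 10)(0 := Suc k))) 16 0 = sum (s0 3) {i \<in> ?Z. i < Suc k}) s"
        by (simp add: P_def)
    next
      fix s assume J: "s 16 0 = sum (s0 3) {i \<in> ?Z. i < n}" and fr: "\<And>a. a \<notin> insert 10 (mods sum_body) \<Longrightarrow> s a = ?s1 a"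
      have "{i \<in> ?Z. i < n} = ?Z" by (auto simp: supp_def)
      then have v: "s 16 0 = sum (s0 3) ?Z" using J by simp
      have s13: "s 13 = s0 13" using fr[of 13] by (simp add: mb)
      show "wp N (Cond (Sub (Reg 16) (Reg 13)) (Assign 13 (Const 0) (Reg 16)) Skip) Q s"
      proof (rule wp_Cond, goal_cases)
        case 1
        then have "s 13 0 < s 16 0" by simp
        then show ?case using v s13 lt fr
          by (intro wp_Assign_eq[where k = 0 and v = "s 16 0"] Q) (auto simp: mb)
      next
        case 2
        then have "s 16 0 \<le> s 13 0" by simp
        then show ?case using v s13 fr by (intro wp_Skip Q) (auto simp: mb)
      qed
    qed (auto simp: mb)
  qed auto
qed

end

section \<open>Repeated contraction\<close>

definition contract :: com where
  "contract = Seq (fill 4 (Mult (Rd 4 (Reg 10)) (Sub (Const 1) (Rd 5 (Reg 10)))))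
     (Seq (Assign 4 (Reg 14) (Const 1)) (Assign 3 (Reg 14) (Reg 13)))"

definition main_body :: com where
  "main_body = Seq shrink (Seq solve contract)"

definition main_loop :: com where
  "main_loop = For 8 nE main_body"

context wmisp_ram
begin

lemma digits4:
  assumes "q < n * (n * (n * n))"
  shows "q mod n < n" "q div n mod n < n" "q div n div n mod n < n" "q div n div n div n < n" "0 < n"
proof -
  show "0 < n" using assms by (cases n) auto
  then show "q mod n < n" "q div n mod n < n" "q div n div n mod n < n" by auto
  show "q div n div n div n < n" using assms by (auto intro!: less_mult_imp_div_less simp: ac_simps)
qed

definition digit_set :: "nat \<Rightarrow> nat set" where
  "digit_set q = {q mod n, q div n mod n, q div n div n mod n, q div n div n div n}"

lemma code4:
  assumes "a < n" "b < n" "c < n" "d < n"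
  shows "\<exists>q<n * (n * (n * n)). digit_set q = {a, b, c, d}"
proof -
  obtain t where t: "t < n * (n * n)" "t div n div n = d" "t div n mod n = c" "t mod n = b"
    using assms by (auto intro: code3)
  let ?q = "t * n + a"
  have "Suc t * n \<le> n * (n * n) * n" using t(1) by (intro mult_le_mono1) simp
  then have "?q < n * (n * (n * n))" using assms(1) by (simp add: ac_simps)
  moreover have "?q mod n = a" "?q div n = t" using assms(1) by auto
  ultimately show ?thesis using t by (intro exI[of _ ?q]) (auto simp: digit_set_def)
qed

lemma decode4_wp:
  assumes s: "s 0 = b0" and q: "s 12 0 = q" "q < n * (n * (n * n))"
    and Q: "\<And>s'. (\<And>b. b \<notin> {22, 23, 24, 25} \<Longrightarrow> s' b = s b) \<Longrightarrow> s' 22 0 = q mod n \<Longrightarrow>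
       s' 23 0 = q div n mod n \<Longrightarrow> s' 24 0 = q div n div n mod n \<Longrightarrow> s' 25 0 = q div n div n div n \<Longrightarrow> Q s'"
  shows "wp N decode4 Q s"
proof -
  have l: "d < 2 ^ N" if "d < n" for d using that n_powers(1) by (intro less_N) linarith
  note dig = digits4[OF q(2)]
  note ld = l[OF dig(1)] l[OF dig(2)] l[OF dig(3)] l[OF dig(4)]
  show ?thesis
    unfolding decode4_def
    by (intro wp_Seq wp_Assign_eq[where a = 22 and k = 0 and v = "q mod n"] wp_Assign_eq[where a = 23 and k = 0 and v = "q div n mod n"]
        wp_Assign_eq[where a = 24 and k = 0 and v = "q div n div n mod n"] wp_Assign_eq[where a = 25 and k = 0 and v = "q div n div n div n"] ld)
      (use s b0_n q in \<open>auto simp: minus_div_mult_eq_mod intro!: Q\<close>)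
qed

text \<open>Each weighed candidate is a transitive subset of \<open>M\<close>, so the recorded
  weight never exceeds the optimum; \<open>prime_opt\<close> supplies a quadruple that attains
  it.\<close>

lemma solve_wp:
  assumes s0: "s0 0 = b0" and M: "M = supp s0 5" "M \<noteq> {}" "prime_tour M E" and lt: "sum (s0 3) M < 2 ^ N"
    and Q: "\<And>s. s 13 0 = opt E (s0 3) M \<Longrightarrow> s 14 0 \<in> M \<Longrightarrow> (\<And>b. b \<notin> mods solve \<Longrightarrow> s b = s0 b) \<Longrightarrow> Q s"
  shows "wp N solve Q s0"
proof -
  interpret M: w5_free_tour M E using w5_free_tour.sub_w5_free[OF tour supp_subset] M by simp
  let ?W = "s0 3"
  let ?val = "\<lambda>q. sum ?W (ext E M (digit_set q))"
  have extM: "ext E M Y \<subseteq> M" for Y by (auto simp: ext_def)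
  define good where "good k v \<longleftrightarrow> v \<le> opt E ?W M \<and>
     (\<forall>q<k. digit_set q \<subseteq> M \<longrightarrow> cycle_free E (ext E M (digit_set q)) \<longrightarrow> ?val q \<le> v)" for k v
  define J where "J k s \<longleftrightarrow> good k (s 13 0) \<and> ((\<exists>q<k. digit_set q \<subseteq> M) \<longrightarrow> s 14 0 \<in> M)" for k and s :: state
  have mb: "mods solve_body = {7, 10, 11, 13, 14, 15, 16, 22, 23, 24, 25, 26, 27, 28}"
    by (auto simp: mods_solve)
  have ms: "mods solve = insert 12 (mods solve_body)" by (auto simp: solve_def mods_For mb)
  show ?thesis
    unfolding solve_def
  proof (rule wp_Seq, rule wp_Assign_eq[where k = 0 and v = 0])
    let ?s1 = "s0(13 := (s0 13)(0 := 0))"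
    show "wp N (For 12 (Mult nE (Mult nE (Mult nE nE))) solve_body) Q ?s1"
    proof (rule wp_For[where m = "n * (n * (n * n))" and J = J])
      show "\<And>s. s 0 = ?s1 0 \<Longrightarrow> aval (Mult nE (Mult nE (Mult nE nE))) s = n * (n * (n * n))" using s0 b0_n by simp
      show "n * (n * (n * n)) \<le> N" using n_powers(4) N_ge by linarith
      show "J 0 (?s1(12 := (?s1 12)(0 := 0)))" by (simp add: J_def good_def)
    next
      fix k s assume k: "k < n * (n * (n * n))" and Jk: "J k s" and s12: "s 12 0 = k"
        and fr: "\<And>a. a \<notin> insert 12 (mods solve_body) \<Longrightarrow> s a = ?s1 a"
      have s: "s 0 = b0" "s 3 = s0 3" "s 5 = s0 5" using fr[of 0] fr[of 3] fr[of 5] s0 by (simp_all add: mb)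
      note dig = digits4[OF k]
      define P where "P = (\<lambda>s'. J (Suc k) (s'(12 := (s' 12)(0 := Suc k))))"
      have P: "P s'" if "J (Suc k) s'" for s' using that by (simp add: P_def J_def)
      have gs: "good k (s 13 0)" using Jk by (simp add: J_def)
      have skip: "good (Suc k) v" if "good k v" "\<not> (digit_set k \<subseteq> M \<and> cycle_free E (ext E M (digit_set k)))" for v
        using that unfolding good_def less_Suc_eq by blast
      have take: "good (Suc k) (max v (?val k))" if "good k v" "cycle_free E (ext E M (digit_set k))" for v
      proof -
        have "?val k \<le> opt E ?W M" using opt_ge[OF M.fin extM that(2)] .
        moreover have "?val q \<le> max v (?val k)" if "q < Suc k" "digit_set q \<subseteq> M" "cycle_free E (ext E M (digit_set q))" for q
          using \<open>good k v\<close> that unfolding good_def less_Suc_eq by fastforce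
        ultimately show ?thesis using that(1) unfolding good_def by simp
      qed
      have "wp N solve_body P s"
        unfolding solve_body_def
      proof (intro wp_Seq decode4_wp)
        show "s 0 = b0" "s 12 0 = k" "k < n * (n * (n * n))" using s s12 k by auto
      next
        fix s' assume fr': "\<And>b. b \<notin> {22, 23, 24, 25} \<Longrightarrow> s' b = s b"
          and d: "s' 22 0 = k mod n" "s' 23 0 = k div n mod n" "s' 24 0 = k div n div n mod n" "s' 25 0 = k div n div n div n"
        have s': "s' 0 = b0" "s' 3 = s0 3" "s' 5 = s0 5" "s' 13 = s 13" "s' 14 = s 14" using fr' s by auto
        have c: "aval (Mult (Mult (Rd 5 (Reg 22)) (Rd 5 (Reg 23))) (Mult (Rd 5 (Reg 24)) (Rd 5 (Reg 25)))) s' \<noteq> 0 \<longleftrightarrow> digit_set k \<subseteq> M"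
          using d s' dig by (auto simp: digit_set_def M(1) supp_def)
        show "wp N (Cond (Mult (Mult (Rd 5 (Reg 22)) (Rd 5 (Reg 23))) (Mult (Rd 5 (Reg 24)) (Rd 5 (Reg 25))))
           (Seq (Assign 14 (Const 0) (Reg 22)) (Seq set_ext (Seq check (Cond (Reg 15) weigh Skip)))) Skip) P s'"
        proof (rule wp_Cond, goal_cases)
          case 1
          then have dM: "digit_set k \<subseteq> M" using c by blast
          then have mM: "k mod n \<in> M" by (simp add: digit_set_def)
          let ?s2 = "s'(14 := (s' 14)(0 := k mod n))"
          have "wp N (Seq set_ext (Seq check (Cond (Reg 15) weigh Skip))) P ?s2"
          proof (rule wp_Seq, rule set_ext_wp[where Y = "digit_set k"])
            show "?s2 0 = b0" using s' by simp
            show "\<And>a. a \<in> {22, 23, 24, 25} \<Longrightarrow> ?s2 a 0 < n" using d dig by auto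
            show "digit_set k = {?s2 22 0, ?s2 23 0, ?s2 24 0, ?s2 25 0}" using d by (simp add: digit_set_def)
          next
            fix s3 assume Z3: "supp s3 7 = ext E (supp ?s2 5) (digit_set k)" and fr3: "\<And>b. b \<notin> {7, 10} \<Longrightarrow> s3 b = ?s2 b"
            have M2: "supp ?s2 5 = M" using s' M by (simp add: supp_def)
            have s3: "s3 0 = b0" "s3 3 = s0 3" "s3 13 = s 13" "s3 14 0 = k mod n" using fr3 s' by auto
            show "wp N (Seq check (Cond (Reg 15) weigh Skip)) P s3"
            proof (rule wp_Seq, rule check_wp[where ?s0.0 = s3, OF s3(1)])
              fix s4 assume ok: "s4 15 0 \<noteq> 0 \<longleftrightarrow> cycle_free E (supp s3 7)" and fr4: "\<And>b. b \<notin> {11, 15, 26, 27, 28} \<Longrightarrow> s4 b = s3 b"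
              have s4: "s4 0 = b0" "s4 3 = s0 3" "s4 13 = s 13" "s4 14 0 = k mod n" "s4 7 = s3 7" using fr4 s3 by auto
              have Z4: "supp s4 7 = ext E M (digit_set k)" using Z3 s4(5) unfolding M2 by (simp add: supp_def)
              have Z3': "supp s3 7 = ext E M (digit_set k)" using Z3 unfolding M2 .
              show "wp N (Cond (Reg 15) weigh Skip) P s4"
              proof (rule wp_Cond, goal_cases)
                case 1
                then have cf: "cycle_free E (ext E M (digit_set k))" using ok Z3' by simp
                have "sum (s4 3) (supp s4 7) \<le> sum ?W M" unfolding Z4 s4(2) using extM M.fin by (intro sum_mono2) auto
                then have lt4: "sum (s4 3) (supp s4 7) < 2 ^ N" using lt by linarith
                show ?case
                proof (rule weigh_wp[where ?s0.0 = s4, OF s4(1) lt4])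
                  fix s5 assume v: "s5 13 0 = max (s4 13 0) (sum (s4 3) (supp s4 7))" and fr5: "\<And>b. b \<notin> {10, 13, 16} \<Longrightarrow> s5 b = s4 b"
                  have "s5 14 0 = k mod n" using fr5 s4 by auto
                  moreover have "s5 13 0 = max (s 13 0) (?val k)" using v unfolding Z4 s4 .
                  ultimately show "P s5" using take[OF gs cf] mM by (intro P) (simp add: J_def)
                qed
              next
                case 2
                then have "\<not> cycle_free E (ext E M (digit_set k))" using ok Z3' by simp
                then show ?case using skip[OF gs] mM s4 by (intro wp_Skip P) (simp add: J_def)
              qed
            qed
          qed
          moreover have "k mod n < 2 ^ N" using dig(1) n_powers(1) by (intro less_N) linarith
          ultimately show ?case by (intro wp_Seq[of N "Assign 14 (Const 0) (Reg 22)"] wp_Assign_eq[where k = 0 and v = "k mod n"]) (simp_all add: d)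
        next
          case 2
          then have nd: "\<not> digit_set k \<subseteq> M" using c by blast
          have "s' 14 0 \<in> M" if "\<exists>q<Suc k. digit_set q \<subseteq> M"
          proof -
            from that nd have "\<exists>q<k. digit_set q \<subseteq> M" by (metis less_SucE)
            then show ?thesis using Jk s' by (simp add: J_def)
          qed
          then show ?case using skip[OF gs] nd s' by (intro wp_Skip P) (simp add: J_def)
        qed
      qed
      then show "wp N solve_body (\<lambda>s'. J (Suc k) (s'(12 := (s' 12)(0 := Suc k)))) s"
        by (simp add: P_def)
    next
      fix s assume Jn: "J (n * (n * (n * n))) s" and fr: "\<And>a. a \<notin> insert 12 (mods solve_body) \<Longrightarrow> s a = ?s1 a"
      obtain a b c d where abcd: "a \<in> M" "b \<in> M" "c \<in> M" "d \<in> M" "cycle_free E (ext E M {a, b, c, d})"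
          "sum ?W (ext E M {a, b, c, d}) = opt E ?W M"
        using M.prime_opt[OF M(3,2), of ?W] by blast
      then have "a < n" "b < n" "c < n" "d < n" using M(1) by (auto simp: supp_def)
      then obtain q where q: "q < n * (n * (n * n))" "digit_set q = {a, b, c, d}" using code4 by blast
      then have dq: "digit_set q \<subseteq> M" using abcd by simp
      have "s 14 0 \<in> M" using Jn q(1) dq unfolding J_def by blast
      moreover have "s 13 0 = opt E ?W M"
      proof (rule antisym)
        show "s 13 0 \<le> opt E ?W M" using Jn by (simp add: J_def good_def)
        have "?val q \<le> s 13 0" using Jn q dq abcd(5) unfolding J_def good_def by metis
        then show "opt E ?W M \<le> s 13 0" using abcd(6) q(2) by simp
      qed
      ultimately show "Q s" by (intro Q) (use fr in \<open>auto simp: ms mb\<close>)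
    qed (auto simp: mb)
  qed auto
qed

lemma contract_wp:
  assumes s0: "s0 0 = b0" and m: "s0 14 0 = m" "m < n"
    and Q: "\<And>s. supp s 4 = insert m (supp s0 4 - supp s0 5) \<Longrightarrow> s 3 = (s0 3)(m := s0 13 0) \<Longrightarrow>
      (\<And>b. b \<notin> {3, 4, 10} \<Longrightarrow> s b = s0 b) \<Longrightarrow> Q s"
  shows "wp N contract Q s0"
proof (rule wp_bounded)
  assume bs: "bounded_state N s0"
  show "wp N contract Q s0"
    unfolding contract_def
  proof (intro wp_Seq wp_fill[where f = "\<lambda>k. s0 4 k * (1 - s0 5 k)"])
    show "s0 0 = b0" by (rule s0)
    fix k show "s0 4 k * (1 - s0 5 k) < 2 ^ N"
      using bs by (cases "s0 5 k") (auto simp: bounded_state_def)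
  next
    fix s :: state assume s4: "\<And>j. s 4 j = (if j < n then s0 4 j * (1 - s0 5 j) else s0 4 j)"
      and fr: "\<And>b. b \<noteq> 4 \<Longrightarrow> b \<noteq> 10 \<Longrightarrow> s b = s0 b"
    let ?s2 = "s(4 := (s 4)(m := 1))"
    let ?s3 = "?s2(3 := (?s2 3)(m := s0 13 0))"
    have s: "s 14 0 = m" "s 13 = s0 13" "s 3 = s0 3" using fr m by auto
    have "supp ?s3 4 = insert m (supp s0 4 - supp s0 5)"
      using s4 m(2) by (auto simp: supp_def)
    moreover have "?s3 3 = (s0 3)(m := s0 13 0)" using s by simp
    ultimately have Q3: "Q ?s3" using fr by (intro Q) auto
    show "wp N (Assign 4 (Reg 14) (Const 1)) (wp N (Assign 3 (Reg 14) (Reg 13)) Q) s"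
    proof (rule wp_Assign_eq[where k = m and v = 1])
      show "wp N (Assign 3 (Reg 14) (Reg 13)) Q ?s2"
        by (rule wp_Assign_eq[where k = m and v = "s0 13 0"]) (use s bs Q3 in \<open>auto simp: bounded_state_def\<close>)
    qed (use s less_N[of 1] in auto)
  qed auto
qed

text \<open>As long as two vertices remain, a round contracts a set of at least two, so for
  \<open>n > 0\<close> a single vertex is left after \<open>n\<close> rounds and carries the
  optimum. The total weight never grows, because the weights of a set give way to its optimum; this
  keeps all later sums below \<open>2 ^ N\<close>.\<close>

lemma main_loop_wp:
  assumes s0: "s0 0 = b0" "supp s0 4 = {..<n}" "s0 13 0 = 0" and lt: "sum (s0 3) {..<n} < 2 ^ N"
    and Q: "\<And>s. s 13 0 = opt E (s0 3) {..<n} \<Longrightarrow> (\<And>b. b \<notin> mods main_loop \<Longrightarrow> s b = s0 b) \<Longrightarrow> Q s"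
  shows "wp N main_loop Q s0"
proof -
  \<comment> \<open>The alternative \<open>k = 0\<close> serves the empty tournament: no round is
    run, and the initial 0 in bank 13 is already the answer.\<close>
  define J where "J k s \<longleftrightarrow> (n > 0 \<longrightarrow> supp s 4 \<noteq> {}) \<and> opt E (s 3) (supp s 4) = opt E (s0 3) {..<n} \<and>
     sum (s 3) (supp s 4) \<le> sum (s0 3) {..<n} \<and> (card (supp s 4) + k \<le> n \<or> card (supp s 4) \<le> 1) \<and>
     (if k = 0 then s 13 0 = 0 else s 14 0 \<in> supp s 4 \<and> s 3 (s 14 0) = s 13 0)" for k s
  have msh: "mods shrink = {5, 6, 9, 10, 11, 20, 21, 26, 27, 28}" by (auto simp: mods_simps)
  have mso: "mods solve = {7, 10, 11, 12, 13, 14, 15, 16, 22, 23, 24, 25, 26, 27, 28}" by (auto simp: mods_solve)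
  have mco: "mods contract = {3, 4, 10}" by (auto simp: contract_def fill_def mods_For)
  have mb: "mods main_body = {3, 4, 5, 6, 7, 9, 10, 11, 12, 13, 14, 15, 16, 20, 21, 22, 23, 24, 25, 26, 27, 28}"
    by (auto simp: main_body_def msh mso mco)
  have mm: "mods main_loop = insert 8 (mods main_body)" by (simp add: main_loop_def mods_For)
  show ?thesis
    unfolding main_loop_def
  proof (rule wp_For[where m = n and J = J])
    show "\<And>s. s 0 = s0 0 \<Longrightarrow> aval nE s = n" using s0 b0_n by simp
    show "n \<le> N" using n_powers(1) N_ge by linarith
    have "supp (s0(8 := (s0 8)(0 := 0))) 4 = {..<n}" using s0(2) by (simp add: supp_def)
    then show "J 0 (s0(8 := (s0 8)(0 := 0)))" using s0(3) by (auto simp: J_def)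
  next
    fix k s assume k: "k < n" and Jk: "J k s" and fr: "\<And>a. a \<notin> insert 8 (mods main_body) \<Longrightarrow> s a = s0 a"
    have s: "s 0 = b0" using fr[of 0] s0 by (simp add: mb)
    define A where "A = supp s 4"
    define W where "W = s 3"
    interpret A: w5_free_tour A E using w5_free_tour.sub_w5_free[OF tour supp_subset] by (simp add: A_def)
    have A: "A \<noteq> {}" "opt E W A = opt E (s0 3) {..<n}" "sum W A \<le> sum (s0 3) {..<n}" "card A + k \<le> n \<or> card A \<le> 1"
      using Jk k by (auto simp: J_def A_def W_def)
    define P where "P = (\<lambda>s'. J (Suc k) (s'(8 := (s' 8)(0 := Suc k))))"
    have P: "P s'" if "J (Suc k) s'" for s' using that by (simp add: P_def J_def supp_def)
    have "wp N main_body P s"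
      unfolding main_body_def
    proof (rule wp_Seq, rule shrink_wp[where A = A])
      show "s 0 = b0" "A = supp s 4" by (simp_all add: s A_def)
    next
      fix s1 assume M: "homogeneous A E (supp s1 5)" "A \<noteq> {} \<Longrightarrow> supp s1 5 \<noteq> {}"
          "\<exists>x\<in>A. \<exists>y\<in>A. x \<noteq> y \<Longrightarrow> \<exists>x\<in>supp s1 5. \<exists>y\<in>supp s1 5. x \<noteq> y" "prime_tour (supp s1 5) E"
        and fr1: "\<And>b. b \<notin> mods shrink \<Longrightarrow> s1 b = s b"
      have s1: "s1 0 = b0" "s1 3 = W" "s1 4 = s 4" using fr1[of 0] fr1[of 3] fr1[of 4] s by (simp_all add: msh W_def)
      have MA: "supp s1 5 \<subseteq> A" using M(1) by (simp add: homogeneous_def)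
      have sumM: "sum W (supp s1 5) \<le> sum W A" using MA A.fin by (intro sum_mono2) auto
      show "wp N (Seq solve contract) P s1"
      proof (rule wp_Seq, rule solve_wp[where M = "supp s1 5"])
        show "s1 0 = b0" "supp s1 5 = supp s1 5" "prime_tour (supp s1 5) E" by (simp_all add: s1 M(4))
        show "supp s1 5 \<noteq> {}" using M(2) A(1) by simp
        show "sum (s1 3) (supp s1 5) < 2 ^ N" using s1(2) sumM A(3) lt by simp
      next
        fix s2 assume v: "s2 13 0 = opt E (s1 3) (supp s1 5)" and mM: "s2 14 0 \<in> supp s1 5"
          and fr2: "\<And>b. b \<notin> mods solve \<Longrightarrow> s2 b = s1 b"
        have s2: "s2 0 = b0" "s2 3 = W" "s2 4 = s 4" "s2 5 = s1 5"
          using fr2[of 0] fr2[of 3] fr2[of 4] fr2[of 5] s1 by (simp_all add: mso)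
        define m where "m = s2 14 0"
        have mn: "m < n" using mM by (simp add: m_def supp_def)
        have eqA: "supp s2 4 = A" "supp s2 5 = supp s1 5" using s2 by (simp_all add: supp_def A_def)
        show "wp N contract P s2"
        proof (rule contract_wp[where ?s0.0 = s2, OF s2(1) m_def[symmetric] mn])
          fix s3 assume A3: "supp s3 4 = insert m (supp s2 4 - supp s2 5)" and W3: "s3 3 = (s2 3)(m := s2 13 0)"
            and fr3: "\<And>b. b \<notin> {3, 4, 10} \<Longrightarrow> s3 b = s2 b"
          let ?M = "supp s1 5"
          have A3': "supp s3 4 = insert m (A - ?M)" using A3 unfolding eqA .
          have W3': "s3 3 = W(m := opt E W ?M)" using W3 v s1 s2 by simp
          have mM': "m \<in> ?M" using mM by (simp add: m_def)
          have o: "opt E (s3 3) (supp s3 4) = opt E (s0 3) {..<n}"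
            unfolding A3' W3' using A.opt_contract[OF M(1) mM'] A(2) by simp
          have "sum (s3 3) (supp s3 4) = opt E W ?M + sum W (A - ?M)"
            unfolding A3' W3' using A.fin mM' by (subst sum.insert) (auto intro!: sum.cong)
          also have "\<dots> \<le> sum W ?M + sum W (A - ?M)" using opt_le_sum[of ?M E W] by simp
          also have "\<dots> = sum W A" using sum.subset_diff[OF MA A.fin, of W] by simp
          finally have su: "sum (s3 3) (supp s3 4) \<le> sum (s0 3) {..<n}" using A(3) by simp
          have cA: "card (supp s3 4) = Suc (card A - card ?M)"
            unfolding A3' using A.fin mM' MA by (simp add: card_Diff_subset)
          have cMA: "card ?M \<le> card A" using MA A.fin by (rule card_mono[rotated])
          have "card (supp s3 4) + Suc k \<le> n \<or> card (supp s3 4) \<le> 1"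
          proof (cases "\<exists>x\<in>A. \<exists>y\<in>A. x \<noteq> y")
            case True
            then obtain x y where xy: "x \<in> ?M" "y \<in> ?M" "x \<noteq> y" using M(3) by blast
            then have "card {x, y} \<le> card ?M" by (intro card_mono) auto
            then have "2 \<le> card ?M" using xy by simp
            then show ?thesis using cA cMA A(4) by linarith
          next
            case False
            then have "card A \<le> 1" using card_le_Suc0_iff_eq[OF A.fin] by auto
            moreover have "card ?M \<noteq> 0" using mM' by auto
            ultimately show ?thesis using cA cMA by linarith
          qed
          moreover have "s3 14 0 = m" "s3 13 0 = opt E W ?M" using fr3 v s1 by (auto simp: m_def)
          ultimately show "P s3" using o su A3' W3' by (intro P) (simp add: J_def)
        qed
      qed
    qed
    then show "wp N main_body (\<lambda>s'. J (Suc k) (s'(8 := (s' 8)(0 := Suc k)))) s"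
      by (simp add: P_def)
  next
    fix s assume Jn: "J n s" and fr: "\<And>a. a \<notin> insert 8 (mods main_body) \<Longrightarrow> s a = s0 a"
    have "s 13 0 = opt E (s0 3) {..<n}"
    proof (cases "n = 0")
      case True
      have "opt E (s0 3) {} \<le> 0" using opt_le_sum[of "{}" E "s0 3"] by simp
      then show ?thesis using True Jn by (simp add: J_def)
    next
      case False
      have ne: "supp s 4 \<noteq> {}" using Jn False by (simp add: J_def)
      then have "0 < card (supp s 4)" by (simp add: card_gt_0_iff)
      then have "card (supp s 4) \<le> 1" using Jn by (auto simp: J_def)
      moreover have m: "s 14 0 \<in> supp s 4" "s 3 (s 14 0) = s 13 0" using Jn False by (auto simp: J_def)
      ultimately have e: "supp s 4 = {s 14 0}"
        by (metis One_nat_def card_1_singletonE le_antisym Suc_leI \<open>0 < card (supp s 4)\<close> singletonD)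
      have lt14: "s 14 0 < n" using m(1) by (simp add: supp_def)
      have "cycle_free E {s 14 0}"
        using w5_free_tour.irr[OF tour, of "s 14 0"] lt14 by (simp add: cycle_free_def)
      then have "sum (s 3) {s 14 0} \<le> opt E (s 3) {s 14 0}" by (intro opt_ge) auto
      moreover have "opt E (s 3) {s 14 0} \<le> sum (s 3) {s 14 0}" by (intro opt_le_sum) simp
      ultimately have "opt E (s 3) (supp s 4) = s 13 0" unfolding e using m(2) by simp
      then show ?thesis using Jn by (simp add: J_def)
    qed
    then show "Q s" by (rule Q) (use fr in \<open>auto simp: mm\<close>)
  qed (auto simp: mb)
qed

end

section \<open>Rational weights: common denominator, Euclid's algorithm, output\<close>

abbreviation numE :: "aexp \<Rightarrow> aexp" where
  "numE i \<equiv> Rd 0 (Add (Const 2) (Add (Mult nE nE) (Mult (Const 2) i)))"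
abbreviation denE :: "aexp \<Rightarrow> aexp" where
  "denE i \<equiv> Rd 0 (Add (Const 2) (Add (Mult nE nE) (Add (Mult (Const 2) i) (Const 1))))"

definition common_den :: com where
  "common_den = Seq (Assign 2 (Const 0) (Const 1)) (For 10 nE (Assign 2 (Const 0) (Mult (Reg 2) (denE (Reg 10)))))"

definition euclid_body :: com where
  "euclid_body = Seq (Assign 19 (Const 0) (Reg 18)) (Seq (Assign 18 (Const 0) (modE (Reg 17) (Reg 18))) (Assign 17 (Const 0) (Reg 19)))"

definition euclid :: com where
  "euclid = Seq (Assign 17 (Const 0) (Reg 13)) (Seq (Assign 18 (Const 0) (Reg 2)) (While (Reg 18) euclid_body))"

definition write_output :: com where
  "write_output = Seq (Assign 1 (Const 0) (Const 2)) (Seq (Assign 1 (Const 1) (Div (Reg 13) (Reg 17)))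
     (Assign 1 (Const 2) (Div (Reg 2) (Reg 17))))"

definition wmisp_prog :: com where
  "wmisp_prog = Seq common_den (Seq (fill 3 (Mult (numE (Reg 10)) (Div (Reg 2) (denE (Reg 10))))) (Seq (fill 4 (Const 1))
     (Seq main_loop (Seq euclid write_output))))"

text \<open>A potential for Euclid's algorithm. If \<open>b \<le> a\<close>, the remainder is at
  most half of \<open>a\<close>, so a logarithm drops; \<open>of_bool (a < b)\<close> pays for the
  step that merely exchanges the arguments.\<close>

definition euclid_steps :: "nat \<Rightarrow> nat \<Rightarrow> nat" where
  "euclid_steps a b = (if b = 0 then 0 else 1 + floor_log a + floor_log b + of_bool (a < b))"

lemma euclid_steps_less:
  assumes "b \<noteq> 0"
  shows "euclid_steps b (a mod b) < euclid_steps a b"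
proof (cases "a mod b = 0")
  case True
  then show ?thesis using assms by (simp add: euclid_steps_def)
next
  case r: False
  show ?thesis
  proof (cases "a < b")
    case True
    then show ?thesis using r by (simp add: euclid_steps_def)
  next
    case False
    have lt: "a mod b < b" using assms by simp
    have "1 \<le> a div b" using False assms by (simp add: Suc_le_eq div_greater_zero_iff)
    then have "b \<le> a div b * b" using mult_le_mono1[of 1 "a div b" b] by simp
    then have "b + a mod b \<le> a" using div_mult_mod_eq[of a b] by linarith
    then have "2 * (a mod b) \<le> a" using lt by simp
    then have "floor_log (2 * (a mod b)) \<le> floor_log a" by (rule floor_log_le_iff)
    moreover have "floor_log (2 * (a mod b)) = Suc (floor_log (a mod b))" using r by (simp add: floor_log_twice)
    ultimately show ?thesis using r assms lt by (simp add: euclid_steps_def)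
  qed
qed

lemma floor_log_less: "a < 2 ^ B \<Longrightarrow> floor_log a \<le> B"
  using bit_length_le[of a "Suc B"] by (simp add: bit_length_def)

text \<open>Both the common denominator and the total scaled weight are below \<open>2 ^ B\<close>,
  and \<open>2 * B + 2\<close> bounds the potential \<open>euclid_steps\<close> of two such
  numbers.\<close>

locale wmisp_weights = wmisp_ram +
  fixes num den :: "nat \<Rightarrow> nat" and B :: nat
  assumes b0_num: "\<And>i. i < n \<Longrightarrow> b0 (Suc (Suc (n * n + 2 * i))) = num i"
    and b0_den: "\<And>i. i < n \<Longrightarrow> b0 (Suc (Suc (Suc (n * n + 2 * i)))) = den i"
    and den_pos: "\<And>i. i < n \<Longrightarrow> 0 < den i"
    and den_bound: "(\<Prod>i<n. den i) < 2 ^ B"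
    and num_bound: "(\<Sum>i<n. num i * ((\<Prod>j<n. den j) div den i)) < 2 ^ B"
    and B_N: "2 * B + 2 \<le> N"
begin

definition D :: nat where "D = (\<Prod>i<n. den i)"
definition W :: "nat \<Rightarrow> nat" where "W i = num i * (D div den i)"

lemma B_less:
  fixes x :: nat
  assumes "x < 2 ^ B"
  shows "x < 2 ^ N"
proof -
  have "(2::nat) ^ B \<le> 2 ^ N" using B_N by (intro power_increasing) auto
  then show ?thesis using assms by linarith
qed

lemma D_pos: "0 < D"
  unfolding D_def using den_pos by (intro prod_pos) auto

lemma common_den_wp:
  assumes s0: "s0 0 = b0"
    and Q: "\<And>s. s 2 0 = D \<Longrightarrow> (\<And>b. b \<notin> {2, 10} \<Longrightarrow> s b = s0 b) \<Longrightarrow> Q s"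
  shows "wp N common_den Q s0"
  unfolding common_den_def
proof (rule wp_Seq, rule wp_Assign_eq[where k = 0 and v = 1])
  show "(1::nat) < 2 ^ N" using less_N[of 1] by simp
  let ?s1 = "s0(2 := (s0 2)(0 := 1))"
  let ?b = "Assign 2 (Const 0) (Mult (Reg 2) (denE (Reg 10)))"
  show "wp N (For 10 nE ?b) Q ?s1"
  proof (rule wp_For[where m = n and J = "\<lambda>k s. s 2 0 = (\<Prod>i<k. den i)"])
    show "\<And>s. s 0 = ?s1 0 \<Longrightarrow> aval nE s = n" using s0 b0_n by simp
    show "n \<le> N" using n_powers(1) N_ge by linarith
  next
    fix k s assume k: "k < n" and J: "s 2 0 = (\<Prod>i<k. den i)" and s10: "s 10 0 = k"
      and fr: "\<And>a. a \<notin> insert 10 (mods ?b) \<Longrightarrow> s a = ?s1 a"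
    have s: "s 0 = b0" using fr[of 0] s0 by simp
    have v: "aval (Mult (Reg 2) (denE (Reg 10))) s = (\<Prod>i<Suc k. den i)"
      using J s s10 b0_n b0_den[OF k] by simp
    have "(\<Prod>i<Suc k. den i) \<le> D"
    proof -
      have "D = (\<Prod>i<Suc k. den i) * (\<Prod>i=Suc k..<n. den i)"
        unfolding D_def lessThan_atLeast0 by (rule prod.atLeastLessThan_concat[symmetric]) (use k in auto)
      moreover have "1 \<le> (\<Prod>i=Suc k..<n. den i)" using den_pos by (simp add: Suc_le_eq prod_pos)
      ultimately show ?thesis by simp
    qed
    then have "(\<Prod>i<Suc k. den i) < 2 ^ N" using den_bound B_less unfolding D_def by (meson le_less_trans)
    then show "wp N ?b (\<lambda>s'. (s'(10 := (s' 10)(0 := Suc k))) 2 0 = (\<Prod>i<Suc k. den i)) s"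
      by (intro wp_Assign_eq[OF _ v]) auto
  next
    fix s assume "s 2 0 = (\<Prod>i<n. den i)" and fr: "\<And>a. a \<notin> insert 10 (mods ?b) \<Longrightarrow> s a = ?s1 a"
    then show "Q s" by (intro Q) (auto simp: D_def)
  qed auto
qed auto

lemma euclid_wp:
  assumes s0: "s0 13 0 < 2 ^ B" "s0 2 0 = D"
    and Q: "\<And>s. s 17 0 = gcd (s0 13 0) D \<Longrightarrow> (\<And>b. b \<notin> {17, 18, 19} \<Longrightarrow> s b = s0 b) \<Longrightarrow> Q s"
  shows "wp N euclid Q s0"
proof -
  let ?g = "gcd (s0 13 0) D"
  let ?I = "\<lambda>s::state. gcd (s 17 0) (s 18 0) = ?g \<and> s 17 0 < 2 ^ B \<and> s 18 0 < 2 ^ B \<and> (\<forall>b. b \<notin> {17, 18, 19} \<longrightarrow> s b = s0 b)"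
  let ?V = "\<lambda>s::state. euclid_steps (s 17 0) (s 18 0)"
  have DB: "D < 2 ^ B" using den_bound by (simp add: D_def)
  let ?s1 = "s0(17 := (s0 17)(0 := s0 13 0))"
  let ?s2 = "?s1(18 := (?s1 18)(0 := D))"
  have "wp N (While (Reg 18) euclid_body) Q ?s2"
  proof (rule wp_While[where I = ?I and V = ?V])
    show "?I ?s2" using s0 DB by auto
    have "euclid_steps (s0 13 0) D \<le> 1 + B + B + 1"
      unfolding euclid_steps_def using floor_log_less[OF s0(1)] floor_log_less[OF DB] by auto
    then show "?V ?s2 \<le> N" using B_N by simp
  next
    fix s assume I: "?I s" and b: "aval (Reg 18) s \<noteq> 0"
    let ?r = "s 17 0 mod s 18 0"
    have rB: "?r < 2 ^ B" using le_less_trans[OF mod_less_eq_dividend] I by blast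
    define P where "P = (\<lambda>s'. ?I s' \<and> ?V s' < ?V s)"
    let ?a = "s(19 := (s 19)(0 := s 18 0))"
    let ?b = "?a(18 := (?a 18)(0 := ?r))"
    let ?c = "?b(17 := (?b 17)(0 := s 18 0))"
    have "?I ?c" using I rB gcd_red_nat[of "s 17 0" "s 18 0"] by auto
    moreover have "?V ?c < ?V s" using euclid_steps_less[of "s 18 0" "s 17 0"] b by simp
    ultimately have Pc: "P ?c" unfolding P_def by blast
    have "wp N euclid_body P s"
      unfolding euclid_body_def
      by (rule wp_Seq, rule wp_Assign_eq[where k = 0 and v = "s 18 0"], simp, simp, use I B_less in blast,
          rule wp_Seq, rule wp_Assign_eq[where k = 0 and v = ?r], simp, simp add: minus_div_mult_eq_mod,
          use rB B_less in blast, rule wp_Assign_eq[where k = 0 and v = "s 18 0"], simp, simp, use I B_less in blast, rule Pc)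
    then show "wp N euclid_body (\<lambda>s'. ?I s' \<and> ?V s' < ?V s) s" unfolding P_def .
  next
    fix s assume "?I s" "aval (Reg 18) s = 0"
    then show "Q s" by (intro Q) auto
  qed
  then show ?thesis
    unfolding euclid_def
    by (intro wp_Seq wp_Assign_eq[where a = 17 and k = 0 and v = "s0 13 0"] wp_Assign_eq[where a = 18 and k = 0 and v = D])
      (use s0 B_less DB in auto)
qed

lemma W_le: "i < n \<Longrightarrow> W i < 2 ^ B"
proof -
  assume i: "i < n"
  have "W i \<le> (\<Sum>i<n. W i)" using i by (intro member_le_sum) auto
  also have "\<dots> < 2 ^ B" using num_bound by (simp add: W_def D_def)
  finally show ?thesis .
qed

text \<open>The answer is the optimum of the scaled weights over \<open>D\<close>; dividing both by
  their gcd produces the lowest terms that \<open>encode_rat\<close> prescribes.\<close>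

lemma wmisp_prog_wp:
  assumes s0: "s0 0 = b0" "s0 13 0 = 0"
  shows "wp N wmisp_prog (\<lambda>s. s 1 0 = 2 \<and> s 1 1 = opt E W {..<n} div gcd (opt E W {..<n}) D \<and>
    s 1 2 = D div gcd (opt E W {..<n}) D) s0"
  unfolding wmisp_prog_def
proof (rule wp_Seq, rule common_den_wp[where ?s0.0 = s0, OF s0(1)])
  let ?O = "opt E W {..<n}"
  let ?P = "\<lambda>s. s 1 0 = 2 \<and> s 1 1 = ?O div gcd ?O D \<and> s 1 2 = D div gcd ?O D"
  fix s1 assume D1: "s1 2 0 = D" and fr1: "\<And>b. b \<notin> {2, 10} \<Longrightarrow> s1 b = s0 b"
  show "wp N (Seq (fill 3 (Mult (numE (Reg 10)) (Div (Reg 2) (denE (Reg 10))))) (Seq (fill 4 (Const 1))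
     (Seq main_loop (Seq euclid write_output)))) ?P s1"
  proof (rule wp_Seq, rule wp_fill[where f = W])
    show s1: "s1 0 = b0" using fr1 s0 by simp
    show "\<And>k. k < n \<Longrightarrow> W k < 2 ^ N" using W_le B_less by blast
    fix s :: state and k assume "k < n" "s 10 0 = k" "\<And>b. b \<noteq> 3 \<Longrightarrow> b \<noteq> 10 \<Longrightarrow> s b = s1 b"
    then show "aval (Mult (numE (Reg 10)) (Div (Reg 2) (denE (Reg 10)))) s = W k"
      using s1 D1 b0_n b0_num b0_den by (simp add: W_def)
  next
    fix s2 :: state assume W2: "\<And>j. s2 3 j = (if j < n then W j else s1 3 j)" and fr2: "\<And>b. b \<noteq> 3 \<Longrightarrow> b \<noteq> 10 \<Longrightarrow> s2 b = s1 b"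
    show "wp N (Seq (fill 4 (Const 1)) (Seq main_loop (Seq euclid write_output))) ?P s2"
    proof (rule wp_Seq, rule wp_fill[where f = "\<lambda>_. 1"])
      show "s2 0 = b0" using fr2 fr1 s0 by simp
      show "\<And>k. k < n \<Longrightarrow> (1::nat) < 2 ^ N" using less_N[of 1] by simp
    next
      fix s3 :: state assume A3: "\<And>j. s3 4 j = (if j < n then 1 else s2 4 j)" and fr3: "\<And>b. b \<noteq> 4 \<Longrightarrow> b \<noteq> 10 \<Longrightarrow> s3 b = s2 b"
      have W3: "s3 3 j = W j" if "j < n" for j using fr3 W2 that by simp
      have s3: "s3 0 = b0" "s3 13 0 = 0" "s3 2 0 = D" using fr3 fr2 fr1 s0 D1 by simp_all
      have sumW: "sum (s3 3) {..<n} < 2 ^ B" using num_bound W3 by (simp add: W_def D_def)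
      have optW: "opt E (s3 3) {..<n} = ?O" using W3 by (intro opt_cong) auto
      show "wp N (Seq main_loop (Seq euclid write_output)) ?P s3"
      proof (rule wp_Seq, rule main_loop_wp[where ?s0.0 = s3, OF s3(1) _ s3(2)])
        show "supp s3 4 = {..<n}" using A3 by (auto simp: supp_def)
        show "sum (s3 3) {..<n} < 2 ^ N" using sumW B_less by blast
      next
        fix s4 assume O4: "s4 13 0 = opt E (s3 3) {..<n}" and fr4: "\<And>b. b \<notin> mods main_loop \<Longrightarrow> s4 b = s3 b"
        have "s4 2 = s3 2"
          by (rule fr4) (auto simp: main_loop_def main_body_def contract_def mods_simps mods_solve)
        then have D4: "s4 2 0 = D" using s3 by simp
        have OB: "?O < 2 ^ B" using opt_le_sum[of "{..<n}" E "s3 3"] sumW optW by simp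
        show "wp N (Seq euclid write_output) ?P s4"
        proof (rule wp_Seq, rule euclid_wp[where ?s0.0 = s4, OF _ D4])
          show "s4 13 0 < 2 ^ B" using O4 optW OB by simp
        next
          fix s5 assume g: "s5 17 0 = gcd (s4 13 0) D" and fr5: "\<And>b. b \<notin> {17, 18, 19} \<Longrightarrow> s5 b = s4 b"
          have s5: "s5 17 0 = gcd ?O D" "s5 13 0 = ?O" "s5 2 0 = D" using g fr5 O4 optW D4 by auto
          have l: "?O div gcd ?O D < 2 ^ N" "D div gcd ?O D < 2 ^ N" "(2::nat) < 2 ^ N"
          proof -
            have "D < 2 ^ B" using den_bound by (simp add: D_def)
            then show "?O div gcd ?O D < 2 ^ N" "D div gcd ?O D < 2 ^ N"
              using OB B_less[of ?O] B_less[of D] div_le_dividend[of ?O "gcd ?O D"] div_le_dividend[of D "gcd ?O D"] by linarith+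
            have "2 \<le> (n + 2) ^ 4" using power_increasing[of 1 4 "n + 2"] by simp
            then show "(2::nat) < 2 ^ N" by (rule less_N)
          qed
          show "wp N write_output ?P s5"
            unfolding write_output_def
            by (rule wp_Seq, rule wp_Assign_eq[where k = 0 and v = 2], simp, simp, rule l(3), rule wp_Seq,
                rule wp_Assign_eq[where k = 1 and v = "?O div gcd ?O D"], simp, use s5 in simp, rule l(1),
                rule wp_Assign_eq[where k = 2 and v = "D div gcd ?O D"], simp, use s5 in simp, rule l(2), simp)
        qed
      qed
    qed auto
  qed auto
qed

end

section \<open>Encodings\<close>

lemma tournament_arcs:
  assumes "tournament V E"
  shows "finite V" "\<And>x. (x, x) \<notin> E" "\<And>x y. x \<in> V \<Longrightarrow> y \<in> V \<Longrightarrow> x \<noteq> y \<Longrightarrow> (x, y) \<in> E \<longleftrightarrow> (y, x) \<notin> E"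
  using assms unfolding tournament_def total_on_def by (auto dest: asymD)

lemma W5_free_tour:
  assumes t: "tournament V E" and W: "W5_free V E"
  shows "w5_free_tour V E"
proof
  note T = tournament_arcs[OF t]
  show "finite V" by (rule T)
  show "\<And>x. (x, x) \<notin> E" by (rule T)
  show "\<And>x y. x \<in> V \<Longrightarrow> y \<in> V \<Longrightarrow> x \<noteq> y \<Longrightarrow> (x, y) \<in> E \<longleftrightarrow> (y, x) \<notin> E" by (rule T)
  fix v w1 w2 w3 w4
  assume V: "v \<in> V" "w1 \<in> V" "w2 \<in> V" "w3 \<in> V" "w4 \<in> V"
  show "\<not> forms_W5 E v w1 w2 w3 w4"
  proof
    assume "forms_W5 E v w1 w2 w3 w4"
    then have A: "(w1, w2) \<in> E" "(w1, w3) \<in> E" "(w1, w4) \<in> E" "(w2, w3) \<in> E" "(w2, w4) \<in> E"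
         "(w3, w4) \<in> E" "(w2, v) \<in> E" "(w4, v) \<in> E" "(v, w1) \<in> E" "(v, w3) \<in> E" by blast+
    have as: "(b, a) \<notin> E" if "(a, b) \<in> E" for a b
      using that t unfolding tournament_def by (blast dest: asymD)
    note N = A[THEN as]
    have D: "distinct [v, w1, w2, w3, w4]" using A N by auto
    have D': "distinct [w4, w3, w2, w1, v]" using D by auto
    let ?X = "{v, w1, w2, w3, w4}"
    define f where "f x = (if x = v then 0 else if x = w1 then 1 else if x = w2 then 2 else if x = w3 then 3 else (4::nat))" for x
    have fv: "f v = 0" "f w1 = 1" "f w2 = 2" "f w3 = 3" "f w4 = 4" using D by (auto simp: f_def)
    have "bij_betw f ?X W5_verts"
      unfolding bij_betw_def inj_on_def W5_verts_def by (simp add: fv)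
    moreover have "\<forall>x\<in>?X. \<forall>y\<in>?X. (x, y) \<in> Restr E ?X \<longleftrightarrow> (f x, f y) \<in> W5_arcs"
      using A N T(2) D D' by (simp add: fv W5_arcs_def)
    ultimately have "isomorphic ?X (Restr E ?X) W5_verts W5_arcs" unfolding isomorphic_def by blast
    moreover have "?X \<subseteq> V" using V by blast
    ultimately show False using W unfolding W5_free_def tournament_free_def by blast
  qed
qed

text \<open>Transitivity of a tournament can fail only at a 3-cycle, because \<open>x\<close>,
  \<open>y\<close>, \<open>z\<close> with coinciding ends would give a loop or a pair of opposite
  arcs.\<close>

lemma independent_set_iff:
  assumes t: "tournament V E"
  shows "independent_set V E X \<longleftrightarrow> X \<subseteq> V \<and> cycle_free E X"
proof -
  note T = tournament_arcs[OF t]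
  have "trans (Restr E X) \<longleftrightarrow> cycle_free E X" if X: "X \<subseteq> V"
  proof
    assume tr: "trans (Restr E X)"
    show "cycle_free E X"
      unfolding cycle_free_def
    proof (intro ballI notI)
      fix x y z assume m: "x \<in> X" "y \<in> X" "z \<in> X" and c: "cycle3 E x y z"
      then have "(x, z) \<in> Restr E X" using transD[OF tr, of x y z] by blast
      then show False using T(2)[of x] T(3)[of x z] c m X by (cases "x = z") auto
    qed
  next
    assume cf: "cycle_free E X"
    show "trans (Restr E X)"
    proof (rule transI)
      fix x y z assume c: "(x, y) \<in> Restr E X" "(y, z) \<in> Restr E X"
      then have m: "x \<in> V" "y \<in> V" "z \<in> V" "x \<in> X" "y \<in> X" "z \<in> X" using X by auto
      have "x \<noteq> z" using c T(2)[of x] T(3)[of x y] m by (cases "x = y") auto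
      moreover have "(z, x) \<notin> E" using cf c m unfolding cycle_free_def by blast
      ultimately show "(x, z) \<in> Restr E X" using T(3)[of x z] m by blast
    qed
  qed
  then show ?thesis unfolding independent_set_def by blast
qed

text \<open>Division by \<open>d\<close> is monotone and therefore commutes with the
  maximum.\<close>

lemma max_independent_weight_scaled:
  assumes t: "tournament V E" and d: "0 < d" and w: "\<And>v. v \<in> V \<Longrightarrow> w v = of_nat (W v) / of_nat d"
  shows "max_independent_weight V E w = of_nat (opt E W V) / of_nat d"
proof -
  let ?S = "{X. X \<subseteq> V \<and> cycle_free E X}"
  let ?f = "\<lambda>k::nat. of_nat k / of_nat d :: rat"
  have fin: "finite V" by (rule tournament_arcs[OF t])
  have s: "sum w X = ?f (sum W X)" if "X \<subseteq> V" for X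
    using that w by (simp add: sum_divide_distrib subset_iff)
  have "{\<Sum>v\<in>X. w v | X. independent_set V E X} = sum w ` ?S"
    unfolding independent_set_iff[OF t] by blast
  also have "\<dots> = ?f ` (sum W ` ?S)"
    unfolding image_image by (rule image_cong[OF refl], rule s) blast
  finally have "{\<Sum>v\<in>X. w v | X. independent_set V E X} = ?f ` (sum W ` ?S)" .
  moreover have "Max (?f ` (sum W ` ?S)) = ?f (Max (sum W ` ?S))"
  proof (rule mono_Max_commute[symmetric])
    show "mono ?f" using d by (intro monoI divide_right_mono) auto
    show "finite (sum W ` ?S)" using fin by simp
    show "sum W ` ?S \<noteq> {}" using cycle_free_empty by blast
  qed
  ultimately show ?thesis unfolding max_independent_weight_def opt_def by simp
qed

lemma encode_rat_quotient:
  assumes "0 < d"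
  shows "encode_rat (of_nat a / of_nat d) = [a div gcd a d, d div gcd a d]"
proof -
  have "(of_nat a / of_nat d :: rat) = Fract (int a) (int d)" by (simp add: Fract_of_int_quotient)
  then have "quotient_of (of_nat a / of_nat d) = (int a div gcd (int a) (int d), int d div gcd (int a) (int d))"
    using assms by (simp add: quotient_of_Fract normalize_def Let_def)
  then show ?thesis by (simp add: encode_rat_def zdiv_int[symmetric])
qed

text \<open>Locates the entries of the row-by-row matrix and of the list of numerators and
  denominators.\<close>

lemma concat_uniform:
  assumes "\<And>i. length (f i) = m"
  shows "length (concat (map f [0..<n])) = n * m"
    and "i < n \<Longrightarrow> j < m \<Longrightarrow> concat (map f [0..<n]) ! (i * m + j) = f i ! j"
proof -
  show len: "length (concat (map f [0..<n])) = n * m" for n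
    by (induction n) (simp_all add: assms)
  show "i < n \<Longrightarrow> j < m \<Longrightarrow> concat (map f [0..<n]) ! (i * m + j) = f i ! j"
  proof (induction n)
    case (Suc n)
    show ?case
    proof (cases "i = n")
      case True
      then show ?thesis using len[of n] Suc.prems by (simp add: nth_append)
    next
      case False
      then have "i < n" using Suc.prems by simp
      then have "Suc i * m \<le> n * m" by (intro mult_le_mono1) simp
      then have "i * m + j < n * m" using Suc.prems by simp
      then show ?thesis using len[of n] Suc.IH \<open>i < n\<close> Suc.prems by (simp add: nth_append)
    qed
  qed simp
qed

section \<open>Sizes of encoded instances\<close>

lemma less_two_bit_length: "k < 2 ^ bit_length k"
  unfolding bit_length_def by (cases "k = 0") (simp_all add: floor_log_exp2_gt)

lemma bit_length_ge_1: "1 \<le> bit_length k"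
  by (simp add: bit_length_def)

lemma input_size_append: "input_size (xs @ ys) = input_size xs + input_size ys"
  by (simp add: input_size_def)

lemma input_size_concat: "input_size (concat (map f [0..<n])) = (\<Sum>i<n. input_size (f i))"
  by (induction n) (simp_all add: input_size_def)

lemma length_le_input_size: "length xs \<le> input_size xs"
proof (induction xs)
  case (Cons a xs)
  then show ?case using bit_length_ge_1[of a] by (simp add: input_size_def)
qed simp

lemma member_less_input_size: "x \<in> set xs \<Longrightarrow> x < 2 ^ input_size xs"
proof -
  assume "x \<in> set xs"
  then have "bit_length x \<le> input_size xs" unfolding input_size_def by (simp add: member_le_sum_list)
  then have "(2::nat) ^ bit_length x \<le> 2 ^ input_size xs" by (intro power_increasing) auto
  then show ?thesis using less_two_bit_length[of x] by linarith
qed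

text \<open>Keeps the common denominator short: its binary length is controlled by the total length
  of all denominators.\<close>

lemma prod_le_two_power:
  "finite I \<Longrightarrow> (\<Prod>i\<in>I. f i) \<le> (2::nat) ^ (\<Sum>i\<in>I. bit_length (f i))"
proof (induction I rule: finite_induct)
  case (insert i I)
  have "f i * prod f I \<le> 2 ^ bit_length (f i) * 2 ^ (\<Sum>i\<in>I. bit_length (f i))"
    using insert.IH less_two_bit_length[of "f i"] by (intro mult_mono) auto
  then show ?case using insert.hyps by (simp add: power_add)
qed simp

text \<open>The scaled total is a sum of \<open>n \<le> 2 ^ sz\<close> terms, each a product of two
  numbers of size at most \<open>2 ^ sz\<close>; this gives \<open>B = 3 * sz + 1\<close>.
  \<open>N\<close> is the loop bound \<open>(sz + 2) ^ 4\<close> plus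
  \<open>2 * B + 2\<close>.\<close>

lemma wmisp_time:
  assumes t: "tournament {..<n} E" and W5: "W5_free {..<n} E" and w: "\<And>v. v < n \<Longrightarrow> 0 \<le> w v"
    and xs: "xs = encode_instance (n, E, w)" and sz: "sz = input_size xs" and N: "N = (sz + 2) ^ 4 + 6 * sz + 4"
  shows "\<exists>u s. exec wmisp_prog (init_state xs) u s \<and> holds_output s (encode_rat (wmisp (n, E, w))) \<and>
    u \<le> time_bound wmisp_prog N"
proof -
  define num where "num v = nat (fst (quotient_of (w v)))" for v
  define den where "den v = nat (snd (quotient_of (w v)))" for v
  define adj where "adj = concat (map (\<lambda>i. map (\<lambda>j. of_bool ((i, j) \<in> E) :: nat) [0..<n]) [0..<n])"
  define wts where "wts = concat (map (\<lambda>i. [num i, den i]) [0..<n])"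
  have enc: "encode_rat (w i) = [num i, den i]" for i
    by (simp add: encode_rat_def num_def den_def split: prod.split)
  have xs': "xs = n # adj @ wts"
    unfolding xs encode_instance_def adj_def wts_def enc[symmetric] by simp
  have ladj: "length adj = n * n" unfolding adj_def by (rule concat_uniform) simp
  have lwts: "length wts = n * 2" unfolding wts_def by (rule concat_uniform) simp
  have adj_nth: "adj ! (i * n + j) = of_bool ((i, j) \<in> E)" if "i < n" "j < n" for i j
    unfolding adj_def using that by (subst concat_uniform(2)) auto
  have wts_nth: "wts ! (i * 2 + j) = [num i, den i] ! j" if "i < n" "j < 2" for i j
    unfolding wts_def using that by (subst concat_uniform(2)) auto
  define b0 where "b0 = init_state xs 0"
  have b0_0: "b0 (Suc 0) = n" by (simp add: b0_def init_state_def xs')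
  have b0_S: "b0 (Suc (Suc k)) = (adj @ wts) ! k" if "k < n * n + n * 2" for k
    using that ladj lwts by (simp add: b0_def init_state_def xs')
  have b0_E: "b0 (Suc (Suc (i * n + j))) = of_bool ((i, j) \<in> E)" if ij: "i < n" "j < n" for i j
  proof -
    have "Suc i * n \<le> n * n" using ij by (intro mult_le_mono1) simp
    then have "i * n + j < n * n" using ij by simp
    then show ?thesis using b0_S[of "i * n + j"] ladj adj_nth[OF ij] by (simp add: nth_append)
  qed
  have b0_num: "b0 (Suc (Suc (n * n + 2 * i))) = num i" if "i < n" for i
    using b0_S[of "n * n + 2 * i"] ladj wts_nth[OF that, of 0] that by (simp add: nth_append mult.commute)
  have b0_den: "b0 (Suc (Suc (Suc (n * n + 2 * i)))) = den i" if "i < n" for i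
    using b0_S[of "Suc (n * n + 2 * i)"] ladj wts_nth[OF that, of 1] that by (simp add: nth_append mult.commute)
  have den_pos: "0 < den v" for v using quotient_of_denom_pos'[of "w v"] by (simp add: den_def)
  have w_eq: "w v = of_nat (num v) / of_nat (den v)" if "v < n" for v
  proof -
    obtain a b where ab: "quotient_of (w v) = (a, b)" by fastforce
    then have b: "0 < b" using quotient_of_denom_pos by blast
    have e: "w v = of_int a / of_int b" using quotient_of_div[OF ab] .
    then have "0 \<le> a" using w[OF that] b by (simp add: zero_le_divide_iff)
    then show ?thesis using e ab b by (simp add: num_def den_def)
  qed
  define d where "d = (\<Prod>i<n. den i)"
  have set_wts: "num i \<in> set xs" if "i < n" for i
    using that by (force simp: xs' wts_def)
  \<comment> \<open>In binary, the entry \<open>n\<close> alone contributes only logarithmically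
    many digits; the bound comes from the length of the list, as each entry has at least one
    digit.\<close>
  have n_sz: "n \<le> sz" using length_le_input_size[of xs] ladj unfolding sz xs' by (simp add: xs') (cases n, auto)
  have "(\<Sum>i<n. bit_length (den i)) \<le> input_size wts"
    unfolding wts_def input_size_concat by (intro sum_mono) (simp add: input_size_def)
  also have "\<dots> \<le> sz" unfolding sz xs' using input_size_append[of "n # adj" wts] by simp
  finally have "(2::nat) ^ (\<Sum>i<n. bit_length (den i)) \<le> 2 ^ sz" by (intro power_increasing) auto
  then have d_le: "d \<le> 2 ^ sz"
    unfolding d_def by (rule order_trans[OF prod_le_two_power[OF finite_lessThan]])
  have sum_le: "(\<Sum>i<n. num i * (d div den i)) \<le> 2 ^ (3 * sz)"
  proof -
    have "(\<Sum>i<n. num i * (d div den i)) \<le> (\<Sum>i<n. 2 ^ sz * 2 ^ sz)"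
    proof (intro sum_mono mult_mono)
      fix i assume "i \<in> {..<n}"
      then show "num i \<le> 2 ^ sz" using member_less_input_size[OF set_wts[of i]] sz by simp
      show "d div den i \<le> 2 ^ sz" using d_le div_le_dividend le_trans by blast
    qed auto
    also have "\<dots> = n * (2 ^ sz * 2 ^ sz)" by simp
    also have "\<dots> \<le> 2 ^ sz * (2 ^ sz * 2 ^ sz)" using n_sz less_exp[of sz] by (intro mult_le_mono1) linarith
    also have "\<dots> = 2 ^ (3 * sz)" by (simp add: power_add[symmetric])
    finally show ?thesis .
  qed
  interpret wmisp_weights n N E b0 num den "3 * sz + 1"
  proof (intro wmisp_weights.intro wmisp_ram.intro wmisp_weights_axioms.intro)
    show "b0 (Suc 0) = n" by (rule b0_0)
    show "w5_free_tour {..<n} E" by (rule W5_free_tour[OF t W5])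
    have "(n + 2) ^ 4 \<le> (sz + 2) ^ 4" using n_sz by (intro power_mono) auto
    then show "(n + 2) ^ 4 \<le> N" unfolding N by linarith
    have "(2::nat) ^ sz < 2 ^ (3 * sz + 1)" by (intro power_strict_increasing) auto
    then show "(\<Prod>i<n. den i) < 2 ^ (3 * sz + 1)" using d_le unfolding d_def by linarith
    have "(2::nat) ^ (3 * sz) < 2 ^ (3 * sz + 1)" by (intro power_strict_increasing) auto
    then show "(\<Sum>i<n. num i * ((\<Prod>j<n. den j) div den i)) < 2 ^ (3 * sz + 1)" using sum_le unfolding d_def by linarith
    show "2 * (3 * sz + 1) + 2 \<le> N" unfolding N by simp
  qed (use b0_E b0_num b0_den den_pos in auto)
  let ?O = "opt E W {..<n}"
  have init0: "init_state xs 0 = b0" "init_state xs 13 0 = 0" by (simp_all add: b0_def init_state_def)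
  have "bounded_state N (init_state xs)"
    unfolding bounded_state_def
  proof (intro allI)
    fix a i
    have le: "(2::nat) ^ sz \<le> 2 ^ N" unfolding N by (intro power_increasing) auto
    have "(length xs # xs) ! i < 2 ^ sz" if "i \<le> length xs"
    proof (cases i)
      case 0
      then show ?thesis using le_less_trans[OF length_le_input_size less_exp, of xs] sz by simp
    next
      case (Suc j)
      then have "xs ! j \<in> set xs" using that by simp
      then show ?thesis using member_less_input_size[of "xs ! j" xs] Suc sz by simp
    qed
    then show "init_state xs a i < 2 ^ N" using less_le_trans[OF _ le] by (simp add: init_state_def)
  qed
  then obtain u s where e: "exec wmisp_prog (init_state xs) u s" "u \<le> time_bound wmisp_prog N"
      and o: "s 1 0 = 2" "s 1 1 = ?O div gcd ?O D" "s 1 2 = D div gcd ?O D"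
    using wmisp_prog_wp[of "init_state xs", OF init0] unfolding wp_def by blast
  have "w v = of_nat (W v) / of_nat D" if "v \<in> {..<n}" for v
  proof -
    have "den v dvd D" unfolding D_def using that by (intro dvd_prodI) auto
    then obtain k where k: "D = den v * k" by blast
    then show ?thesis using w_eq[of v] that den_pos[of v] D_pos by (simp add: W_def)
  qed
  then have "wmisp (n, E, w) = of_nat ?O / of_nat D"
    unfolding wmisp_def using max_independent_weight_scaled[OF t D_pos, of w W] by simp
  then have enc_o: "encode_rat (wmisp (n, E, w)) = [?O div gcd ?O D, D div gcd ?O D]"
    using encode_rat_quotient[OF D_pos] by simp
  have "holds_output s (encode_rat (wmisp (n, E, w)))"
    unfolding holds_output_def enc_o using o by (auto simp: le_Suc_eq numeral_2_eq_2)
  then show ?thesis using e by blast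
qed

theorem theorem1p3:
  shows "poly_time_solvable encode_instance encode_rat
     {(n, E, w) \<in> wmisp_instances. W5_free {..<n} E} wmisp"
proof -
  obtain p :: "nat poly" where p: "\<And>N. time_bound wmisp_prog N = poly p N" using time_bound_poly by blast
  \<comment> \<open>The number \<open>N\<close> of \<open>wmisp_time\<close> as a polynomial in the
    input size, to be substituted into the time bound of the fixed program.\<close>
  let ?q = "[:2, 1:] ^ 4 + [:4, 6:] :: nat poly"
  have q: "poly ?q x = (x + 2) ^ 4 + 6 * x + 4" for x by (simp add: algebra_simps)
  have "\<exists>t s. exec wmisp_prog (init_state (encode_instance x)) t s \<and> holds_output s (encode_rat (wmisp x)) \<and>
        t \<le> poly (pcompose p ?q) (input_size (encode_instance x))"
    if x: "x \<in> {(n, E, w) \<in> wmisp_instances. W5_free {..<n} E}" for x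
  proof -
    obtain n E w where nEw: "x = (n, E, w)" by (cases x)
    then have "tournament {..<n} E" "\<And>v. v < n \<Longrightarrow> 0 \<le> w v" "W5_free {..<n} E"
      using x by (auto simp: wmisp_instances_def)
    from wmisp_time[OF this(1,3,2) refl refl refl]
    show ?thesis unfolding nEw poly_pcompose q p .
  qed
  then show ?thesis unfolding poly_time_solvable_def by blast
qed

end
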